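(* Let $S$ be the Riemann sphere, $X$ a compact connected Riemann surface, and $f:X\to S$ a branched covering. Suppose that $f$ is subject to a branching datum of one of the types $(n,n)$, $(2,2,n)$ (with $n\ge 2$ an integer), $(2,3,3)$, $(2,3,4)$, $(2,3,5)$. Then $X$ is the Riemann sphere and $f$ is dominated by one of the following coverings: the quotient map $S\to S/G\cong S$, where $G$ is (i) the cyclic group of rotations by angle $2\pi/m$ around an axis; (ii) the group of rotational symmetries of a regular $m$-gon lying on a big circle of the sphere; (iii) the group of rotational symmetries of a regular tetrahedron; (iv) the group of rotational symmetries of a cube (or its dual octahedron); (v) the group of rotational symmetries of an icosahedron (or its dual dodecahedron).
   Context: Branched covering: a non-constant holomorphic map between compact connected Riemann surfaces. The order of branching of $f$ at $x_0$ is the integer $k\ge1$ such that in suitable local coordinates around $x_0$ and $f(x_0)$ the map is $x\mapsto x^k$. A branching datum on $S$ is a finite collection of distinct points $p_1,\ldots,p_b\in S$ with integers $n_1,\ldots,n_b\ge 2$; its type is $(n_1,\ldots,n_b)$ (order of entries irrelevant, location of the points arbitrary). A branched covering $f:X\to S$ is subject to this branching datum if for each $i$ the order of branching of $f$ at every preimage of $p_i$ divides $n_i$, and $f$ is unbranched over all other points of $S$. A branched covering $g:Z\to Y$ dominates $f:X\to Y$ if there is a holomorphic map $h:Z\to X$ with $f\circ h=g$. The quotient $S/G$ is identified with $S$ by an arbitrary biholomorphism $S/G\cong S$: the coverings in the list are taken up to isomorphism of the total space and of the base. The group in (i) has order $m\ge 1$, that in (ii) is the dihedral group of order $2m$ (for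 $m=2$, the Klein four-group of rotations). *)

theory Defs
  imports "HOL-Analysis.Analysis" "HOL-Library.Multiset"
begin

section \<open>Riemann surfaces\<close>

record 'a surface =
  carrier_top :: "'a topology"
  atlas :: "('a set \<times> ('a \<Rightarrow> complex)) set"

abbreviation points :: "'a surface \<Rightarrow> 'a set" where
  "points X \<equiv> topspace (carrier_top X)"

definition complex_chart :: "'a topology \<Rightarrow> 'a set \<Rightarrow> ('a \<Rightarrow> complex) \<Rightarrow> bool" where
  "complex_chart T U \<phi> \<longleftrightarrow>
     openin T U \<and> open (\<phi> ` U) \<and>
     homeomorphic_map (subtopology T U) (top_of_set (\<phi> ` U)) \<phi>"

definition holomorphic_transition ::
  "('a set \<times> ('a \<Rightarrow> complex)) \<Rightarrow> ('a set \<times> ('a \<Rightarrow> complex)) \<Rightarrow> bool" where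
  "holomorphic_transition c d \<longleftrightarrow>
     (case (c, d) of ((U, \<phi>), (V, \<psi>)) \<Rightarrow>
       (\<psi> \<circ> inv_into U \<phi>) holomorphic_on \<phi> ` (U \<inter> V))"

text \<open>Second countability is not required: it is automatic for compact surfaces.\<close>

definition riemann_surface :: "'a surface \<Rightarrow> bool" where
  "riemann_surface X \<longleftrightarrow>
     Hausdorff_space (carrier_top X) \<and>
     (\<forall>(U, \<phi>) \<in> atlas X. complex_chart (carrier_top X) U \<phi>) \<and>
     (\<Union>(U, \<phi>) \<in> atlas X. U) = points X \<and>
     (\<forall>c \<in> atlas X. \<forall>d \<in> atlas X. holomorphic_transition c d)"

definition compact_connected_riemann_surface :: "'a surface \<Rightarrow> bool" where
  "compact_connected_riemann_surface X \<longleftrightarrow>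
     riemann_surface X \<and> compact_space (carrier_top X) \<and> connected_space (carrier_top X)"

text \<open>The charts of the maximal atlas.\<close>

definition local_coordinate :: "'a surface \<Rightarrow> 'a set \<Rightarrow> ('a \<Rightarrow> complex) \<Rightarrow> bool" where
  "local_coordinate X U \<phi> \<longleftrightarrow>
     complex_chart (carrier_top X) U \<phi> \<and>
     (\<forall>c \<in> atlas X. holomorphic_transition c (U, \<phi>) \<and> holomorphic_transition (U, \<phi>) c)"

definition holomorphic_map :: "'a surface \<Rightarrow> 'b surface \<Rightarrow> ('a \<Rightarrow> 'b) \<Rightarrow> bool" where
  "holomorphic_map X Y f \<longleftrightarrow>
     continuous_map (carrier_top X) (carrier_top Y) f \<and>
     (\<forall>(U, \<phi>) \<in> atlas X. \<forall>(V, \<psi>) \<in> atlas Y.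
        (\<psi> \<circ> f \<circ> inv_into U \<phi>) holomorphic_on \<phi> ` {x \<in> U. f x \<in> V})"

definition biholomorphism :: "'a surface \<Rightarrow> 'b surface \<Rightarrow> ('a \<Rightarrow> 'b) \<Rightarrow> bool" where
  "biholomorphism X Y f \<longleftrightarrow>
     holomorphic_map X Y f \<and>
     (\<exists>g. holomorphic_map Y X g \<and>
          (\<forall>x \<in> points X. g (f x) = x) \<and> (\<forall>y \<in> points Y. f (g y) = y))"

definition biholomorphic :: "'a surface \<Rightarrow> 'b surface \<Rightarrow> bool" where
  "biholomorphic X Y \<longleftrightarrow> (\<exists>f. biholomorphism X Y f)"


section \<open>Branched coverings\<close>

definition branched_covering :: "'a surface \<Rightarrow> 'b surface \<Rightarrow> ('a \<Rightarrow> 'b) \<Rightarrow> bool" where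
  "branched_covering X Y f \<longleftrightarrow>
     compact_connected_riemann_surface X \<and> compact_connected_riemann_surface Y \<and>
     holomorphic_map X Y f \<and> (\<exists>x \<in> points X. \<exists>y \<in> points X. f x \<noteq> f y)"

definition has_branching_order ::
  "'a surface \<Rightarrow> 'b surface \<Rightarrow> ('a \<Rightarrow> 'b) \<Rightarrow> 'a \<Rightarrow> nat \<Rightarrow> bool" where
  "has_branching_order X Y f x k \<longleftrightarrow>
     k \<ge> 1 \<and>
     (\<exists>U \<phi> V \<psi>. local_coordinate X U \<phi> \<and> x \<in> U \<and> \<phi> x = 0 \<and>
                local_coordinate Y V \<psi> \<and> f ` U \<subseteq> V \<and> \<psi> (f x) = 0 \<and>
                (\<forall>y \<in> U. \<psi> (f y) = \<phi> y ^ k))"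

definition branching_order ::
  "'a surface \<Rightarrow> 'b surface \<Rightarrow> ('a \<Rightarrow> 'b) \<Rightarrow> 'a \<Rightarrow> nat" where
  "branching_order X Y f x = (THE k. has_branching_order X Y f x k)"

text \<open>A branching datum is a finite set \<open>P\<close> of points together with the weights \<open>n p\<close> for
  \<open>p \<in> P\<close>; its type is an unordered tuple, i.e. a multiset.\<close>

definition branching_datum :: "'b surface \<Rightarrow> 'b set \<Rightarrow> ('b \<Rightarrow> nat) \<Rightarrow> bool" where
  "branching_datum Y P n \<longleftrightarrow> finite P \<and> P \<subseteq> points Y \<and> (\<forall>p \<in> P. n p \<ge> 2)"

definition branching_type :: "'b set \<Rightarrow> ('b \<Rightarrow> nat) \<Rightarrow> nat multiset" where
  "branching_type P n = image_mset n (mset_set P)"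

definition subject_to ::
  "'a surface \<Rightarrow> 'b surface \<Rightarrow> ('a \<Rightarrow> 'b) \<Rightarrow> 'b set \<Rightarrow> ('b \<Rightarrow> nat) \<Rightarrow> bool" where
  "subject_to X Y f P n \<longleftrightarrow>
     (\<forall>x \<in> points X. (f x \<in> P \<longrightarrow> branching_order X Y f x dvd n (f x)) \<and>
                     (f x \<notin> P \<longrightarrow> branching_order X Y f x = 1))"

text \<open>Argument order: \<open>g : Z \<rightarrow> Y\<close> dominates \<open>f : X \<rightarrow> Y\<close>.\<close>

definition dominates ::
  "'c surface \<Rightarrow> 'a surface \<Rightarrow> 'b surface \<Rightarrow> ('c \<Rightarrow> 'b) \<Rightarrow> ('a \<Rightarrow> 'b) \<Rightarrow> bool" where
  "dominates Z X Y g f \<longleftrightarrow>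
     branched_covering Z Y g \<and> branched_covering X Y f \<and>
     (\<exists>h. holomorphic_map Z X h \<and> (\<forall>z \<in> points Z. f (h z) = g z))"


section \<open>The Riemann sphere\<close>

text \<open>The unit sphere in 3-space. The second coordinate is stereographic projection from the
  south pole followed by complex conjugation, so that the transition map is \<open>z \<mapsto> 1 / z\<close>.\<close>

definition north_coordinate :: "real^3 \<Rightarrow> complex" where
  "north_coordinate x = Complex (x $ 1 / (1 - x $ 3)) (x $ 2 / (1 - x $ 3))"

definition south_coordinate :: "real^3 \<Rightarrow> complex" where
  "south_coordinate x = Complex (x $ 1 / (1 + x $ 3)) (- x $ 2 / (1 + x $ 3))"

definition riemann_sphere :: "(real^3) surface" where
  "riemann_sphere =
     \<lparr> carrier_top = top_of_set (sphere 0 1),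
       atlas = {(sphere 0 1 - {axis 3 1}, north_coordinate),
                (sphere 0 1 - {- axis 3 1}, south_coordinate)} \<rparr>"


section \<open>Quotient surfaces\<close>

definition orbit :: "('a \<Rightarrow> 'a) set \<Rightarrow> 'a \<Rightarrow> 'a set" where
  "orbit G x = {g x |g. g \<in> G}"

definition quotient_topology :: "'a topology \<Rightarrow> ('a \<Rightarrow> 'b) \<Rightarrow> 'b topology" where
  "quotient_topology T \<pi> =
     topology (\<lambda>V. V \<subseteq> \<pi> ` topspace T \<and> openin T {x \<in> topspace T. \<pi> x \<in> V})"

lemma openin_quotient_topology:
  "openin (quotient_topology T \<pi>) V \<longleftrightarrow>
     V \<subseteq> \<pi> ` topspace T \<and> openin T {x \<in> topspace T. \<pi> x \<in> V}"
proof -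
  have vimage: "{x \<in> topspace T. \<pi> x \<in> V} = topspace T \<inter> \<pi> -` V" for V
    by blast
  have inter: "openin T (topspace T \<inter> \<pi> -` (A \<inter> B))"
    if "openin T (topspace T \<inter> \<pi> -` A)" "openin T (topspace T \<inter> \<pi> -` B)" for A B
    using openin_Int[OF that] by (simp add: Int_ac)
  have union: "openin T (topspace T \<inter> \<pi> -` \<Union>\<K>)"
    if "\<And>K. K \<in> \<K> \<Longrightarrow> openin T (topspace T \<inter> \<pi> -` K)" for \<K>
  proof -
    have "topspace T \<inter> \<pi> -` \<Union>\<K> = (\<Union>K\<in>\<K>. topspace T \<inter> \<pi> -` K)"
      by blast
    then show ?thesis
      using openin_clauses(3) that by (metis (no_types, lifting) imageE)
  qed
  have "istopology (\<lambda>V. V \<subseteq> \<pi> ` topspace T \<and> openin T (topspace T \<inter> \<pi> -` V))"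
    unfolding istopology_def
    by (intro conjI allI impI) (blast, use inter in blast, blast, use union in blast)
  then show ?thesis
    by (simp add: quotient_topology_def vimage)
qed

lemma quotient_map_quotient_topology:
  "quotient_map T (quotient_topology T \<pi>) \<pi>"
proof -
  have eq: "{x \<in> topspace T. \<pi> x \<in> \<pi> ` topspace T} = topspace T"
    by blast
  have "openin (quotient_topology T \<pi>) (\<pi> ` topspace T)"
    unfolding openin_quotient_topology eq by simp
  moreover have "topspace (quotient_topology T \<pi>) \<subseteq> \<pi> ` topspace T"
    using openin_quotient_topology openin_topspace by metis
  ultimately have top: "topspace (quotient_topology T \<pi>) = \<pi> ` topspace T"
    by (meson openin_subset subset_antisym)
  show ?thesis
    unfolding quotient_map_def openin_quotient_topology top by blast
qed
definition holomorphic_function :: "'a surface \<Rightarrow> 'a set \<Rightarrow> ('a \<Rightarrow> complex) \<Rightarrow> bool" where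
  "holomorphic_function X W F \<longleftrightarrow>
     openin (carrier_top X) W \<and>
     (\<forall>(U, \<phi>) \<in> atlas X. (F \<circ> inv_into U \<phi>) holomorphic_on \<phi> ` (U \<inter> W))"

text \<open>The complex structure on \<open>X/G\<close> is the one whose holomorphic functions are those that pull
  back to holomorphic functions on \<open>X\<close>. For a finite group of biholomorphisms, the charts below
  form the maximal atlas of this structure.\<close>

definition quotient_surface :: "'a surface \<Rightarrow> ('a \<Rightarrow> 'a) set \<Rightarrow> 'a set surface" where
  "quotient_surface X G =
     (let T = quotient_topology (carrier_top X) (orbit G) in
      \<lparr> carrier_top = T,
        atlas = {(V, \<phi>). complex_chart T V \<phi> \<and>
                   holomorphic_function X {x \<in> points X. orbit G x \<in> V} (\<phi> \<circ> orbit G)} \<rparr>)"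


section \<open>Rotation groups\<close>

definition rotation :: "(real^3 \<Rightarrow> real^3) \<Rightarrow> bool" where
  "rotation g \<longleftrightarrow> linear g \<and> rotation_matrix (matrix g)"

text \<open>Rodrigues' formula for the rotation by angle \<open>t\<close> around the axis spanned by the unit
  vector \<open>u\<close>.\<close>

definition axis_rotation :: "real^3 \<Rightarrow> real \<Rightarrow> real^3 \<Rightarrow> real^3" where
  "axis_rotation u t x = cos t *\<^sub>R x + sin t *\<^sub>R cross3 u x + ((1 - cos t) * (u \<bullet> x)) *\<^sub>R u"

definition rotational_symmetries :: "(real^3) set \<Rightarrow> (real^3 \<Rightarrow> real^3) set" where
  "rotational_symmetries P = {g. rotation g \<and> g ` P = P}"

definition cyclic_rotation_group :: "nat \<Rightarrow> (real^3 \<Rightarrow> real^3) set \<Rightarrow> bool" where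
  "cyclic_rotation_group m G \<longleftrightarrow>
     (\<exists>u. norm u = 1 \<and> G = {axis_rotation u (2 * pi * real k / real m) |k. k < m})"

definition orthonormal_pair :: "real^3 \<Rightarrow> real^3 \<Rightarrow> bool" where
  "orthonormal_pair u v \<longleftrightarrow> norm u = 1 \<and> norm v = 1 \<and> u \<bullet> v = 0"

definition orthonormal_frame :: "real^3 \<Rightarrow> real^3 \<Rightarrow> real^3 \<Rightarrow> bool" where
  "orthonormal_frame u v w \<longleftrightarrow>
     norm u = 1 \<and> norm v = 1 \<and> norm w = 1 \<and> u \<bullet> v = 0 \<and> u \<bullet> w = 0 \<and> v \<bullet> w = 0"

definition regular_polygon_on_big_circle :: "nat \<Rightarrow> (real^3) set \<Rightarrow> (real^3) set \<Rightarrow> bool" where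
  "regular_polygon_on_big_circle m P C \<longleftrightarrow>
     (\<exists>u v. orthonormal_pair u v \<and>
        C = {cos t *\<^sub>R u + sin t *\<^sub>R v |t. t \<in> UNIV} \<and>
        P = convex hull {cos (2 * pi * real k / real m) *\<^sub>R u
                         + sin (2 * pi * real k / real m) *\<^sub>R v |k. k < m})"

text \<open>For \<open>m \<ge> 3\<close> every symmetry of the polygon preserves its big circle. Requiring this explicitly
  only matters for \<open>m = 2\<close>, where the polygon degenerates to a diameter; it yields the Klein
  four-group instead of the infinite group of all symmetries of the diameter.\<close>

definition dihedral_rotation_group :: "nat \<Rightarrow> (real^3 \<Rightarrow> real^3) set \<Rightarrow> bool" where
  "dihedral_rotation_group m G \<longleftrightarrow>
     (\<exists>P C. regular_polygon_on_big_circle m P C \<and>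
            G = rotational_symmetries P \<inter> rotational_symmetries C)"

text \<open>The polyhedra are centred at the origin. Only the tetrahedron is normalised to be inscribed
  in the unit sphere; scaling does not change the group.\<close>

definition regular_tetrahedron :: "(real^3) set \<Rightarrow> bool" where
  "regular_tetrahedron P \<longleftrightarrow>
     (\<exists>V d. V \<subseteq> sphere 0 1 \<and> card V = 4 \<and>
            (\<forall>x \<in> V. \<forall>y \<in> V. x \<noteq> y \<longrightarrow> dist x y = d) \<and> P = convex hull V)"

definition cube :: "(real^3) set \<Rightarrow> bool" where
  "cube P \<longleftrightarrow>
     (\<exists>u v w. orthonormal_frame u v w \<and>
        P = convex hull {a *\<^sub>R u + b *\<^sub>R v + c *\<^sub>R w |a b c.
                         a \<in> {1, -1} \<and> b \<in> {1, -1} \<and> c \<in> {1, -1}})"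

text \<open>The twelve vertices are, in the frame \<open>u, v, w\<close>, the cyclic permutations of
  \<open>(0, \<plusminus>1, \<plusminus>r)\<close> with \<open>r\<close> the golden ratio.\<close>

definition regular_icosahedron :: "(real^3) set \<Rightarrow> bool" where
  "regular_icosahedron P \<longleftrightarrow>
     (\<exists>u v w r. orthonormal_frame u v w \<and> r = (1 + sqrt 5) / 2 \<and>
        P = convex hull (\<Union>a \<in> {1, -1}. \<Union>b \<in> {1, -1}.
              {a *\<^sub>R v + (b * r) *\<^sub>R w, a *\<^sub>R w + (b * r) *\<^sub>R u, a *\<^sub>R u + (b * r) *\<^sub>R v}))"

definition listed_rotation_group :: "(real^3 \<Rightarrow> real^3) set \<Rightarrow> bool" where
  "listed_rotation_group G \<longleftrightarrow>
     (\<exists>m \<ge> 1. cyclic_rotation_group m G) \<or>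
     (\<exists>m \<ge> 2. dihedral_rotation_group m G) \<or>
     (\<exists>P. regular_tetrahedron P \<and> G = rotational_symmetries P) \<or>
     (\<exists>P. cube P \<and> G = rotational_symmetries P) \<or>
     (\<exists>P. regular_icosahedron P \<and> G = rotational_symmetries P)"

end

theory Submission
  imports Defs "HOL-Complex_Analysis.Complex_Analysis"
begin

text \<open>Each type is that of a finite rotation group \<open>G\<close>, namely of the stabiliser orders of its
  non-free orbits. The quotient of the sphere by \<open>G\<close> is again a sphere, because a suitable
  \<open>G\<close>-invariant rational function has the orbits as fibres; after a Moebius transformation, the
  resulting map \<open>g\<close> sends the three special orbits to the points of the branching datum, and its
  local orders there are multiples of the weights. Hence \<open>g\<close> lifts locally through \<open>f\<close> everywhere.
  The sphere being simply connected (the lifts are continued over growing discs and glued at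
  infinity), there is a global lift \<open>h\<close> with \<open>f \<circ> h = g\<close>. Its fibres are the orbits of a
  subgroup of \<open>G\<close>, so \<open>X\<close> is itself a quotient of the sphere by a finite rotation group, i.e. a
  sphere.\<close>


section \<open>Charts and holomorphic curves\<close>


text \<open>Divisibility does the local work: where \<open>f\<close> is t ^ d and \<open>g\<close>
  is the N-th power of a holomorphic function with d dividing N, the equation for the lift is solved
  by single-valued functions even at a branched point. The obstacle is that \<open>f\<close> is no
  covering map there: different lifts can pass through the same branched point. Lifts are therefore
  compared at parameters whose whole fibre is unbranched; these are dense, and the identity theorem
  carries agreement across the branch values.

  The N-th root asks only for a rotation in the stabiliser whose powers are trivial for multiples of
  the weight alone, so each group contributes points in three different orbits and an explicit
  rotation for each weight. Three is also the number of points that a Moebius transformation can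
  place; for (n,n) a third point is added.

  Maps out of a quotient are recovered by descent: a continuous function is holomorphic if its
  composite with a nonconstant holomorphic map is, because critical values are removable
  singularities. One lemma of this kind identifies both \<open>X\<close> and S/G with the
  sphere.\<close>

lemma complex_chart_openin: "complex_chart T U \<phi> \<Longrightarrow> openin T U"
  and complex_chart_open_image: "complex_chart T U \<phi> \<Longrightarrow> open (\<phi> ` U)"
  by (auto simp: complex_chart_def)

lemma complex_chart_inj: 
  assumes "complex_chart T U \<phi>" shows "inj_on \<phi> U"
proof -
  have "U \<subseteq> topspace T" using assms complex_chart_openin openin_subset by blast
  then show ?thesis
    using assms by (auto simp: complex_chart_def homeomorphic_map_def Int_absorb1)
qed

lemma complex_chart_open_map:
  assumes c: "complex_chart T U \<phi>" and W: "openin T W"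
  shows "open (\<phi> ` (U \<inter> W))"
proof -
  have h: "homeomorphic_map (subtopology T U) (top_of_set (\<phi> ` U)) \<phi>" and o: "open (\<phi> ` U)"
    using c by (auto simp: complex_chart_def)
  have "openin (subtopology T U) (U \<inter> W)"
    using W openin_subtopology_Int2 by blast
  then have "openin (top_of_set (\<phi> ` U)) (\<phi> ` (U \<inter> W))"
    using h homeomorphic_imp_open_map open_map_def by blast
  then show ?thesis using o openin_open_trans by blast
qed

lemma complex_chart_inv_open:
  assumes c: "complex_chart T U \<phi>" and B: "open B"
  shows "openin T {x \<in> U. \<phi> x \<in> B}"
proof -
  have h: "homeomorphic_map (subtopology T U) (top_of_set (\<phi> ` U)) \<phi>" and o: "openin T U"
    using c by (auto simp: complex_chart_def)
  have "continuous_map (subtopology T U) euclidean \<phi>"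
    using h homeomorphic_imp_continuous_map continuous_map_into_fulltopology by blast
  then have "openin (subtopology T U) {x \<in> topspace (subtopology T U). \<phi> x \<in> B}"
    using B unfolding continuous_map_def by auto
  moreover have "topspace (subtopology T U) = U" using openin_subset[OF o] by (rule topspace_subtopology_subset)
  ultimately have "openin (subtopology T U) {x \<in> U. \<phi> x \<in> B}" by (simp only:)
  then show ?thesis using o openin_open_subtopology by blast
qed

lemma complex_chartI:
  assumes U: "openin T U" and inj: "inj_on \<phi> U"
    and op: "\<And>W. openin T W \<Longrightarrow> W \<subseteq> U \<Longrightarrow> open (\<phi> ` W)"
    and cont: "\<And>B. open B \<Longrightarrow> openin T {x \<in> U. \<phi> x \<in> B}"
  shows "complex_chart T U \<phi>"
proof -
  have top: "topspace (subtopology T U) = U" using openin_subset[OF U] by (rule topspace_subtopology_subset)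
  have "homeomorphic_map (subtopology T U) (top_of_set (\<phi> ` U)) \<phi>"
  proof (rule bijective_open_imp_homeomorphic_map)
    show "continuous_map (subtopology T U) (top_of_set (\<phi> ` U)) \<phi>"
      unfolding continuous_map_def top
    proof (intro conjI allI impI)
      fix B assume "openin (top_of_set (\<phi> ` U)) B"
      then obtain B' where B': "open B'" "B = \<phi> ` U \<inter> B'" by (auto simp: openin_open)
      then have "{x \<in> U. \<phi> x \<in> B} = {x \<in> U. \<phi> x \<in> B'}" by auto
      then show "openin (subtopology T U) {x \<in> U. \<phi> x \<in> B}"
        using cont[OF B'(1)] by (metis (no_types, lifting) U mem_Collect_eq openin_open_subtopology subsetI)
    qed auto
    show "open_map (subtopology T U) (top_of_set (\<phi> ` U)) \<phi>"
      unfolding open_map_def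
    proof (intro allI impI)
      fix W assume "openin (subtopology T U) W"
      then have "openin T W" "W \<subseteq> U" using U openin_open_subtopology by auto
      then have "open (\<phi> ` W)" using op by blast
      then show "openin (top_of_set (\<phi> ` U)) (\<phi> ` W)"
        using \<open>W \<subseteq> U\<close> by (simp add: image_mono open_subset)
    qed
  qed (use top inj in auto)
  then show ?thesis using U op[OF U] by (auto simp: complex_chart_def)
qed

lemma holomorphic_on_locally:
  assumes "\<And>z. z \<in> S \<Longrightarrow> \<exists>e>0. f holomorphic_on ball z e"
  shows "f holomorphic_on S"
proof (rule holomorphic_onI)
  fix z assume "z \<in> S"
  then obtain e where "e > 0" "f holomorphic_on ball z e" using assms by blast
  then have "f field_differentiable at z"
    using holomorphic_on_imp_differentiable_at[of f "ball z e" z] by simp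
  then show "f field_differentiable at z within S"
    by (rule field_differentiable_at_within)
qed

lemma riemann_surface_chart:
  "riemann_surface X \<Longrightarrow> (U, \<phi>) \<in> atlas X \<Longrightarrow> complex_chart (carrier_top X) U \<phi>"
  by (auto simp: riemann_surface_def)

lemma riemann_surface_cover:
  assumes "riemann_surface X" "x \<in> points X"
  obtains U \<phi> where "(U, \<phi>) \<in> atlas X" "x \<in> U"
proof -
  have "x \<in> (\<Union>(U, \<phi>) \<in> atlas X. U)" using assms by (simp add: riemann_surface_def)
  then show ?thesis by (auto intro: that)
qed

lemma riemann_surface_transition:
  assumes "riemann_surface X" "(U, \<phi>) \<in> atlas X" "(V, \<psi>) \<in> atlas X"
  shows "(\<psi> \<circ> inv_into U \<phi>) holomorphic_on \<phi> ` (U \<inter> V)"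
  using assms by (force simp: riemann_surface_def holomorphic_transition_def)

lemma riemann_surface_chart_subset:
  "riemann_surface X \<Longrightarrow> (U, \<phi>) \<in> atlas X \<Longrightarrow> U \<subseteq> points X"
  by (rule openin_subset[OF complex_chart_openin[OF riemann_surface_chart]])

text \<open>Local arguments run through curves from the plane, so that the source needs no chart. A
  whole ball must go into one chart; this carries the continuity of \<open>h\<close> near
  \<open>z\<close> along with its holomorphy.\<close>

definition hol_at :: "'a surface \<Rightarrow> (complex \<Rightarrow> 'a) \<Rightarrow> complex \<Rightarrow> bool" where
  "hol_at X h z \<longleftrightarrow>
     (\<exists>(U, \<phi>) \<in> atlas X. \<exists>e>0. h ` ball z e \<subseteq> U \<and> (\<phi> \<circ> h) holomorphic_on ball z e)"

lemma hol_atI: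
  assumes "(U, \<phi>) \<in> atlas X" "open D" "z \<in> D" "h ` D \<subseteq> U" "(\<phi> \<circ> h) holomorphic_on D"
  shows "hol_at X h z"
proof -
  obtain e where e: "e > 0" "ball z e \<subseteq> D" using assms(2,3) openE by blast
  with assms show ?thesis unfolding hol_at_def
    by (intro bexI[of _ "(U, \<phi>)"]) (auto intro!: exI[of _ e] intro: holomorphic_on_subset)
qed

lemma hol_at_points: "riemann_surface X \<Longrightarrow> hol_at X h z \<Longrightarrow> h z \<in> points X"
  unfolding hol_at_def using riemann_surface_chart_subset by fastforce

lemma hol_at_cong:
  assumes "hol_at X h z" "open D" "z \<in> D" "\<And>w. w \<in> D \<Longrightarrow> k w = h w"
  shows "hol_at X k z"
proof -
  obtain U \<phi> e where u: "(U, \<phi>) \<in> atlas X" "e > 0" "h ` ball z e \<subseteq> U" "(\<phi> \<circ> h) holomorphic_on ball z e"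
    using assms(1) by (auto simp: hol_at_def)
  show ?thesis
  proof (rule hol_atI[OF u(1)])
    show "open (D \<inter> ball z e)" "z \<in> D \<inter> ball z e" using assms u by auto
    show "k ` (D \<inter> ball z e) \<subseteq> U" using assms(4) u(3) by auto
    have "(\<phi> \<circ> h) holomorphic_on D \<inter> ball z e" using u(4) by (rule holomorphic_on_subset) auto
    then show "(\<phi> \<circ> k) holomorphic_on D \<inter> ball z e"
      by (rule holomorphic_transform) (use assms(4) in auto)
  qed
qed

text \<open>Independence of the chart. The curve is continuous in the chart where it is known to be
  holomorphic, so a smaller ball stays inside both charts and inside \<open>W\<close>; there the
  transition map applies.\<close>

lemma hol_at_chart:
  assumes X: "riemann_surface X" and h: "hol_at X h z" and V: "(V, \<psi>) \<in> atlas X"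
    and W: "openin (carrier_top X) W" "h z \<in> V" "h z \<in> W"
  shows "\<exists>e>0. h ` ball z e \<subseteq> V \<inter> W \<and> (\<psi> \<circ> h) holomorphic_on ball z e"
proof -
  obtain U \<phi> e where U: "(U, \<phi>) \<in> atlas X" and e: "e > 0" "h ` ball z e \<subseteq> U" 
    and hol: "(\<phi> \<circ> h) holomorphic_on ball z e"
    using h by (auto simp: hol_at_def)
  note cU = riemann_surface_chart[OF X U] and cV = riemann_surface_chart[OF X V]
  have inj: "inj_on \<phi> U" using cU complex_chart_inj by blast
  have oVW: "openin (carrier_top X) (V \<inter> W)" using cV W complex_chart_openin by blast
  let ?O = "\<phi> ` (U \<inter> (V \<inter> W))"
  have oO: "open ?O" by (rule complex_chart_open_map[OF cU oVW])
  have cont: "continuous_on (ball z e) (\<phi> \<circ> h)" using hol holomorphic_on_imp_continuous_on by blast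
  have op: "open ((\<phi> \<circ> h) -` ?O \<inter> ball z e)"
    using continuous_open_preimage[OF cont _ oO] by (simp add: Int_commute)
  have "z \<in> (\<phi> \<circ> h) -` ?O \<inter> ball z e" using W e by force
  then obtain e' where e': "e' > 0" "ball z e' \<subseteq> (\<phi> \<circ> h) -` ?O \<inter> ball z e"
    using op openE by blast
  have sub: "h w \<in> U \<inter> (V \<inter> W)" if "w \<in> ball z e'" for w
  proof -
    have "w \<in> ball z e" using that e' by auto
    then have "\<phi> (h w) \<in> ?O" "h w \<in> U" using that e' e by auto
    then show ?thesis using inj by (auto simp: inj_on_def)
  qed
  have "((\<psi> \<circ> inv_into U \<phi>) \<circ> (\<phi> \<circ> h)) holomorphic_on ball z e'"
  proof (rule holomorphic_on_compose_gen)
    show "(\<phi> \<circ> h) holomorphic_on ball z e'" using hol by (rule holomorphic_on_subset) (use e' in auto)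
    show "(\<psi> \<circ> inv_into U \<phi>) holomorphic_on \<phi> ` (U \<inter> V)" by (rule riemann_surface_transition[OF X U V])
    show "(\<phi> \<circ> h) ` ball z e' \<subseteq> \<phi> ` (U \<inter> V)" using sub by auto
  qed
  then have "(\<psi> \<circ> h) holomorphic_on ball z e'"
    by (rule holomorphic_transform) (use sub inj in auto)
  then show ?thesis using e' sub by blast
qed

lemma hol_at_open_ball:
  assumes X: "riemann_surface X" and h: "hol_at X h z" 
    and W: "openin (carrier_top X) W" "h z \<in> W"
  shows "\<exists>e>0. h ` ball z e \<subseteq> W"
proof -
  obtain U \<phi> where "(U, \<phi>) \<in> atlas X" "h z \<in> U"
    using riemann_surface_cover[OF X hol_at_points[OF X h]] .
  from hol_at_chart[OF X h this(1) W(1) this(2) W(2)] show ?thesis by auto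
qed

lemma hol_at_inv_chart:
  assumes X: "riemann_surface X" and U: "(U, \<phi>) \<in> atlas X" and z: "z \<in> \<phi> ` U"
  shows "hol_at X (inv_into U \<phi>) z"
proof (rule hol_atI[OF U])
  show "open (\<phi> ` U)" using riemann_surface_chart[OF X U] complex_chart_open_image by blast
  show "inv_into U \<phi> ` (\<phi> ` U) \<subseteq> U" by (auto intro: inv_into_into)
  show "(\<phi> \<circ> inv_into U \<phi>) holomorphic_on \<phi> ` U"
    by (rule holomorphic_transform[OF holomorphic_on_id]) (auto simp: f_inv_into_f)
qed (use z in auto)

lemma hol_at_compose:
  assumes h: "hol_at X h (k z)" and k: "k holomorphic_on D" "open D" "z \<in> D"
  shows "hol_at X (h \<circ> k) z"
proof -
  obtain U \<phi> e where U: "(U, \<phi>) \<in> atlas X" and e: "e > 0" "h ` ball (k z) e \<subseteq> U" 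
    and hol: "(\<phi> \<circ> h) holomorphic_on ball (k z) e"
    using h by (auto simp: hol_at_def)
  let ?D = "k -` ball (k z) e \<inter> D"
  have "open ?D"
    using continuous_open_preimage[OF holomorphic_on_imp_continuous_on[OF k(1)] k(2)] 
    by (simp add: Int_commute)
  show ?thesis
  proof (rule hol_atI[OF U \<open>open ?D\<close>])
    show "z \<in> ?D" using k e by auto
    show "(h \<circ> k) ` ?D \<subseteq> U" using e by auto
    have "((\<phi> \<circ> h) \<circ> k) holomorphic_on ?D"
      by (rule holomorphic_on_compose_gen[OF _ hol]) (use k in \<open>auto intro: holomorphic_on_subset\<close>)
    then show "(\<phi> \<circ> (h \<circ> k)) holomorphic_on ?D" by (simp add: o_assoc)
  qed
qed

lemma holomorphic_map_hol_at:
  assumes X: "riemann_surface X" and Y: "riemann_surface Y"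
    and f: "holomorphic_map X Y f" and h: "hol_at X h z"
  shows "hol_at Y (f \<circ> h) z"
proof -
  have cont: "continuous_map (carrier_top X) (carrier_top Y) f" using f by (auto simp: holomorphic_map_def)
  have hz: "h z \<in> points X" using X h hol_at_points by blast
  then have fz: "f (h z) \<in> points Y" using cont by (auto simp: continuous_map_def)
  obtain U \<phi> where U: "(U, \<phi>) \<in> atlas X" "h z \<in> U" using riemann_surface_cover[OF X hz] .
  obtain V \<psi> where V: "(V, \<psi>) \<in> atlas Y" "f (h z) \<in> V" using riemann_surface_cover[OF Y fz] .
  let ?W = "{x \<in> points X. f x \<in> V}"
  have W: "openin (carrier_top X) ?W"
    using cont complex_chart_openin[OF riemann_surface_chart[OF Y V(1)]]
    by (auto simp: continuous_map_def)
  obtain e where e: "e > 0" "h ` ball z e \<subseteq> U \<inter> ?W" and hol: "(\<phi> \<circ> h) holomorphic_on ball z e"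
    using hol_at_chart[OF X h U(1) W U(2)] hz V(2) by blast
  have inj: "inj_on \<phi> U" using riemann_surface_chart[OF X U(1)] complex_chart_inj by blast
  have fhol: "(\<psi> \<circ> f \<circ> inv_into U \<phi>) holomorphic_on \<phi> ` {x \<in> U. f x \<in> V}"
    using f U V by (force simp: holomorphic_map_def)
  have "((\<psi> \<circ> f \<circ> inv_into U \<phi>) \<circ> (\<phi> \<circ> h)) holomorphic_on ball z e"
    by (rule holomorphic_on_compose_gen[OF hol fhol]) (use e in auto)
  then have "(\<psi> \<circ> (f \<circ> h)) holomorphic_on ball z e"
    by (rule holomorphic_transform) (use e inj in \<open>auto simp: image_subset_iff\<close>)
  then show ?thesis
    by (intro hol_atI[OF V(1), of "ball z e"]) (use e in auto)
qed

text \<open>Continuity comes out of the same assumption: a curve that is holomorphic at a point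
  takes a small ball into any given neighbourhood of its value, and charts transport balls to open
  sets of \<open>X\<close>.\<close>

lemma holomorphic_mapI:
  assumes X: "riemann_surface X" and Y: "riemann_surface Y"
    and h: "\<And>U \<phi> z. (U, \<phi>) \<in> atlas X \<Longrightarrow> z \<in> \<phi> ` U \<Longrightarrow> hol_at Y (f \<circ> inv_into U \<phi>) z"
  shows "holomorphic_map X Y f"
proof -
  have pre: "openin (carrier_top X) {x \<in> points X. f x \<in> W}" if W: "openin (carrier_top Y) W" for W
  proof (subst openin_subopen, intro ballI)
    fix x assume x: "x \<in> {x \<in> points X. f x \<in> W}"
    obtain U \<phi> where U: "(U, \<phi>) \<in> atlas X" "x \<in> U" using riemann_surface_cover[OF X] x by blast
    note c = riemann_surface_chart[OF X U(1)]
    have inj: "inj_on \<phi> U" using c complex_chart_inj by blast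
    have "hol_at Y (f \<circ> inv_into U \<phi>) (\<phi> x)" using h U by blast
    moreover have "(f \<circ> inv_into U \<phi>) (\<phi> x) \<in> W" using x U inj by auto
    ultimately obtain e where e: "e > 0" "(f \<circ> inv_into U \<phi>) ` ball (\<phi> x) e \<subseteq> W"
      using hol_at_open_ball[OF Y _ W] by blast
    let ?T = "{y \<in> U. \<phi> y \<in> ball (\<phi> x) e}"
    have "openin (carrier_top X) ?T" using complex_chart_inv_open[OF c] by blast
    moreover have "x \<in> ?T" using U e by auto
    moreover have "?T \<subseteq> {x \<in> points X. f x \<in> W}"
    proof
      fix y assume y: "y \<in> ?T"
      then have "(f \<circ> inv_into U \<phi>) (\<phi> y) \<in> W" using e by blast
      then show "y \<in> {x \<in> points X. f x \<in> W}"
        using y inj riemann_surface_chart_subset[OF X U(1)] by auto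
    qed
    ultimately show "\<exists>T. openin (carrier_top X) T \<and> x \<in> T \<and> T \<subseteq> {x \<in> points X. f x \<in> W}" by blast
  qed
  have cont: "continuous_map (carrier_top X) (carrier_top Y) f"
    unfolding continuous_map_def
  proof (intro conjI allI impI)
    show "f \<in> points X \<rightarrow> points Y"
    proof
      fix x assume x: "x \<in> points X"
      obtain U \<phi> where U: "(U, \<phi>) \<in> atlas X" "x \<in> U" using riemann_surface_cover[OF X x] .
      have "inj_on \<phi> U" using riemann_surface_chart[OF X U(1)] complex_chart_inj by blast
      then show "f x \<in> points Y" using hol_at_points[OF Y h[OF U(1)]] U(2) by fastforce
    qed
  qed (use pre in auto)
  have main: "(\<psi> \<circ> f \<circ> inv_into U \<phi>) holomorphic_on \<phi> ` {x \<in> U. f x \<in> V}"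
    if U: "(U, \<phi>) \<in> atlas X" and V: "(V, \<psi>) \<in> atlas Y" for U \<phi> V \<psi>
  proof -
    have inj: "inj_on \<phi> U" using riemann_surface_chart[OF X U(1)] complex_chart_inj by blast
    have "\<exists>e>0. (\<psi> \<circ> f \<circ> inv_into U \<phi>) holomorphic_on ball z e" if z: "z \<in> \<phi> ` {x \<in> U. f x \<in> V}" for z
    proof -
      have "hol_at Y (f \<circ> inv_into U \<phi>) z" using h U z by blast
      moreover have "(f \<circ> inv_into U \<phi>) z \<in> V" using z inj by auto
      moreover have "openin (carrier_top Y) V" using riemann_surface_chart[OF Y V] complex_chart_openin by blast
      ultimately show ?thesis using hol_at_chart[OF Y _ V] by (metis comp_assoc)
    qed
    then show ?thesis by (rule holomorphic_on_locally)
  qed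
  show ?thesis using cont main by (simp add: holomorphic_map_def Ball_def)
qed

lemma holomorphic_map_compose:
  assumes X: "riemann_surface X" and Y: "riemann_surface Y" and Z: "riemann_surface Z"
    and f: "holomorphic_map X Y f" and g: "holomorphic_map Y Z g"
  shows "holomorphic_map X Z (g \<circ> f)"
proof (rule holomorphic_mapI[OF X Z])
  fix U \<phi> z assume "(U, \<phi>) \<in> atlas X" "z \<in> \<phi> ` U"
  then have "hol_at Y (f \<circ> inv_into U \<phi>) z"
    using holomorphic_map_hol_at[OF X Y f hol_at_inv_chart[OF X]] by blast
  from holomorphic_map_hol_at[OF Y Z g this] show "hol_at Z (g \<circ> f \<circ> inv_into U \<phi>) z"
    by (simp add: o_assoc)
qed

text \<open>The set \<open>E\<close> where the curves agree locally is open by construction. It is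
  closed because at a limit point the two values coincide by the Hausdorff property, so both curves
  run in one chart nearby and the identity theorem for holomorphic functions applies there.\<close>

lemma hol_at_identity:
  assumes X: "riemann_surface X" and D: "open D" "connected D"
    and h: "\<And>z. z \<in> D \<Longrightarrow> hol_at X h z" and k: "\<And>z. z \<in> D \<Longrightarrow> hol_at X k z"
    and B: "open B" "B \<noteq> {}" "B \<subseteq> D" "\<And>z. z \<in> B \<Longrightarrow> h z = k z"
    and z: "z \<in> D"
  shows "h z = k z"
proof -
  define E where "E = {z \<in> D. \<exists>e>0. \<forall>w\<in>ball z e. h w = k w}"
  have "B \<subseteq> E"
  proof
    fix z assume z: "z \<in> B"
    then obtain e where "e > 0" "ball z e \<subseteq> B" using openE[OF B(1)] by blast
    then show "z \<in> E" using z B(3,4) unfolding E_def by blast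
  qed
  have oE: "openin (top_of_set D) E"
  proof (subst openin_open, intro exI conjI)
    let ?O = "\<Union>{B. open B \<and> (\<forall>w\<in>B. h w = k w)}"
    show "open ?O" by auto
    have "(\<exists>e>0. \<forall>w\<in>ball z e. h w = k w) \<longleftrightarrow> z \<in> ?O" for z
    proof
      assume "z \<in> ?O"
      then obtain B where "open B" "z \<in> B" "\<forall>w\<in>B. h w = k w" by blast
      then show "\<exists>e>0. \<forall>w\<in>ball z e. h w = k w" by (meson openE subsetD)
    next
      assume "\<exists>e>0. \<forall>w\<in>ball z e. h w = k w"
      then obtain e where "e > 0" "\<forall>w\<in>ball z e. h w = k w" by blast
      then show "z \<in> ?O" by (intro UnionI[of "ball z e"]) auto
    qed
    then show "E = D \<inter> ?O" unfolding E_def by blast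
  qed
  have "E \<subseteq> D" unfolding E_def by blast
  have cE: "closedin (top_of_set D) E"
    unfolding closedin_limpt
  proof (intro conjI allI impI)
    show "E \<subseteq> D" by fact
  next
    fix x assume x: "x islimpt E \<and> x \<in> D"
    then have hx: "hol_at X h x" and kx: "hol_at X k x" using h k by auto
    note px = hol_at_points[OF X hx] hol_at_points[OF X kx]
    have lim: "\<exists>w\<in>E. w \<in> ball x e \<and> w \<noteq> x" if e: "e > 0" for e
    proof -
      have "x islimpt E" using x by blast
      then obtain y where "y \<in> E" "y \<in> ball x e" "y \<noteq> x"
        by (rule islimptE[where T = "ball x e"]) (use e in simp_all)
      then show ?thesis by blast
    qed
    have eq: "h x = k x"
    proof (rule ccontr)
      assume "h x \<noteq> k x"
      moreover have Hausdorff: "Hausdorff_space (carrier_top X)" using X by (simp add: riemann_surface_def)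
      ultimately obtain W1 W2 where W: "openin (carrier_top X) W1" "openin (carrier_top X) W2" 
         "h x \<in> W1" "k x \<in> W2" "disjnt W1 W2"
        using Hausdorff px unfolding Hausdorff_space_def by metis
      obtain e1 where e1: "e1>0" "h ` ball x e1 \<subseteq> W1" using hol_at_open_ball[OF X hx W(1) W(3)] by auto
      obtain e2 where e2: "e2>0" "k ` ball x e2 \<subseteq> W2" using hol_at_open_ball[OF X kx W(2) W(4)] by auto
      obtain w where w: "w \<in> E" "w \<in> ball x (min e1 e2)" using lim[of "min e1 e2"] e1 e2 by auto
      then have "h w = k w" unfolding E_def using centre_in_ball by blast
      moreover have "h w \<in> W1" "k w \<in> W2" using w e1 e2 by auto
      ultimately show False using W(5) by (auto simp: disjnt_iff)
    qed
    obtain U \<phi> where U: "(U, \<phi>) \<in> atlas X" "h x \<in> U" using riemann_surface_cover[OF X px(1)] .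
    note c = riemann_surface_chart[OF X U(1)]
    have oU: "openin (carrier_top X) U" and inj: "inj_on \<phi> U" using c complex_chart_openin complex_chart_inj by blast+
    obtain e1 where e1: "e1>0" "h ` ball x e1 \<subseteq> U" "(\<phi> \<circ> h) holomorphic_on ball x e1" 
      using hol_at_chart[OF X hx U(1) oU U(2) U(2)] by auto
    obtain e2 where e2: "e2>0" "k ` ball x e2 \<subseteq> U" "(\<phi> \<circ> k) holomorphic_on ball x e2" 
      using hol_at_chart[OF X kx U(1) oU] U(2) eq by auto
    define e where "e = min e1 e2"
    have e: "e > 0" using e1 e2 by (auto simp: e_def)
    obtain w where w: "w \<in> E" "w \<in> ball x e" using lim[OF e] by auto
    then obtain d where d: "d>0" "\<forall>v\<in>ball w d. h v = k v" by (auto simp: E_def)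
    have eqx: "(\<phi> \<circ> h) v = (\<phi> \<circ> k) v" if "v \<in> ball x e" for v
    proof (rule analytic_continuation_open[where f = "\<phi> \<circ> h" and g = "\<phi> \<circ> k" and s = "ball w d \<inter> ball x e" and s' = "ball x e"])
      have "w \<in> ball w d \<inter> ball x e" using w d by simp
      then show "ball w d \<inter> ball x e \<noteq> {}" by blast
      show "(\<phi> \<circ> h) holomorphic_on ball x e" "(\<phi> \<circ> k) holomorphic_on ball x e"
        using e1 e2 by (auto simp: e_def intro: holomorphic_on_subset)
    qed (use d that in auto)
    have "h v = k v" if "v \<in> ball x e" for v
      using eqx[OF that] inj that e1 e2 by (auto simp: e_def inj_on_def image_subset_iff)
    then show "x \<in> E" using x e by (auto simp: E_def)
  qed
  have "E = {} \<or> E = D" using oE cE D(2) connected_clopen by blast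
  then have "E = D" using B \<open>B \<subseteq> E\<close> by blast
  then obtain e where "e > 0" "\<forall>w\<in>ball z e. h w = k w" using z unfolding E_def by blast
  then show ?thesis by simp
qed


section \<open>Global properties of branched coverings\<close>


lemma chart_ball:
  assumes X: "riemann_surface X" and x: "x \<in> points X" and W: "openin (carrier_top X) W" "x \<in> W"
  obtains U \<phi> e where "(U, \<phi>) \<in> atlas X" "x \<in> U" "e > 0" "ball (\<phi> x) e \<subseteq> \<phi> ` (U \<inter> W)"
proof -
  obtain U \<phi> where U: "(U, \<phi>) \<in> atlas X" "x \<in> U" using riemann_surface_cover[OF X x] .
  have "open (\<phi> ` (U \<inter> W))" using complex_chart_open_map[OF riemann_surface_chart[OF X U(1)] W(1)] .
  then obtain e where "e > 0" "ball (\<phi> x) e \<subseteq> \<phi> ` (U \<inter> W)"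
    using openE[of "\<phi> ` (U \<inter> W)" "\<phi> x"] U W by blast
  then show ?thesis using that U by blast
qed

lemma hol_at_const: 
  assumes Y: "riemann_surface Y" and c: "c \<in> points Y" shows "hol_at Y (\<lambda>_. c) z"
proof -
  obtain U \<phi> where U: "(U, \<phi>) \<in> atlas Y" "c \<in> U" using riemann_surface_cover[OF Y c] .
  have "(\<phi> \<circ> (\<lambda>_. c)) holomorphic_on UNIV" by (simp add: o_def)
  then show ?thesis using hol_atI[OF U(1), of UNIV z "\<lambda>_. c"] U by auto
qed

lemma chart_inv_ball_openin:
  assumes X: "riemann_surface X" and U: "(U, \<phi>) \<in> atlas X" and B: "open B" "B \<subseteq> \<phi> ` U"
  shows "openin (carrier_top X) (inv_into U \<phi> ` B)"
proof -
  note c = riemann_surface_chart[OF X U]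
  have "inv_into U \<phi> ` B = {y \<in> U. \<phi> y \<in> B}"
  proof (intro subset_antisym subsetI)
    fix y assume "y \<in> inv_into U \<phi> ` B"
    then obtain t where "t \<in> B" "y = inv_into U \<phi> t" by blast
    then show "y \<in> {y \<in> U. \<phi> y \<in> B}" using B(2) by (auto simp: inv_into_into f_inv_into_f subset_iff)
  next
    fix y assume "y \<in> {y \<in> U. \<phi> y \<in> B}"
    then show "y \<in> inv_into U \<phi> ` B" 
      using complex_chart_inj[OF c] by (intro image_eqI[of _ _ "\<phi> y"]) simp_all
  qed
  then show ?thesis using complex_chart_inv_open[OF c B(1)] by simp
qed

lemma chart_inv_in: "B \<subseteq> \<phi> ` (U \<inter> W) \<Longrightarrow> inj_on \<phi> U \<Longrightarrow> t \<in> B \<Longrightarrow> inv_into U \<phi> t \<in> U \<inter> W"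
proof -
  assume "B \<subseteq> \<phi> ` (U \<inter> W)" "t \<in> B" and inj: "inj_on \<phi> U"
  then obtain y where "y \<in> U \<inter> W" "t = \<phi> y" by blast
  then show "inv_into U \<phi> t \<in> U \<inter> W" using inj by simp
qed

text \<open>The connectedness argument again, now on \<open>X\<close>: if a chart ball meets the
  open set \<open>A\<close> where \<open>f\<close> is locally equal to \<open>c\<close>, the
  identity theorem against a constant curve puts the whole ball into \<open>A\<close>. So the
  complement of \<open>A\<close> is open as well.\<close>

lemma holomorphic_map_locally_constant:
  assumes X: "riemann_surface X" "connected_space (carrier_top X)" and Y: "riemann_surface Y"
    and f: "holomorphic_map X Y f" 
    and W: "openin (carrier_top X) W" "W \<noteq> {}" "\<And>y. y \<in> W \<Longrightarrow> f y = c" and x: "x \<in> points X"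
  shows "f x = c"
proof -
  let ?T = "carrier_top X"
  define A where "A = \<Union>{T. openin ?T T \<and> (\<forall>y\<in>T. f y = c)}"
  have oA: "openin ?T A" unfolding A_def by (rule openin_Union) auto
  have fA: "f y = c" if "y \<in> A" for y using that unfolding A_def by auto
  have AI: "T \<subseteq> A" if "openin ?T T" "\<And>y. y \<in> T \<Longrightarrow> f y = c" for T using that unfolding A_def by auto
  have "openin ?T (points X - A)"
  proof (subst openin_subopen, intro ballI)
    fix x assume x: "x \<in> points X - A"
    then obtain U \<phi> e where U: "(U, \<phi>) \<in> atlas X" "x \<in> U" "e > 0" "ball (\<phi> x) e \<subseteq> \<phi> ` (U \<inter> points X)"
      using chart_ball[OF X(1), of x "points X"] by (metis DiffD1 openin_topspace)
    note c = riemann_surface_chart[OF X(1) U(1)]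
    have inj: "inj_on \<phi> U" using c by (rule complex_chart_inj)
    let ?T' = "inv_into U \<phi> ` ball (\<phi> x) e"
    have sub: "ball (\<phi> x) e \<subseteq> \<phi> ` U" using U(4) by blast
    have oT: "openin ?T ?T'" using chart_inv_ball_openin[OF X(1) U(1) _ sub] by simp
    have xT: "x \<in> ?T'" using U inj by (metis centre_in_ball image_eqI inv_into_f_f)
    have "?T' \<inter> A = {}"
    proof (rule ccontr)
      assume "?T' \<inter> A \<noteq> {}"
      then obtain t where t: "t \<in> ball (\<phi> x) e" "inv_into U \<phi> t \<in> A" by blast
      have "t \<in> \<phi> ` U" using t(1) sub by blast
      then have "(f \<circ> inv_into U \<phi>) t \<in> points Y"
        by (rule hol_at_points[OF Y holomorphic_map_hol_at[OF X(1) Y f hol_at_inv_chart[OF X(1) U(1)]]])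
      then have px: "c \<in> points Y" using fA[OF t(2)] by simp
      let ?B = "\<phi> ` (U \<inter> A) \<inter> ball (\<phi> x) e"
      have "(f \<circ> inv_into U \<phi>) s = (\<lambda>_. c) s" if s: "s \<in> ball (\<phi> x) e" for s
      proof (rule hol_at_identity[OF Y open_ball convex_connected[OF convex_ball], where B = ?B])
        show "hol_at Y (f \<circ> inv_into U \<phi>) z" if "z \<in> ball (\<phi> x) e" for z
          using holomorphic_map_hol_at[OF X(1) Y f hol_at_inv_chart[OF X(1) U(1)]] that sub by blast
        show "hol_at Y (\<lambda>_. c) z" for z by (rule hol_at_const[OF Y px])
        show "open ?B" using complex_chart_open_map[OF c oA] by auto
        have "inv_into U \<phi> t \<in> U" "\<phi> (inv_into U \<phi> t) = t"
          using \<open>t \<in> \<phi> ` U\<close> by (simp_all add: inv_into_into f_inv_into_f)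
        then have "t \<in> ?B" using t by (intro IntI image_eqI[of _ _ "inv_into U \<phi> t"]) simp_all
        then show "?B \<noteq> {}" by blast
        show "(f \<circ> inv_into U \<phi>) z = c" if "z \<in> ?B" for z
          using that fA inj by auto
      qed (use s in auto)
      then have "f y = c" if "y \<in> ?T'" for y using that by auto
      then have "?T' \<subseteq> A" by (rule AI[OF oT])
      then show False using xT x by blast
    qed
    moreover have "?T' \<subseteq> points X" using oT openin_subset by blast
    ultimately show "\<exists>T. openin ?T T \<and> x \<in> T \<and> T \<subseteq> points X - A" using oT xT by blast
  qed
  then have "closedin ?T A" using oA by (simp add: closedin_def openin_subset)
  then have "A = {} \<or> A = points X" using oA X(2) connected_space_clopen_in by blast
  moreover have "A \<noteq> {}" using AI[OF W(1) W(3)] W(2) by blast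
  ultimately show ?thesis using x fA by blast
qed

lemma branched_covering_rs:
  assumes "branched_covering X Y f"
  shows "riemann_surface X" "riemann_surface Y" "compact_space (carrier_top X)" "compact_space (carrier_top Y)"
    "connected_space (carrier_top X)" "connected_space (carrier_top Y)" "holomorphic_map X Y f"
    "continuous_map (carrier_top X) (carrier_top Y) f" "Hausdorff_space (carrier_top X)"  "Hausdorff_space (carrier_top Y)"
proof -
  show rs: "riemann_surface X" "riemann_surface Y" and "compact_space (carrier_top X)" "compact_space (carrier_top Y)"
    "connected_space (carrier_top X)" "connected_space (carrier_top Y)" and h: "holomorphic_map X Y f"
    using assms unfolding branched_covering_def compact_connected_riemann_surface_def by blast+
  show "continuous_map (carrier_top X) (carrier_top Y) f" using h unfolding holomorphic_map_def by (rule conjunct1)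
  show "Hausdorff_space (carrier_top X)"  "Hausdorff_space (carrier_top Y)"
    using rs unfolding riemann_surface_def by - (erule conjunct1)+
qed

lemma branched_covering_not_locally_constant:
  assumes bc: "branched_covering X Y f" and U: "openin (carrier_top X) U" "U \<noteq> {}"
  shows "\<exists>x\<in>U. \<exists>y\<in>U. f x \<noteq> f y"
proof (rule ccontr)
  assume "\<not> ?thesis"
  then obtain c where c: "\<And>x. x \<in> U \<Longrightarrow> f x = c" using U(2) by (metis all_not_in_conv)
  note * = branched_covering_rs[OF bc]
  have "f x = c" if "x \<in> points X" for x
    using holomorphic_map_locally_constant[OF *(1,5,2,7) U c that] .
  then show False using bc by (auto simp: branched_covering_def)
qed

lemma branched_covering_curve_nonconstant:
  assumes bc: "branched_covering X Y f" and U: "(U, \<phi>) \<in> atlas X" and B: "open B" "B \<noteq> {}" "B \<subseteq> \<phi> ` U"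
  shows "\<exists>s\<in>B. \<exists>t\<in>B. f (inv_into U \<phi> s) \<noteq> f (inv_into U \<phi> t)"
proof -
  have "openin (carrier_top X) (inv_into U \<phi> ` B)"
    using chart_inv_ball_openin[OF branched_covering_rs(1)[OF bc] U B(1,3)] .
  then show ?thesis using branched_covering_not_locally_constant[OF bc] B(2) by blast
qed

text \<open>This is the form in which theorems on functions of one variable see \<open>f\<close>.
  Global nonconstancy has become nonconstancy on every open part of the ball, as the open mapping
  and factorisation theorems require.\<close>

lemma branched_covering_chart_function:
  assumes bc: "branched_covering X Y f" and x: "x \<in> W" "openin (carrier_top X) W"
    and V: "(V, \<psi>) \<in> atlas Y" "f x \<in> V"
  obtains U \<phi> e where "(U, \<phi>) \<in> atlas X" "x \<in> U" "e > 0" "ball (\<phi> x) e \<subseteq> \<phi> ` (U \<inter> W)"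
    "(\<lambda>t. f (inv_into U \<phi> t)) ` ball (\<phi> x) e \<subseteq> V"
    "(\<lambda>t. \<psi> (f (inv_into U \<phi> t))) holomorphic_on ball (\<phi> x) e"
    "\<And>B. open B \<Longrightarrow> B \<noteq> {} \<Longrightarrow> B \<subseteq> ball (\<phi> x) e \<Longrightarrow> \<not> (\<lambda>t. \<psi> (f (inv_into U \<phi> t))) constant_on B"
proof -
  note * = branched_covering_rs[OF bc]
  have xp: "x \<in> points X" using x openin_subset by blast
  obtain U \<phi> e where U: "(U, \<phi>) \<in> atlas X" "x \<in> U" "e > 0" "ball (\<phi> x) e \<subseteq> \<phi> ` (U \<inter> W)"
    using chart_ball[OF *(1) xp x(2,1)] by blast
  have inj: "inj_on \<phi> U" using riemann_surface_chart[OF *(1) U(1)] by (rule complex_chart_inj)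
  have hol: "hol_at Y (f \<circ> inv_into U \<phi>) (\<phi> x)"
    using holomorphic_map_hol_at[OF *(1,2,7) hol_at_inv_chart[OF *(1) U(1)]] U(2) by blast
  have oV: "openin (carrier_top Y) V" using riemann_surface_chart[OF *(2) V(1)] complex_chart_openin by blast
  obtain e' where e': "e' > 0" "(f \<circ> inv_into U \<phi>) ` ball (\<phi> x) e' \<subseteq> V \<inter> V"
    "(\<psi> \<circ> (f \<circ> inv_into U \<phi>)) holomorphic_on ball (\<phi> x) e'"
    using hol_at_chart[OF *(2) hol V(1) oV] V(2) U(2) inj by auto
  let ?e = "min e e'"
  have sub: "ball (\<phi> x) ?e \<subseteq> ball (\<phi> x) e" "ball (\<phi> x) ?e \<subseteq> ball (\<phi> x) e'" by auto
  have injV: "inj_on \<psi> V" using riemann_surface_chart[OF *(2) V(1)] by (rule complex_chart_inj)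
  show ?thesis
  proof (rule that[OF U(1,2), of ?e])
    show im: "(\<lambda>t. f (inv_into U \<phi> t)) ` ball (\<phi> x) ?e \<subseteq> V" using e'(2) sub by auto
    show "(\<lambda>t. \<psi> (f (inv_into U \<phi> t))) holomorphic_on ball (\<phi> x) ?e"
      using holomorphic_on_subset[OF e'(3) sub(2)] by (simp add: o_def)
    show "\<not> (\<lambda>t. \<psi> (f (inv_into U \<phi> t))) constant_on B" if B: "open B" "B \<noteq> {}" "B \<subseteq> ball (\<phi> x) ?e" for B
    proof
      assume "(\<lambda>t. \<psi> (f (inv_into U \<phi> t))) constant_on B"
      then obtain c where c: "\<And>t. t \<in> B \<Longrightarrow> \<psi> (f (inv_into U \<phi> t)) = c" by (auto simp: constant_on_def)
      have "B \<subseteq> \<phi> ` U" using B(3) sub U(4) by blast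
      then obtain s t where st: "s \<in> B" "t \<in> B" "f (inv_into U \<phi> s) \<noteq> f (inv_into U \<phi> t)"
        using branched_covering_curve_nonconstant[OF bc U(1) B(1,2)] by blast
      have "f (inv_into U \<phi> s) \<in> V" "f (inv_into U \<phi> t) \<in> V" using im B st by auto
      then show False using injV c[OF st(1)] c[OF st(2)] st(3) by (metis inj_onD)
    qed
  qed (use e'(1) U sub in auto)
qed

lemma branched_covering_open_map:
  assumes bc: "branched_covering X Y f" and W: "openin (carrier_top X) W"
  shows "openin (carrier_top Y) (f ` W)"
proof (subst openin_subopen, intro ballI)
  note * = branched_covering_rs[OF bc]
  fix y assume "y \<in> f ` W"
  then obtain x where x: "x \<in> W" "y = f x" by blast
  then have "y \<in> points Y" using *(8) W openin_subset by (fastforce simp: continuous_map_def)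
  then obtain V \<psi> where V: "(V, \<psi>) \<in> atlas Y" "f x \<in> V" using riemann_surface_cover[OF *(2)] x by blast
  obtain U \<phi> e where U: "(U, \<phi>) \<in> atlas X" "x \<in> U" "e > 0" "ball (\<phi> x) e \<subseteq> \<phi> ` (U \<inter> W)"
    "(\<lambda>t. f (inv_into U \<phi> t)) ` ball (\<phi> x) e \<subseteq> V"
    "(\<lambda>t. \<psi> (f (inv_into U \<phi> t))) holomorphic_on ball (\<phi> x) e"
    "\<And>B. open B \<Longrightarrow> B \<noteq> {} \<Longrightarrow> B \<subseteq> ball (\<phi> x) e \<Longrightarrow> \<not> (\<lambda>t. \<psi> (f (inv_into U \<phi> t))) constant_on B"
    using branched_covering_chart_function[OF bc x(1) W V] by metis
  let ?b = "ball (\<phi> x) e"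
  let ?k = "\<lambda>t. \<psi> (f (inv_into U \<phi> t))"
  have "open (?k ` ?b)"
    by (rule open_mapping_thm[OF U(6)]) (use U in auto)
  then have o: "openin (carrier_top Y) {y \<in> V. \<psi> y \<in> ?k ` ?b}"
    using complex_chart_inv_open[OF riemann_surface_chart[OF *(2) V(1)]] by blast
  have inj: "inj_on \<phi> U" using riemann_surface_chart[OF *(1) U(1)] by (rule complex_chart_inj)
  have injV: "inj_on \<psi> V" using riemann_surface_chart[OF *(2) V(1)] by (rule complex_chart_inj)
  have "{y \<in> V. \<psi> y \<in> ?k ` ?b} \<subseteq> f ` W"
  proof
    fix y' assume "y' \<in> {y \<in> V. \<psi> y \<in> ?k ` ?b}"
    then obtain t where t: "t \<in> ?b" "y' \<in> V" "\<psi> y' = \<psi> (f (inv_into U \<phi> t))" by auto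
    then have "y' = f (inv_into U \<phi> t)" using U(5) injV by (metis (no_types, lifting) image_subset_iff inj_onD)
    then show "y' \<in> f ` W" using chart_inv_in[OF U(4) inj t(1)] by blast
  qed
  moreover have "f x \<in> {y \<in> V. \<psi> y \<in> ?k ` ?b}"
    using V(2) U(2,3) inj by (auto intro!: image_eqI[of _ _ "\<phi> x"])
  ultimately show "\<exists>T. openin (carrier_top Y) T \<and> y \<in> T \<and> T \<subseteq> f ` W"
    using o x(2) by blast
qed

lemma branched_covering_surj:
  assumes bc: "branched_covering X Y f"
  shows "f ` points X = points Y"
proof -
  note * = branched_covering_rs[OF bc]
  have 1: "openin (carrier_top Y) (f ` points X)" by (rule branched_covering_open_map[OF bc openin_topspace])
  have "compactin (carrier_top Y) (f ` points X)"
    using *(3,8) image_compactin compact_space_def by blast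
  then have 2: "closedin (carrier_top Y) (f ` points X)" using *(10) compactin_imp_closedin by blast
  have "f ` points X \<noteq> {}" using bc by (auto simp: branched_covering_def)
  then show ?thesis using 1 2 *(6) connected_space_clopen_in by blast
qed

lemma hol_at_local_coordinate:
  assumes X: "riemann_surface X" and h: "hol_at X h z" and V: "local_coordinate X V \<psi>" "h z \<in> V"
  shows "\<exists>e>0. h ` ball z e \<subseteq> V \<and> (\<psi> \<circ> h) holomorphic_on ball z e"
proof -
  obtain U \<phi> where U: "(U, \<phi>) \<in> atlas X" "h z \<in> U" using riemann_surface_cover[OF X hol_at_points[OF X h]] .
  have oV: "openin (carrier_top X) V" using V complex_chart_openin unfolding local_coordinate_def by blast
  have inj: "inj_on \<phi> U" using riemann_surface_chart[OF X U(1)] by (rule complex_chart_inj)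
  obtain e where e: "e > 0" "h ` ball z e \<subseteq> U \<inter> V" "(\<phi> \<circ> h) holomorphic_on ball z e"
    using hol_at_chart[OF X h U(1) oV U(2) V(2)] by blast
  have "(\<psi> \<circ> inv_into U \<phi>) holomorphic_on \<phi> ` (U \<inter> V)"
    using V(1) U(1) by (force simp: local_coordinate_def holomorphic_transition_def)
  then have "((\<psi> \<circ> inv_into U \<phi>) \<circ> (\<phi> \<circ> h)) holomorphic_on ball z e"
    by (rule holomorphic_on_compose_gen[OF e(3)]) (use e in auto)
  then have "(\<psi> \<circ> h) holomorphic_on ball z e"
    by (rule holomorphic_transform) (use e inj in \<open>auto simp: image_subset_iff\<close>)
  then show ?thesis using e by blast
qed

text \<open>Members of the maximal atlas are easiest to obtain from their inverses. The inverse of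
  \<open>\<alpha>\<close> is compatible with the atlas because an injective holomorphic function of
  one variable has a holomorphic inverse.\<close>

lemma local_coordinate_parametrization:
  assumes X: "riemann_surface X" and D: "open D" and hol: "\<And>t. t \<in> D \<Longrightarrow> hol_at X \<alpha> t"
    and inj: "inj_on \<alpha> D" and op: "\<And>B. open B \<Longrightarrow> B \<subseteq> D \<Longrightarrow> openin (carrier_top X) (\<alpha> ` B)"
  shows "local_coordinate X (\<alpha> ` D) (inv_into D \<alpha>)"
proof -
  have inv: "inv_into D \<alpha> (\<alpha> t) = t" if "t \<in> D" for t using inj that by simp
  have pre: "open {t \<in> D. \<alpha> t \<in> W}" if W: "openin (carrier_top X) W" for W
  proof (subst open_contains_ball, intro ballI)
    fix t assume t: "t \<in> {t \<in> D. \<alpha> t \<in> W}"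
    obtain e1 where "e1 > 0" "\<alpha> ` ball t e1 \<subseteq> W" using hol_at_open_ball[OF X hol W] t by blast
    moreover obtain e2 where "e2 > 0" "ball t e2 \<subseteq> D" using D t openE by blast
    ultimately show "\<exists>e>0. ball t e \<subseteq> {t \<in> D. \<alpha> t \<in> W}"
      by (intro exI[of _ "min e1 e2"]) auto
  qed
  have "complex_chart (carrier_top X) (\<alpha> ` D) (inv_into D \<alpha>)"
  proof (rule complex_chartI)
    show "openin (carrier_top X) (\<alpha> ` D)" using op D by blast
    show "inj_on (inv_into D \<alpha>) (\<alpha> ` D)" by (rule inj_on_inv_into) auto
    show "open (inv_into D \<alpha> ` W)" if "openin (carrier_top X) W" "W \<subseteq> \<alpha> ` D" for W
    proof -
      have "inv_into D \<alpha> ` W = {t \<in> D. \<alpha> t \<in> W}"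
        using that(2) inv by (force simp: inv_into_into f_inv_into_f subset_iff image_iff)
      then show ?thesis using pre[OF that(1)] by simp
    qed
    show "openin (carrier_top X) {x \<in> \<alpha> ` D. inv_into D \<alpha> x \<in> B}" if "open B" for B
    proof -
      have "{x \<in> \<alpha> ` D. inv_into D \<alpha> x \<in> B} = \<alpha> ` (D \<inter> B)" using inv by auto
      then show ?thesis using op[of "D \<inter> B"] D that by auto
    qed
  qed
  moreover have "holomorphic_transition (W, \<kappa>) (\<alpha> ` D, inv_into D \<alpha>) \<and> holomorphic_transition (\<alpha> ` D, inv_into D \<alpha>) (W, \<kappa>)"
    if W: "(W, \<kappa>) \<in> atlas X" for W \<kappa>
  proof -
    note c = riemann_surface_chart[OF X W]
    have oW: "openin (carrier_top X) W" and injW: "inj_on \<kappa> W" 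
      using c complex_chart_openin complex_chart_inj by blast+
    let ?D = "{t \<in> D. \<alpha> t \<in> W}"
    have holD: "(\<kappa> \<circ> \<alpha>) holomorphic_on ?D"
      by (rule holomorphic_on_locally) (use hol_at_chart[OF X hol W oW] in blast)
    have "inj_on (\<kappa> \<circ> \<alpha>) ?D" using inj injW by (auto simp: inj_on_def)
    then obtain g where g: "g holomorphic_on (\<kappa> \<circ> \<alpha>) ` ?D" "\<And>z. z \<in> ?D \<Longrightarrow> g ((\<kappa> \<circ> \<alpha>) z) = z"
      by (rule holomorphic_has_inverse[OF holD pre[OF oW]]) (rule that)
    have im: "\<kappa> ` (W \<inter> \<alpha> ` D) = (\<kappa> \<circ> \<alpha>) ` ?D" by auto
    have "(inv_into D \<alpha> \<circ> inv_into W \<kappa>) holomorphic_on (\<kappa> \<circ> \<alpha>) ` ?D"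
      by (rule holomorphic_transform[OF g(1)]) (use g(2) injW inv in auto)
    moreover have im2: "inv_into D \<alpha> ` (\<alpha> ` D \<inter> W) = ?D" using inv by force
    have "inv_into (\<alpha> ` D) (inv_into D \<alpha>) t = \<alpha> t" if "t \<in> D" for t
    proof -
      have "inj_on (inv_into D \<alpha>) (\<alpha> ` D)" by (rule inj_on_inv_into) auto
      then show ?thesis using that inv by (metis image_eqI inv_into_f_f)
    qed
    then have "(\<kappa> \<circ> inv_into (\<alpha> ` D) (inv_into D \<alpha>)) holomorphic_on ?D"
      by (intro holomorphic_transform[OF holD]) auto
    ultimately show ?thesis by (simp add: holomorphic_transition_def im im2)
  qed
  ultimately show ?thesis by (auto simp: local_coordinate_def)
qed


section \<open>Local normal form\<close>


lemma tendsto_quotient_deriv: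
  fixes v :: "complex \<Rightarrow> complex"
  assumes "v holomorphic_on ball 0 e" "e > 0" "inj_on v (ball 0 e)" "v 0 = 0"
  shows "((\<lambda>s. v s / s) \<longlongrightarrow> deriv v 0) (at 0)" "deriv v 0 \<noteq> 0"
proof -
  have "(v has_field_derivative deriv v 0) (at 0)"
    using holomorphic_derivI[OF assms(1) open_ball] assms(2) by simp
  then show "((\<lambda>s. v s / s) \<longlongrightarrow> deriv v 0) (at 0)"
    using assms(4) by (simp add: has_field_derivative_iff)
  show "deriv v 0 \<noteq> 0"
    by (rule holomorphic_injective_imp_regular[OF assms(1) open_ball assms(3)]) (use assms(2) in simp)
qed

text \<open>Source of the uniqueness of the branching order. Both \<open>u\<close> and
  \<open>v\<close> have a simple zero at 0, so the two sides of \<open>eq\<close> vanish to the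
  exact orders d and k; after division by the lower power one side would have a nonzero limit and
  the other the limit 0.\<close>

lemma power_factor_exponents:
  fixes u v :: "complex \<Rightarrow> complex"
  assumes u: "((\<lambda>t. u t / t) \<longlongrightarrow> a) (at 0)" "a \<noteq> 0"
    and v: "((\<lambda>s. v s / s) \<longlongrightarrow> b) (at 0)" "b \<noteq> 0"
    and eq: "\<forall>\<^sub>F t in at 0. v (t ^ d) = u t ^ k" and d: "d \<ge> 1" 
  shows "d = k"
proof -
  have 1: "((\<lambda>t. u t ^ k / t ^ k) \<longlongrightarrow> a ^ k) (at 0)"
    using tendsto_power[OF u(1), of k] by (simp add: power_divide)
  have lim: "filterlim (\<lambda>t::complex. t ^ d) (at 0) (at 0)"
    unfolding filterlim_at
  proof
    show "\<forall>\<^sub>F x::complex in at 0. x ^ d \<in> UNIV \<and> x ^ d \<noteq> 0"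
      using eventually_neq_at_within[of 0] by (rule eventually_mono) simp
    have "((\<lambda>t::complex. t ^ d) \<longlongrightarrow> 0 ^ d) (at 0)" by (intro tendsto_intros)
    then show "((\<lambda>t::complex. t ^ d) \<longlongrightarrow> 0) (at 0)" using d by (simp add: zero_power)
  qed
  have "((\<lambda>t. v (t ^ d) / t ^ d) \<longlongrightarrow> b) (at 0)"
    using filterlim_compose[OF v(1) lim] .
  moreover have "\<forall>\<^sub>F t in at 0. v (t ^ d) / t ^ d = u t ^ k / t ^ d"
    using eq by (rule eventually_mono) simp
  ultimately have 2: "((\<lambda>t. u t ^ k / t ^ d) \<longlongrightarrow> b) (at 0)"
    by (rule Lim_transform_eventually)
  have nz: "\<forall>\<^sub>F t::complex in at 0. t \<noteq> 0" using eventually_neq_at_within[of 0] by (rule eventually_mono) simp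
  show ?thesis
  proof (rule linorder_cases[of d k])
    assume "d < k"
    have "((\<lambda>t. u t ^ k / t ^ k * t ^ (k - d)) \<longlongrightarrow> a ^ k * 0 ^ (k - d)) (at 0)"
      by (intro tendsto_mult[OF 1] tendsto_intros)
    moreover have "\<forall>\<^sub>F t in at 0. u t ^ k / t ^ k * t ^ (k - d) = u t ^ k / t ^ d"
      using nz by (rule eventually_mono) (use \<open>d < k\<close> in \<open>simp add: field_simps flip: power_add\<close>)
    ultimately have "((\<lambda>t. u t ^ k / t ^ d) \<longlongrightarrow> a ^ k * 0 ^ (k - d)) (at 0)"
      by (rule Lim_transform_eventually)
    then have "b = a ^ k * 0 ^ (k - d)" using 2 tendsto_unique by (metis at_neq_bot)
    then show ?thesis using v(2) \<open>d < k\<close> by (simp add: zero_power)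
  next
    assume "k < d"
    have "((\<lambda>t. u t ^ k / t ^ d * t ^ (d - k)) \<longlongrightarrow> b * 0 ^ (d - k)) (at 0)"
      by (intro tendsto_mult[OF 2] tendsto_intros)
    moreover have "\<forall>\<^sub>F t in at 0. u t ^ k / t ^ d * t ^ (d - k) = u t ^ k / t ^ k"
      using nz by (rule eventually_mono) (use \<open>k < d\<close> in \<open>simp add: field_simps flip: power_add\<close>)
    ultimately have "((\<lambda>t. u t ^ k / t ^ k) \<longlongrightarrow> b * 0 ^ (d - k)) (at 0)"
      by (rule Lim_transform_eventually)
    then have "a ^ k = b * 0 ^ (d - k)" using 1 tendsto_unique by (metis at_neq_bot)
    then show ?thesis using u(2) \<open>k < d\<close> by (simp add: zero_power)
  qed
qed

text \<open>Charts of the atlas need not vanish at a prescribed point, whereas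
  \<open>has_branching_order\<close> asks for centred coordinates. The translated chart is written
  as the inverse of \<open>\<beta>\<close> so that \<open>local_coordinate_parametrization\<close>
  covers it.\<close>

lemma chart_shift_local_coordinate:
  fixes c :: complex
  assumes X: "riemann_surface X" and V: "(V, \<psi>) \<in> atlas X"
  defines "D \<equiv> (\<lambda>y. \<psi> y - c) ` V" and "\<beta> \<equiv> inv_into V \<psi> \<circ> (\<lambda>s. s + c)"
  shows "open D" "\<beta> ` D = V" "inj_on \<beta> D" "\<And>s. s \<in> D \<Longrightarrow> hol_at X \<beta> s"
    "local_coordinate X V (inv_into D \<beta>)" "\<And>y. y \<in> V \<Longrightarrow> inv_into D \<beta> y = \<psi> y - c"
    "\<And>y. y \<in> V \<Longrightarrow> \<beta> (\<psi> y - c) = y"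
proof -
  note ch = riemann_surface_chart[OF X V]
  have inj: "inj_on \<psi> V" using ch by (rule complex_chart_inj)
  have "D = (\<lambda>z. z - c) ` (\<psi> ` V)" unfolding D_def by auto
  moreover have "open ((\<lambda>z. z - c) ` (\<psi> ` V))"
    using open_translation_subtract[OF complex_chart_open_image[OF ch], of c] by (simp add: image_image)
  ultimately show oD: "open D" by simp
  show bb: "\<beta> (\<psi> y - c) = y" if "y \<in> V" for y using that inj by (simp add: \<beta>_def)
  have Dv: "\<exists>y\<in>V. s = \<psi> y - c" if "s \<in> D" for s using that unfolding D_def by blast
  show im: "\<beta> ` D = V" using bb unfolding D_def by force
  show injb: "inj_on \<beta> D" by (rule inj_onI) (use Dv bb in metis)
  show inv: "inv_into D \<beta> y = \<psi> y - c" if "y \<in> V" for y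
    using inv_into_f_f[OF injb, of "\<psi> y - c"] that bb unfolding D_def by auto
  show hol: "hol_at X \<beta> s" if "s \<in> D" for s
    unfolding \<beta>_def
  proof (rule hol_at_compose)
    show "(\<lambda>s. s + c) holomorphic_on UNIV" by (intro holomorphic_intros)
    show "hol_at X (inv_into V \<psi>) (s + c)"
      by (rule hol_at_inv_chart[OF X V]) (use Dv[OF that] in auto)
  qed auto
  have "openin (carrier_top X) (\<beta> ` B)" if "open B" "B \<subseteq> D" for B
  proof -
    have "\<beta> ` B = {y \<in> V. \<psi> y \<in> (\<lambda>s. s + c) ` B}"
    proof (intro subset_antisym subsetI)
      fix y assume "y \<in> \<beta> ` B"
      then obtain s where s: "s \<in> B" "y = \<beta> s" by blast
      with that Dv obtain y' where "y' \<in> V" "s = \<psi> y' - c" by blast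
      with s bb show "y \<in> {y \<in> V. \<psi> y \<in> (\<lambda>s. s + c) ` B}" by (auto intro!: image_eqI[of _ _ s])
    next
      fix y assume "y \<in> {y \<in> V. \<psi> y \<in> (\<lambda>s. s + c) ` B}"
      then obtain s where "y \<in> V" "s \<in> B" "\<psi> y = s + c" by blast
      then show "y \<in> \<beta> ` B" using bb[of y] by (auto intro!: image_eqI[of _ _ s])
    qed
    moreover have "open ((\<lambda>s. s + c) ` B)" using open_translation[OF that(1), of c] by (simp add: add.commute)
    ultimately show ?thesis using complex_chart_inv_open[OF ch] by simp
  qed
  then show "local_coordinate X V (inv_into D \<beta>)"
    using local_coordinate_parametrization[OF X oD hol injb] im by simp
qed

text \<open>In a chart, \<open>f\<close> minus its value is (w - a) ^ n * g w with \<open>g\<close>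
  free of zeros. On the disc \<open>g\<close> has a logarithm \<open>l\<close>, so \<open>K\<close>
  is a holomorphic n-th root with a simple zero at a. Its local inverse gives the parameter t in
  which \<open>f\<close> is t ^ n.\<close>

lemma branched_covering_normal_form:
  assumes bc: "branched_covering X Y f" and x: "x \<in> points X" and V: "(V, \<psi>) \<in> atlas Y" "f x \<in> V"
  obtains d r \<alpha> where "d \<ge> 1" "r > 0" "\<And>t. t \<in> ball 0 r \<Longrightarrow> hol_at X \<alpha> t" "inj_on \<alpha> (ball 0 r)" "\<alpha> 0 = x"
    "openin (carrier_top X) (\<alpha> ` ball 0 r)" 
    "\<And>t. t \<in> ball 0 r \<Longrightarrow> f (\<alpha> t) \<in> V \<and> \<psi> (f (\<alpha> t)) - \<psi> (f x) = t ^ d"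
    "has_branching_order X Y f x d"
proof -
  note * = branched_covering_rs[OF bc]
  obtain U \<phi> e where U: "(U, \<phi>) \<in> atlas X" "x \<in> U" "e > 0" "ball (\<phi> x) e \<subseteq> \<phi> ` (U \<inter> points X)"
    "(\<lambda>t. f (inv_into U \<phi> t)) ` ball (\<phi> x) e \<subseteq> V"
    and hk: "(\<lambda>t. \<psi> (f (inv_into U \<phi> t))) holomorphic_on ball (\<phi> x) e"
    and nc: "\<And>B. open B \<Longrightarrow> B \<noteq> {} \<Longrightarrow> B \<subseteq> ball (\<phi> x) e \<Longrightarrow> \<not> (\<lambda>t. \<psi> (f (inv_into U \<phi> t))) constant_on B"
    using branched_covering_chart_function[OF bc x openin_topspace V] by metis
  note cU = riemann_surface_chart[OF *(1) U(1)]
  have injU: "inj_on \<phi> U" using cU by (rule complex_chart_inj)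
  have sub: "ball (\<phi> x) e \<subseteq> \<phi> ` U" using U(4) by blast
  define a where "a = \<phi> x"
  define F where "F = (\<lambda>t. \<psi> (f (inv_into U \<phi> t)) - \<psi> (f x))"
  have hF: "F holomorphic_on ball a e" unfolding F_def a_def by (intro holomorphic_intros hk)
  have Fa: "F a = 0" using U(2) injU by (simp add: F_def a_def)
  have ncF: "\<not> F constant_on ball a e"
  proof
    assume "F constant_on ball a e"
    then obtain c where "\<And>t. t \<in> ball a e \<Longrightarrow> F t = c" by (auto simp: constant_on_def)
    then have "\<psi> (f (inv_into U \<phi> t)) = c + \<psi> (f x)" if "t \<in> ball a e" for t
      using that by (metis F_def diff_add_cancel)
    then show False using nc[of "ball a e"] U(3) by (auto simp: constant_on_def a_def)
  qed
  obtain g r n where g: "0 < n" "0 < r" "ball a r \<subseteq> ball a e" "g holomorphic_on ball a r"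
      "\<And>w. w \<in> ball a r \<Longrightarrow> F w = (w - a) ^ n * g w" "\<And>w. w \<in> ball a r \<Longrightarrow> g w \<noteq> 0"
    using holomorphic_factor_zero_nonconstant[OF hF open_ball convex_connected[OF convex_ball] _ Fa ncF] U(3) 
    by (metis centre_in_ball)
  obtain l where l: "l holomorphic_on ball a r" "\<And>z. z \<in> ball a r \<Longrightarrow> g z = exp (l z)"
    using contractible_imp_holomorphic_log[OF g(4) convex_imp_contractible[OF convex_ball] g(6)] by blast
  define K where "K = (\<lambda>w. (w - a) * exp (l w / of_nat n))"
  have hK: "K holomorphic_on ball a r" unfolding K_def by (intro holomorphic_intros l(1)) (use g in auto)
  have KF: "F w = K w ^ n" if "w \<in> ball a r" for w
  proof -
    have "exp (l w / of_nat n) ^ n = exp (l w)" using g(1) by (simp add: exp_of_nat_mult[symmetric])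
    then show ?thesis using g(5)[OF that] l(2)[OF that] by (simp add: K_def power_mult_distrib)
  qed
  have "(l has_field_derivative deriv l a) (at a)" using holomorphic_derivI[OF l(1) open_ball] g(2) by simp
  then have "(K has_field_derivative exp (l a / of_nat n)) (at a)"
    unfolding K_def using g(1) by (auto intro!: derivative_eq_intros)
  then have "deriv K a \<noteq> 0" by (simp add: DERIV_imp_deriv)
  then obtain r1 where r1: "r1 > 0" "ball a r1 \<subseteq> ball a r" "open (K ` ball a r1)" "inj_on K (ball a r1)"
    using has_complex_derivative_locally_invertible[OF hK _ open_ball] g(2) by (metis centre_in_ball)
  have K0: "0 \<in> K ` ball a r1" using r1(1) by (intro image_eqI[of _ _ a]) (auto simp: K_def)
  obtain \<rho> where \<rho>: "\<rho> > 0" "ball 0 \<rho> \<subseteq> K ` ball a r1" using openE[OF r1(3) K0] by blast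
  obtain \<kappa> where \<kappa>: "\<kappa> holomorphic_on K ` ball a r1" "\<And>z. z \<in> ball a r1 \<Longrightarrow> \<kappa> (K z) = z"
    by (rule holomorphic_has_inverse[OF holomorphic_on_subset[OF hK r1(2)] open_ball r1(4)]) (rule that)
  have kin: "\<kappa> t \<in> ball a r1" "K (\<kappa> t) = t" if "t \<in> ball 0 \<rho>" for t
  proof -
    have "t \<in> K ` ball a r1" using that \<rho>(2) by blast
    then obtain z where "z \<in> ball a r1" "t = K z" by blast
    then show "\<kappa> t \<in> ball a r1" "K (\<kappa> t) = t" using \<kappa>(2) by auto
  qed
  have k0: "\<kappa> 0 = a" using \<kappa>(2)[of a] r1(1) by (simp add: K_def)
  have hkap: "\<kappa> holomorphic_on ball 0 \<rho>" using \<kappa>(1) \<rho>(2) holomorphic_on_subset by blast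
  have kU: "\<kappa> t \<in> \<phi> ` U" "\<kappa> t \<in> ball a r" if "t \<in> ball 0 \<rho>" for t
    using kin(1)[OF that] r1(2) g(3) sub unfolding a_def by blast+
  define \<alpha> where "\<alpha> = inv_into U \<phi> \<circ> \<kappa>"
  have hol: "hol_at X \<alpha> t" if "t \<in> ball 0 \<rho>" for t
    unfolding \<alpha>_def by (rule hol_at_compose[OF hol_at_inv_chart[OF *(1) U(1) kU(1)[OF that]] hkap open_ball that])
  have inja: "inj_on \<alpha> (ball 0 \<rho>)"
  proof (rule inj_onI)
    fix s t assume st: "s \<in> ball 0 \<rho>" "t \<in> ball 0 \<rho>" "\<alpha> s = \<alpha> t"
    then have "\<kappa> s = \<kappa> t" using kU(1) by (metis \<alpha>_def comp_apply f_inv_into_f)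
    then show "s = t" using kin(2) st by metis
  qed
  have a0: "\<alpha> 0 = x" using k0 injU U(2) by (simp add: \<alpha>_def a_def)
  have op: "openin (carrier_top X) (\<alpha> ` B)" if B: "open B" "B \<subseteq> ball 0 \<rho>" for B
  proof -
    have "\<kappa> ` B = ball a r1 \<inter> K -` B"
    proof (intro subset_antisym subsetI)
      fix z assume "z \<in> \<kappa> ` B" then show "z \<in> ball a r1 \<inter> K -` B" using kin B(2) by auto
    next
      fix z assume z: "z \<in> ball a r1 \<inter> K -` B" 
      then show "z \<in> \<kappa> ` B" using \<kappa>(2)[of z] by (intro image_eqI[of _ _ "K z"]) auto
    qed
    moreover have "open (ball a r1 \<inter> K -` B)"
      using holomorphic_on_imp_continuous_on[OF holomorphic_on_subset[OF hK r1(2)]] B(1)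
      by (intro continuous_open_preimage) auto
    ultimately have ok: "open (\<kappa> ` B)" by simp
    have ks: "\<kappa> ` B \<subseteq> \<phi> ` U" using kU(1) B(2) by blast
    have "\<alpha> ` B = inv_into U \<phi> ` (\<kappa> ` B)" by (simp add: \<alpha>_def image_comp)
    then show ?thesis using chart_inv_ball_openin[OF *(1) U(1) ok ks] by simp
  qed
  have fa: "f (\<alpha> t) \<in> V \<and> \<psi> (f (\<alpha> t)) - \<psi> (f x) = t ^ n" if t: "t \<in> ball 0 \<rho>" for t
  proof
    have "\<kappa> t \<in> ball (\<phi> x) e" using kU(2)[OF t] g(3) a_def by auto
    then show "f (\<alpha> t) \<in> V" using U(5) by (auto simp: \<alpha>_def)
    have "F (\<kappa> t) = t ^ n" using KF[OF kU(2)[OF t]] kin(2)[OF t] by simp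
    then show "\<psi> (f (\<alpha> t)) - \<psi> (f x) = t ^ n" by (simp add: F_def \<alpha>_def)
  qed
  note lc = local_coordinate_parametrization[OF *(1) open_ball hol inja op]
  note sh = chart_shift_local_coordinate[OF *(2) V(1), where c = "\<psi> (f x)"]
  let ?D = "(\<lambda>y. \<psi> y - \<psi> (f x)) ` V" and ?b = "inv_into V \<psi> \<circ> (\<lambda>s. s + \<psi> (f x))"
  have b: "has_branching_order X Y f x n"
    unfolding has_branching_order_def
  proof (intro conjI exI)
    show "1 \<le> n" using g(1) by simp
    show "local_coordinate X (\<alpha> ` ball 0 \<rho>) (inv_into (ball 0 \<rho>) \<alpha>)" by (rule lc)
    show "local_coordinate Y V (inv_into ?D ?b)" by (rule sh(5))
    show "x \<in> \<alpha> ` ball 0 \<rho>" using a0 \<rho>(1) by (intro image_eqI[of _ _ 0]) auto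
    show "inv_into (ball 0 \<rho>) \<alpha> x = 0" using inv_into_f_f[OF inja, of 0] a0 \<rho>(1) by simp
    show "f ` \<alpha> ` ball 0 \<rho> \<subseteq> V" using fa by blast
    show "inv_into ?D ?b (f x) = 0" using sh(6)[OF V(2)] by simp
    show "\<forall>y\<in>\<alpha> ` ball 0 \<rho>. inv_into ?D ?b (f y) = inv_into (ball 0 \<rho>) \<alpha> y ^ n"
    proof
      fix y assume "y \<in> \<alpha> ` ball 0 \<rho>"
      then obtain t where t: "t \<in> ball 0 \<rho>" "y = \<alpha> t" by blast
      then show "inv_into ?D ?b (f y) = inv_into (ball 0 \<rho>) \<alpha> y ^ n"
        using sh(6)[of "f y"] fa[OF t(1)] inv_into_f_f[OF inja t(1)] by simp
    qed
  qed
  show ?thesis by (rule that[OF _ \<rho>(1) hol inja a0 op[OF open_ball] fa b]) (use g(1) in auto)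
qed

text \<open>\<open>branching_order\<close> is a definite description, so the exponent has to be
  shown unique. Any other pair of centred coordinates differs from the normal form by injective
  holomorphic maps \<open>u\<close> and \<open>v\<close> with v (t ^ d) = u t ^ k.\<close>

lemma branching_order_normal_form:
  assumes bc: "branched_covering X Y f" and x: "x \<in> points X" and V: "(V, \<psi>) \<in> atlas Y" "f x \<in> V"
  obtains r \<alpha> where "branching_order X Y f x \<ge> 1" "r > 0" "\<And>t. t \<in> ball 0 r \<Longrightarrow> hol_at X \<alpha> t" 
    "inj_on \<alpha> (ball 0 r)" "\<alpha> 0 = x" "openin (carrier_top X) (\<alpha> ` ball 0 r)" 
    "\<And>t. t \<in> ball 0 r \<Longrightarrow> f (\<alpha> t) \<in> V \<and> \<psi> (f (\<alpha> t)) - \<psi> (f x) = t ^ branching_order X Y f x"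
proof -
  note * = branched_covering_rs[OF bc]
  obtain d r \<alpha> where d: "d \<ge> 1" "r > 0" and hol: "\<And>t. t \<in> ball 0 r \<Longrightarrow> hol_at X \<alpha> t" 
    and inj: "inj_on \<alpha> (ball 0 r)" and a: "\<alpha> 0 = x" "openin (carrier_top X) (\<alpha> ` ball 0 r)" 
    and fa: "\<And>t. t \<in> ball 0 r \<Longrightarrow> f (\<alpha> t) \<in> V \<and> \<psi> (f (\<alpha> t)) - \<psi> (f x) = t ^ d"
    and b: "has_branching_order X Y f x d"
    using branched_covering_normal_form[OF bc x V] by blast
  have uniq: "k = d" if k: "has_branching_order X Y f x k" for k
  proof -
    obtain U' \<phi>' V' \<psi>' where c: "local_coordinate X U' \<phi>'" "x \<in> U'" "\<phi>' x = 0" 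
        "local_coordinate Y V' \<psi>'" "f ` U' \<subseteq> V'" "\<psi>' (f x) = 0" and pw: "\<And>y. y \<in> U' \<Longrightarrow> \<psi>' (f y) = \<phi>' y ^ k"
      using k unfolding has_branching_order_def by blast
    have inj': "inj_on \<phi>' U'" "inj_on \<psi>' V'" using c(1,4) complex_chart_inj unfolding local_coordinate_def by blast+
    let ?D = "(\<lambda>y. \<psi> y - \<psi> (f x)) ` V" 
    define \<beta> where "\<beta> = inv_into V \<psi> \<circ> (\<lambda>s. s + \<psi> (f x))"
    note sh = chart_shift_local_coordinate[OF *(2) V(1), where c = "\<psi> (f x)", folded \<beta>_def]
    have D0: "0 \<in> ?D" using V(2) by (intro image_eqI[of _ _ "f x"]) auto
    have b0: "\<beta> 0 = f x" using sh(7)[OF V(2)] by simp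
    obtain e1 where e1: "e1 > 0" "\<alpha> ` ball 0 e1 \<subseteq> U'" "(\<phi>' \<circ> \<alpha>) holomorphic_on ball 0 e1"
      using hol_at_local_coordinate[OF *(1) hol c(1), of 0] d(2) c(2) a(1) by auto
    obtain e2 where e2: "e2 > 0" "\<beta> ` ball 0 e2 \<subseteq> V'" "(\<psi>' \<circ> \<beta>) holomorphic_on ball 0 e2"
      using hol_at_local_coordinate[OF *(2) sh(4)[OF D0] c(4)] b0 c(2,5) by auto
    obtain e3 where e3: "e3 > 0" "ball 0 e3 \<subseteq> ?D" using openE[OF sh(1) D0] by blast
    define u where "u = \<phi>' \<circ> \<alpha>"
    define v where "v = \<psi>' \<circ> \<beta>"
    have u: "((\<lambda>s. u s / s) \<longlongrightarrow> deriv u 0) (at 0)" "deriv u 0 \<noteq> 0"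
    proof -
      have s: "ball 0 (min e1 r) \<subseteq> ball 0 e1" "ball 0 (min e1 r) \<subseteq> ball 0 r" for r by auto
      have "inj_on u (ball 0 (min e1 r))" unfolding u_def
        by (rule comp_inj_on[OF inj_on_subset[OF inj s(2)] inj_on_subset[OF inj'(1)]]) (use e1(2) s(1) in blast)
      then show "((\<lambda>s. u s / s) \<longlongrightarrow> deriv u 0) (at 0)" "deriv u 0 \<noteq> 0"
        using tendsto_quotient_deriv[of u "min e1 r"] holomorphic_on_subset[OF e1(3) s(1)[of r]] e1(1) d(2) a(1) c(3)
        unfolding u_def by auto
    qed
    have v: "((\<lambda>s. v s / s) \<longlongrightarrow> deriv v 0) (at 0)" "deriv v 0 \<noteq> 0"
    proof -
      have s: "ball 0 (min e2 e3) \<subseteq> ball 0 e2" "ball 0 (min e2 e3) \<subseteq> ball 0 e3" by auto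
      have "inj_on v (ball 0 (min e2 e3))" unfolding v_def
        by (rule comp_inj_on[OF inj_on_subset[OF sh(3)] inj_on_subset[OF inj'(2)]]) (use e2(2) e3(2) s in blast)+
      then show "((\<lambda>s. v s / s) \<longlongrightarrow> deriv v 0) (at 0)" "deriv v 0 \<noteq> 0"
        using tendsto_quotient_deriv[of v "min e2 e3"] holomorphic_on_subset[OF e2(3) s(1)] e2(1) e3(1) b0 c(6)
        unfolding v_def by auto
    qed
    have "v (t ^ d) = u t ^ k" if t: "t \<in> ball 0 (min e1 r)" for t
    proof -
      have 1: "f (\<alpha> t) \<in> V" "\<psi> (f (\<alpha> t)) - \<psi> (f x) = t ^ d" using fa[of t] t by auto
      then have "\<beta> (t ^ d) = f (\<alpha> t)" using sh(7)[OF 1(1)] by simp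
      moreover have "\<alpha> t \<in> U'" using e1(2) t by (auto simp: image_subset_iff)
      ultimately show ?thesis using pw[of "\<alpha> t"] by (simp add: v_def u_def)
    qed
    moreover have "\<forall>\<^sub>F t in at 0. t \<in> ball (0::complex) (min e1 r)"
      using e1(1) d(2) by (intro eventually_at_in_open') auto
    ultimately have "\<forall>\<^sub>F t in at 0. v (t ^ d) = u t ^ k" by (simp add: eventually_mono)
    from power_factor_exponents[OF u v this d(1)] show "k = d" by (rule sym)
  qed
  have "branching_order X Y f x = d" unfolding branching_order_def using b uniq by (rule the_equality)
  then show ?thesis using that[of r \<alpha>] d hol inj a fa by blast
qed

lemma unbranched_locally_injective:
  assumes bc: "branched_covering X Y f" and x: "x \<in> points X" and b: "branching_order X Y f x = 1"
  obtains W where "openin (carrier_top X) W" "x \<in> W" "inj_on f W"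
proof -
  note * = branched_covering_rs[OF bc]
  have "f x \<in> points Y" using x *(8) by (auto simp: continuous_map_def)
  then obtain V \<psi> where V: "(V, \<psi>) \<in> atlas Y" "f x \<in> V" using riemann_surface_cover[OF *(2)] by blast
  obtain r \<alpha> where r: "r > 0" "\<alpha> 0 = x" "openin (carrier_top X) (\<alpha> ` ball 0 r)" 
    "\<And>t. t \<in> ball 0 r \<Longrightarrow> f (\<alpha> t) \<in> V \<and> \<psi> (f (\<alpha> t)) - \<psi> (f x) = t ^ 1"
    using branching_order_normal_form[OF bc x V] b by metis
  show ?thesis
  proof (rule that[OF r(3)])
    show "x \<in> \<alpha> ` ball 0 r" using r(1,2) by (intro image_eqI[of _ _ 0]) auto
    show "inj_on f (\<alpha> ` ball 0 r)"
    proof (rule inj_onI)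
      fix y z assume "y \<in> \<alpha> ` ball 0 r" "z \<in> \<alpha> ` ball 0 r" and eq: "f y = f z"
      then obtain s t where st: "s \<in> ball 0 r" "t \<in> ball 0 r" "y = \<alpha> s" "z = \<alpha> t" by (elim imageE)
      have "\<psi> (f y) - \<psi> (f x) = s ^ 1" "\<psi> (f z) - \<psi> (f x) = t ^ 1"
        using conjunct2[OF r(4)[OF st(1)]] conjunct2[OF r(4)[OF st(2)]] unfolding st(3,4) .
      then have "s = t" unfolding eq by (simp only: power_one_right)
      then show "y = z" using st by simp
    qed
  qed
qed

text \<open>On a small disc \<open>R\<close> has no critical point except possibly \<open>a\<close>.
  At every other point \<open>R\<close> has a local inverse, through which \<open>k\<close> is
  holomorphic; so \<open>k\<close> is holomorphic on a punctured disc about \<open>R a\<close>, and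
  continuity removes the singularity.\<close>

lemma holomorphic_descent:
  assumes R: "R holomorphic_on ball a r" "r > 0" "\<not> R constant_on ball a r"
    and k: "continuous_on (R ` ball a r) k" "(\<lambda>z. k (R z)) holomorphic_on ball a r"
  shows "\<exists>e>0. k holomorphic_on ball (R a) e"
proof -
  have hd: "deriv R holomorphic_on ball a r" by (rule holomorphic_deriv[OF R(1) open_ball])
  have dnz: "\<exists>z\<in>ball a r. deriv R z \<noteq> 0"
  proof (rule ccontr)
    assume "\<not> ?thesis"
    then have "(R has_field_derivative 0) (at z)" if "z \<in> ball a r" for z
      using holomorphic_derivI[OF R(1) open_ball that] that by fastforce
    then have "R constant_on ball a r"
      using has_field_derivative_0_imp_constant_on[OF _ convex_connected[OF convex_ball] open_ball] by blast
    then show False using R(3) by blast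
  qed
  have "\<exists>r1>0. ball a r1 \<subseteq> ball a r \<and> (\<forall>z\<in>ball a r1 - {a}. deriv R z \<noteq> 0)"
  proof (cases "deriv R a = 0")
    case True
    then show ?thesis using isolated_zeros[OF hd open_ball convex_connected[OF convex_ball], of a] dnz R(2)
      by (metis centre_in_ball)
  next
    case False
    have "continuous_on (ball a r) (deriv R)" using hd holomorphic_on_imp_continuous_on by blast
    then have "open (ball a r \<inter> deriv R -` (- {0}))" by (intro continuous_open_preimage) auto
    then obtain r1 where "r1 > 0" "ball a r1 \<subseteq> ball a r \<inter> deriv R -` (- {0})"
      using False R(2) openE[of "ball a r \<inter> deriv R -` (- {0})" a] by auto
    then show ?thesis by (intro exI[of _ r1]) auto
  qed
  then obtain r1 where r1: "r1 > 0" "ball a r1 \<subseteq> ball a r" "\<And>z. z \<in> ball a r1 \<Longrightarrow> z \<noteq> a \<Longrightarrow> deriv R z \<noteq> 0" by blast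
  have o: "open (R ` ball a r1)" 
    by (rule open_mapping_thm[OF R(1) open_ball convex_connected[OF convex_ball] open_ball r1(2) R(3)])
  then obtain e where e: "e > 0" "ball (R a) e \<subseteq> R ` ball a r1" using r1(1) openE[OF o, of "R a"] by auto
  have "k holomorphic_on ball (R a) e"
  proof (rule no_isolated_singularity[where K = "{R a}"])
    show "continuous_on (ball (R a) e) k" using k(1) e(2) r1(2) continuous_on_subset by (metis image_mono subset_trans)
    show "k holomorphic_on ball (R a) e - {R a}"
    proof (rule holomorphic_on_locally)
      fix y assume y: "y \<in> ball (R a) e - {R a}"
      then obtain z where z: "z \<in> ball a r1" "y = R z" using e(2) by blast
      then have "deriv R z \<noteq> 0" using r1(3) y by blast
      then obtain r2 where r2: "r2 > 0" "ball z r2 \<subseteq> ball a r1" "open (R ` ball z r2)" "inj_on R (ball z r2)"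
        using has_complex_derivative_locally_invertible[OF holomorphic_on_subset[OF R(1) r1(2)] z(1) open_ball] by metis
      have hR2: "R holomorphic_on ball z r2" using R(1) r1(2) r2(2) holomorphic_on_subset by (metis subset_trans)
      obtain g where g: "g holomorphic_on R ` ball z r2" "\<And>w. w \<in> ball z r2 \<Longrightarrow> g (R w) = w"
        by (rule holomorphic_has_inverse[OF hR2 open_ball r2(4)]) (rule that)
      have "((\<lambda>z. k (R z)) \<circ> g) holomorphic_on R ` ball z r2"
      proof (rule holomorphic_on_compose_gen[OF g(1) k(2)])
        show "g ` R ` ball z r2 \<subseteq> ball a r" using g(2) r2(2) r1(2) by auto
      qed
      then have hk: "k holomorphic_on R ` ball z r2"
        by (rule holomorphic_transform) (use g(2) in auto)
      have "y \<in> R ` ball z r2" using z(2) r2(1) by auto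
      then obtain e' where "e' > 0" "ball y e' \<subseteq> R ` ball z r2" using openE[OF r2(3)] by blast
      then show "\<exists>e>0. k holomorphic_on ball y e" using hk holomorphic_on_subset by blast
    qed
  qed auto
  then show ?thesis using e(1) by blast
qed


section \<open>Biholomorphisms from quotient maps\<close>


lemma holomorphic_function_subset:
  assumes "holomorphic_function X W F" "openin (carrier_top X) T" "T \<subseteq> W"
  shows "holomorphic_function X T F"
  using assms unfolding holomorphic_function_def
  by (auto intro!: holomorphic_on_subset[where t = "_ ` (_ \<inter> T)"])

lemma holomorphic_descent_surface:
  assumes Z: "riemann_surface Z" and W: "openin (carrier_top Z) W" "x \<in> W"
    and P: "holomorphic_function Z W P" and Q: "holomorphic_function Z W Q"
    and nc: "\<And>T. openin (carrier_top Z) T \<Longrightarrow> T \<noteq> {} \<Longrightarrow> T \<subseteq> W \<Longrightarrow> \<exists>y\<in>T. \<exists>z\<in>T. P y \<noteq> P z"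
    and k: "continuous_on (P ` W) k" "\<And>y. y \<in> W \<Longrightarrow> k (P y) = Q y"
  shows "\<exists>e>0. k holomorphic_on ball (P x) e"
proof -
  have "x \<in> points Z" using W openin_subset by blast
  then obtain U \<phi> e where U: "(U, \<phi>) \<in> atlas Z" "x \<in> U" "e > 0" "ball (\<phi> x) e \<subseteq> \<phi> ` (U \<inter> W)"
    using chart_ball[OF Z _ W] by metis
  note c = riemann_surface_chart[OF Z U(1)]
  have inj: "inj_on \<phi> U" using c by (rule complex_chart_inj)
  have inW: "inv_into U \<phi> t \<in> U \<inter> W" if "t \<in> ball (\<phi> x) e" for t
    by (rule chart_inv_in[OF U(4) inj that])
  have hP: "(P \<circ> inv_into U \<phi>) holomorphic_on \<phi> ` (U \<inter> W)" "(Q \<circ> inv_into U \<phi>) holomorphic_on \<phi> ` (U \<inter> W)"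
    using P Q U(1) unfolding holomorphic_function_def by blast+
  have sub: "ball (\<phi> x) e \<subseteq> \<phi> ` U" using U(4) by blast
  have "\<exists>e>0. k holomorphic_on ball ((P \<circ> inv_into U \<phi>) (\<phi> x)) e"
  proof (rule holomorphic_descent[OF holomorphic_on_subset[OF hP(1) U(4)] U(3)])
    show "\<not> (P \<circ> inv_into U \<phi>) constant_on ball (\<phi> x) e"
    proof
      assume "(P \<circ> inv_into U \<phi>) constant_on ball (\<phi> x) e"
      then obtain a where a: "\<And>t. t \<in> ball (\<phi> x) e \<Longrightarrow> P (inv_into U \<phi> t) = a" by (auto simp: constant_on_def)
      have "openin (carrier_top Z) (inv_into U \<phi> ` ball (\<phi> x) e)"
        by (rule chart_inv_ball_openin[OF Z U(1) open_ball sub])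
      moreover have "inv_into U \<phi> ` ball (\<phi> x) e \<subseteq> W" using inW by blast
      moreover have "inv_into U \<phi> ` ball (\<phi> x) e \<noteq> {}" using U(3) by auto
      ultimately show False using nc[of "inv_into U \<phi> ` ball (\<phi> x) e"] a by auto
    qed
    have "(P \<circ> inv_into U \<phi>) ` ball (\<phi> x) e \<subseteq> P ` W" using inW by auto
    then show "continuous_on ((P \<circ> inv_into U \<phi>) ` ball (\<phi> x) e) k" by (rule continuous_on_subset[OF k(1)])
    show "(\<lambda>z. k ((P \<circ> inv_into U \<phi>) z)) holomorphic_on ball (\<phi> x) e"
      by (rule holomorphic_transform[OF holomorphic_on_subset[OF hP(2) U(4)]]) (use inW k(2) in auto)
  qed
  then show ?thesis using U(2) inj by simp
qed

lemma continuous_on_between_charts: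
  assumes V: "complex_chart T V \<phi>" and U: "complex_chart T' U \<psi>" and F: "continuous_map T T' F"
  shows "continuous_on (\<phi> ` {y \<in> V. F y \<in> U}) (\<psi> \<circ> F \<circ> inv_into V \<phi>)"
proof -
  have inj: "inj_on \<phi> V" using V by (rule complex_chart_inj)
  have Vs: "V \<subseteq> topspace T" using complex_chart_openin[OF V] by (rule openin_subset)
  have pre: "openin T {y \<in> topspace T. F y \<in> W}" if "openin T' W" for W
    using F that by (simp add: continuous_map_def)
  have o: "open (\<phi> ` {y \<in> V. F y \<in> W})" if W: "openin T' W" for W
  proof -
    have "V \<inter> {y \<in> topspace T. F y \<in> W} = {y \<in> V. F y \<in> W}" using Vs by blast
    then show ?thesis using complex_chart_open_map[OF V pre[OF W]] by simp
  qed
  have "open ((\<psi> \<circ> F \<circ> inv_into V \<phi>) -` B \<inter> \<phi> ` {y \<in> V. F y \<in> U})" if "open B" for B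
  proof -
    have "(\<psi> \<circ> F \<circ> inv_into V \<phi>) -` B \<inter> \<phi> ` {y \<in> V. F y \<in> U} = \<phi> ` {y \<in> V. F y \<in> {u \<in> U. \<psi> u \<in> B}}"
      using inj by auto
    then show ?thesis using o[OF complex_chart_inv_open[OF U that]] by simp
  qed
  then show ?thesis using continuous_on_open_vimage[OF o[OF complex_chart_openin[OF U]]] by blast
qed

lemma holomorphic_map_coordinate:
  assumes X: "riemann_surface X" and Y: "riemann_surface Y" and f: "holomorphic_map X Y f" and U: "(U, \<psi>) \<in> atlas Y"
  shows "holomorphic_function X {x \<in> points X. f x \<in> U} (\<psi> \<circ> f)"
  unfolding holomorphic_function_def
proof (intro conjI ballI, goal_cases)
  case 1
  show ?case using f complex_chart_openin[OF riemann_surface_chart[OF Y U]]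
    by (simp add: holomorphic_map_def continuous_map_def)
next
  case (2 c)
  obtain A \<kappa> where A: "c = (A, \<kappa>)" "(A, \<kappa>) \<in> atlas X" using 2 by (cases c) simp
  have "A \<inter> {x \<in> points X. f x \<in> U} = {x \<in> A. f x \<in> U}"
    using riemann_surface_chart_subset[OF X A(2)] by blast
  then show ?case using f A U unfolding holomorphic_map_def by auto
qed

text \<open>Used twice: with the lift of the covering as \<open>p\<close>, to identify
  \<open>X\<close>, and with the orbit map as \<open>p\<close>, to identify the quotient surface. As
  a continuous surjection from a compact space onto a Hausdorff space, \<open>R\<close> is a
  quotient map too, so both induced maps are continuous; descent along \<open>p\<close> and along
  \<open>R\<close> makes them holomorphic.\<close>

lemma quotient_biholomorphism:
  assumes bc: "branched_covering Z Z' R" and p: "quotient_map (carrier_top Z) (carrier_top Y) p"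
    and fib: "\<And>x y. x \<in> points Z \<Longrightarrow> y \<in> points Z \<Longrightarrow> p x = p y \<longleftrightarrow> R x = R y"
    and chart: "\<And>V \<phi>. (V, \<phi>) \<in> atlas Y \<Longrightarrow> complex_chart (carrier_top Y) V \<phi>"
    and hol: "\<And>V \<phi>. (V, \<phi>) \<in> atlas Y \<Longrightarrow> holomorphic_function Z {x \<in> points Z. p x \<in> V} (\<phi> \<circ> p)"
  obtains F where "biholomorphism Y Z' F" "\<And>x. x \<in> points Z \<Longrightarrow> F (p x) = R x"
proof -
  note * = branched_covering_rs[OF bc]
  have surjR: "R ` points Z = points Z'" by (rule branched_covering_surj[OF bc])
  have surjp: "p ` points Z = points Y" using p by (simp add: quotient_map_def)
  define F where "F = (\<lambda>y. R (inv_into (points Z) p y))"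
  define K where "K = (\<lambda>y. p (inv_into (points Z) R y))"
  have Fp: "F (p x) = R x" if "x \<in> points Z" for x
    using that fib[OF inv_into_into[of "p x" p "points Z"] that] f_inv_into_f[of "p x" p "points Z"]
    unfolding F_def by blast
  have KR: "K (R x) = p x" if "x \<in> points Z" for x
    using that fib[OF inv_into_into[of "R x" R "points Z"] that] f_inv_into_f[of "R x" R "points Z"]
    unfolding K_def by blast
  have qR: "quotient_map (carrier_top Z) (carrier_top Z') R"
    by (rule T1_Spaces.continuous_imp_quotient_map[OF *(8,3,10) surjR])
  have "continuous_map (carrier_top Z) (carrier_top Z') (F \<circ> p)"
    by (rule continuous_map_eq[OF *(8)]) (simp add: Fp)
  then have contF: "continuous_map (carrier_top Y) (carrier_top Z') F"
    by (rule continuous_compose_quotient_map[OF p])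
  have contp: "continuous_map (carrier_top Z) (carrier_top Y) p" using p by (rule quotient_imp_continuous_map)
  have "continuous_map (carrier_top Z) (carrier_top Y) (K \<circ> R)"
    by (rule continuous_map_eq[OF contp]) (simp add: KR)
  then have contK: "continuous_map (carrier_top Z') (carrier_top Y) K"
    by (rule continuous_compose_quotient_map[OF qR])
  have main: "(\<psi> \<circ> F \<circ> inv_into V \<phi>) holomorphic_on \<phi> ` {y \<in> V. F y \<in> U}"
       "(\<phi> \<circ> K \<circ> inv_into U \<psi>) holomorphic_on \<psi> ` {y \<in> U. K y \<in> V}"
    if V: "(V, \<phi>) \<in> atlas Y" and U: "(U, \<psi>) \<in> atlas Z'" for V \<phi> U \<psi>
  proof -
    note cV = chart[OF V] and cU = riemann_surface_chart[OF *(2) U]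
    have inj: "inj_on \<phi> V" "inj_on \<psi> U" using cV cU complex_chart_inj by blast+
    have sub: "V \<subseteq> points Y" "U \<subseteq> points Z'" using openin_subset[OF complex_chart_openin[OF cV]] openin_subset[OF complex_chart_openin[OF cU]] .
    \<comment> \<open>Descent starts from this open set upstairs: its images under
      \<open>\<phi> \<circ> p\<close> and \<open>\<psi> \<circ> R\<close> are exactly the two
      coordinate domains on which holomorphy is claimed.\<close>
    define W where "W = {x \<in> points Z. p x \<in> V} \<inter> {x \<in> points Z. R x \<in> U}"
    have oR: "openin (carrier_top Z) {x \<in> points Z. R x \<in> U}"
      using holomorphic_map_coordinate[OF *(1,2,7) U] by (simp add: holomorphic_function_def)
    have oW: "openin (carrier_top Z) W"
      unfolding W_def using hol[OF V] oR unfolding holomorphic_function_def by blast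
    have hP: "holomorphic_function Z W (\<phi> \<circ> p)"
      by (rule holomorphic_function_subset[OF hol[OF V] oW]) (simp add: W_def)
    have "holomorphic_function Z {x \<in> points Z. R x \<in> U} (\<psi> \<circ> R)"
      by (rule holomorphic_map_coordinate[OF *(1,2,7) U])
    then have hQ: "holomorphic_function Z W (\<psi> \<circ> R)"
      by (rule holomorphic_function_subset[OF _ oW]) (simp add: W_def)
    have W1: "x \<in> points Z" "p x \<in> V" "R x \<in> U" if "x \<in> W" for x using that by (auto simp: W_def)
    have W2: "x \<in> W" if "x \<in> points Z" "p x \<in> V" "R x \<in> U" for x using that by (auto simp: W_def)
    have imP: "(\<phi> \<circ> p) ` W = \<phi> ` {y \<in> V. F y \<in> U}"
    proof (intro subset_antisym subsetI)
      fix s assume "s \<in> (\<phi> \<circ> p) ` W"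
      then show "s \<in> \<phi> ` {y \<in> V. F y \<in> U}" using W1 Fp by auto
    next
      fix s assume "s \<in> \<phi> ` {y \<in> V. F y \<in> U}"
      then obtain y where y: "s = \<phi> y" "y \<in> V" "F y \<in> U" by blast
      then obtain x where "x \<in> points Z" "y = p x" using sub surjp by blast
      with y show "s \<in> (\<phi> \<circ> p) ` W" using W2 Fp by (intro image_eqI[of _ _ x]) auto
    qed
    have imQ: "(\<psi> \<circ> R) ` W = \<psi> ` {y \<in> U. K y \<in> V}"
    proof (intro subset_antisym subsetI)
      fix s assume "s \<in> (\<psi> \<circ> R) ` W"
      then show "s \<in> \<psi> ` {y \<in> U. K y \<in> V}" using W1 KR by auto
    next
      fix s assume "s \<in> \<psi> ` {y \<in> U. K y \<in> V}"
      then obtain y where y: "s = \<psi> y" "y \<in> U" "K y \<in> V" by blast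
      then obtain x where "x \<in> points Z" "y = R x" using sub surjR by blast
      with y show "s \<in> (\<psi> \<circ> R) ` W" using W2 KR by (intro image_eqI[of _ _ x]) auto
    qed
    have ncR: "\<exists>y\<in>T. \<exists>z\<in>T. R y \<noteq> R z" if "openin (carrier_top Z) T" "T \<noteq> {}" for T
      using branched_covering_not_locally_constant[OF bc that] .
    have ncP: "\<exists>y\<in>T. \<exists>z\<in>T. (\<phi> \<circ> p) y \<noteq> (\<phi> \<circ> p) z" if T: "openin (carrier_top Z) T" "T \<noteq> {}" "T \<subseteq> W" for T
    proof -
      obtain y z where yz: "y \<in> T" "z \<in> T" "R y \<noteq> R z" using ncR[OF T(1,2)] by blast
      have W: "y \<in> W" "z \<in> W" using yz T(3) by auto
      have "p y \<noteq> p z" using fib[OF W1(1)[OF W(1)] W1(1)[OF W(2)]] yz(3) by simp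
      then have "\<phi> (p y) \<noteq> \<phi> (p z)" using inj_onD[OF inj(1) _ W1(2)[OF W(1)] W1(2)[OF W(2)]] by blast
      then show ?thesis using yz by auto
    qed
    have ncQ: "\<exists>y\<in>T. \<exists>z\<in>T. (\<psi> \<circ> R) y \<noteq> (\<psi> \<circ> R) z" if T: "openin (carrier_top Z) T" "T \<noteq> {}" "T \<subseteq> W" for T
    proof -
      obtain y z where yz: "y \<in> T" "z \<in> T" "R y \<noteq> R z" using ncR[OF T(1,2)] by blast
      have W: "y \<in> W" "z \<in> W" using yz T(3) by auto
      have "\<psi> (R y) \<noteq> \<psi> (R z)" using inj_onD[OF inj(2) _ W1(3)[OF W(1)] W1(3)[OF W(2)]] yz(3) by blast
      then show ?thesis using yz by auto
    qed
    show "(\<psi> \<circ> F \<circ> inv_into V \<phi>) holomorphic_on \<phi> ` {y \<in> V. F y \<in> U}"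
    proof (rule holomorphic_on_locally)
      fix s assume "s \<in> \<phi> ` {y \<in> V. F y \<in> U}"
      then obtain x where x: "x \<in> W" "s = (\<phi> \<circ> p) x" unfolding imP[symmetric] by blast
      have "\<exists>e>0. (\<psi> \<circ> F \<circ> inv_into V \<phi>) holomorphic_on ball ((\<phi> \<circ> p) x) e"
      proof (rule holomorphic_descent_surface[OF *(1) oW x(1) hP hQ ncP])
        show "continuous_on ((\<phi> \<circ> p) ` W) (\<psi> \<circ> F \<circ> inv_into V \<phi>)"
          unfolding imP by (rule continuous_on_between_charts[OF cV cU contF])
        show "(\<psi> \<circ> F \<circ> inv_into V \<phi>) ((\<phi> \<circ> p) y) = (\<psi> \<circ> R) y" if "y \<in> W" for y
          using W1[OF that] inj(1) Fp by simp
      qed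
      then show "\<exists>e>0. (\<psi> \<circ> F \<circ> inv_into V \<phi>) holomorphic_on ball s e" unfolding x(2) .
    qed
    show "(\<phi> \<circ> K \<circ> inv_into U \<psi>) holomorphic_on \<psi> ` {y \<in> U. K y \<in> V}"
    proof (rule holomorphic_on_locally)
      fix s assume "s \<in> \<psi> ` {y \<in> U. K y \<in> V}"
      then obtain x where x: "x \<in> W" "s = (\<psi> \<circ> R) x" unfolding imQ[symmetric] by blast
      have "\<exists>e>0. (\<phi> \<circ> K \<circ> inv_into U \<psi>) holomorphic_on ball ((\<psi> \<circ> R) x) e"
      proof (rule holomorphic_descent_surface[OF *(1) oW x(1) hQ hP ncQ])
        show "continuous_on ((\<psi> \<circ> R) ` W) (\<phi> \<circ> K \<circ> inv_into U \<psi>)"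
          unfolding imQ by (rule continuous_on_between_charts[OF cU cV contK])
        show "(\<phi> \<circ> K \<circ> inv_into U \<psi>) ((\<psi> \<circ> R) y) = (\<phi> \<circ> p) y" if "y \<in> W" for y
          using W1[OF that] inj(2) KR by simp
      qed
      then show "\<exists>e>0. (\<phi> \<circ> K \<circ> inv_into U \<psi>) holomorphic_on ball s e" unfolding x(2) .
    qed
  qed
  have hF: "holomorphic_map Y Z' F" unfolding holomorphic_map_def
    by (intro conjI contF ballI, clarify) (rule main(1))
  have hK: "holomorphic_map Z' Y K" unfolding holomorphic_map_def
    by (intro conjI contK ballI, clarify) (rule main(2))
  have KF: "K (F y) = y" if y: "y \<in> points Y" for y
  proof -
    obtain x where "x \<in> points Z" "y = p x" using surjp y by blast
    then show ?thesis using Fp KR by simp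
  qed
  have FK: "F (K y) = y" if y: "y \<in> points Z'" for y
  proof -
    obtain x where "x \<in> points Z" "y = R x" using surjR y by blast
    then show ?thesis using Fp KR by simp
  qed
  have "biholomorphism Y Z' F" unfolding biholomorphism_def using hF hK KF FK by blast
  then show ?thesis using that Fp by blast
qed


section \<open>Homogeneous coordinates on the sphere\<close>


text \<open>The point with homogeneous coordinates \<open>[z : w]\<close>, i.e. with \<open>north_coordinate\<close> equal to
  \<open>z / w\<close>; it lies on the sphere unless \<open>z = w = 0\<close>.\<close>

definition st :: "complex \<Rightarrow> complex \<Rightarrow> real^3" where
  "st z w = (let n = (cmod z)\<^sup>2 + (cmod w)\<^sup>2 in
     vector [2 * Re (z * cnj w) / n, 2 * Im (z * cnj w) / n, ((cmod z)\<^sup>2 - (cmod w)\<^sup>2) / n])"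

lemma st_components:
  "st z w $ 1 = 2 * Re (z * cnj w) / ((cmod z)\<^sup>2 + (cmod w)\<^sup>2)"
  "st z w $ 2 = 2 * Im (z * cnj w) / ((cmod z)\<^sup>2 + (cmod w)\<^sup>2)"
  "st z w $ 3 = ((cmod z)\<^sup>2 - (cmod w)\<^sup>2) / ((cmod z)\<^sup>2 + (cmod w)\<^sup>2)"
  by (simp_all add: st_def Let_def)

lemma vec3_eq_iff: "(x::real^3) = y \<longleftrightarrow> x $ 1 = y $ 1 \<and> x $ 2 = y $ 2 \<and> x $ 3 = y $ 3"
  by (simp add: vec_eq_iff forall_3)

lemma axis3_components [simp]: 
  "(axis 3 1 :: real^3) $ 1 = 0" "(axis 3 1 :: real^3) $ 2 = 0" "(axis 3 1 :: real^3) $ 3 = 1"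
  by (auto simp: axis_def)

lemma sphere3_iff: "(x::real^3) \<in> sphere 0 1 \<longleftrightarrow> (x $ 1)\<^sup>2 + (x $ 2)\<^sup>2 + (x $ 3)\<^sup>2 = 1"
  by (simp add: norm_eq_1 inner_vec_def sum_3 power2_eq_square)

lemma st_denominator:
  assumes "z \<noteq> 0 \<or> w \<noteq> 0" shows "(cmod z)\<^sup>2 + (cmod w)\<^sup>2 > 0"
  using assms by (metis add_pos_nonneg add_nonneg_pos zero_le_power2 zero_less_norm_iff zero_less_power)

lemma st_in_sphere:
  assumes "z \<noteq> 0 \<or> w \<noteq> 0" shows "st z w \<in> sphere 0 1"
proof -
  let ?n = "(cmod z)\<^sup>2 + (cmod w)\<^sup>2"
  have n: "?n \<noteq> 0" using less_imp_neq[OF st_denominator[OF assms]] by (rule not_sym)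
  have "(2 * Re (z * cnj w))\<^sup>2 + (2 * Im (z * cnj w))\<^sup>2 = 4 * (cmod (z * cnj w))\<^sup>2"
    by (simp only: cmod_power2[of "z * cnj w"] power_mult_distrib) (simp add: algebra_simps)
  also have "\<dots> = 4 * (cmod z)\<^sup>2 * (cmod w)\<^sup>2" by (simp add: norm_mult power_mult_distrib)
  finally have "(2 * Re (z * cnj w))\<^sup>2 + (2 * Im (z * cnj w))\<^sup>2 + ((cmod z)\<^sup>2 - (cmod w)\<^sup>2)\<^sup>2 = ?n\<^sup>2"
    by (simp add: power2_eq_square algebra_simps)
  then show ?thesis unfolding sphere3_iff st_components power_divide
    using n by (simp add: add_divide_distrib[symmetric])
qed

lemma norm_st: "z \<noteq> 0 \<or> w \<noteq> 0 \<Longrightarrow> norm (st z w) = 1"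
  using st_in_sphere by (simp add: sphere_def)

lemma st_scale: assumes "c \<noteq> 0" shows "st (c * z) (c * w) = st z w"
proof -
  have c: "(cmod c)\<^sup>2 \<noteq> 0" using assms by simp
  have r: "c * z * cnj (c * w) = complex_of_real ((cmod c)\<^sup>2) * (z * cnj w)"
    unfolding complex_norm_square by (simp add: mult_ac)
  have n: "(cmod (c * z))\<^sup>2 + (cmod (c * w))\<^sup>2 = (cmod c)\<^sup>2 * ((cmod z)\<^sup>2 + (cmod w)\<^sup>2)"
    "(cmod (c * z))\<^sup>2 - (cmod (c * w))\<^sup>2 = (cmod c)\<^sup>2 * ((cmod z)\<^sup>2 - (cmod w)\<^sup>2)"
    by (simp_all add: norm_mult power_mult_distrib algebra_simps)
  have k: "2 * (a * b) / (a * d) = 2 * b / d" "(a * b) / (a * d) = b / d" if "a \<noteq> 0" for a b d :: real 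
    using that by simp_all
  have rr: "Re (complex_of_real a * x) = a * Re x" "Im (complex_of_real a * x) = a * Im x" for a x
    by simp_all
  show ?thesis
    unfolding vec3_eq_iff st_components n unfolding r rr by (simp only: k[OF c])
qed

lemma quotient_cancel: "n \<noteq> 0 \<Longrightarrow> (2 * a / n) / (2 * b / n) = a / b" for a b n :: real
  by simp

lemma north_st: assumes "w \<noteq> 0" shows "north_coordinate (st z w) = z / w"
proof -
  let ?n = "(cmod z)\<^sup>2 + (cmod w)\<^sup>2"
  have n: "?n \<noteq> 0" using st_denominator[of z w] assms by simp
  have w: "(cmod w)\<^sup>2 \<noteq> 0" using assms by simp
  have "1 - ((cmod z)\<^sup>2 - (cmod w)\<^sup>2) / ?n = 2 * (cmod w)\<^sup>2 / ?n" using n by (simp add: field_simps)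
  then have "north_coordinate (st z w) = Complex (Re (z * cnj w) / (cmod w)\<^sup>2) (Im (z * cnj w) / (cmod w)\<^sup>2)"
    unfolding north_coordinate_def st_components by (simp only: quotient_cancel[OF n])
  also have "\<dots> = z * cnj w / complex_of_real ((cmod w)\<^sup>2)"
    by (simp add: complex_eq_iff Re_divide_of_real Im_divide_of_real del: of_real_power)
  also have "\<dots> = z / w" unfolding complex_norm_square using assms by simp
  finally show ?thesis .
qed

lemma south_st: assumes "z \<noteq> 0" shows "south_coordinate (st z w) = w / z"
proof -
  let ?n = "(cmod z)\<^sup>2 + (cmod w)\<^sup>2"
  have n: "?n \<noteq> 0" using st_denominator[of z w] assms by simp
  have w: "(cmod z)\<^sup>2 \<noteq> 0" using assms by simp
  have flip: "- (2 * Im (z * cnj w) / ?n) = 2 * Im (w * cnj z) / ?n" "2 * Re (z * cnj w) / ?n = 2 * Re (w * cnj z) / ?n"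
    by (simp_all add: minus_divide_left algebra_simps)
  have "1 + ((cmod z)\<^sup>2 - (cmod w)\<^sup>2) / ?n = 2 * (cmod z)\<^sup>2 / ?n" using n by (simp add: field_simps)
  then have "south_coordinate (st z w) = Complex (Re (w * cnj z) / (cmod z)\<^sup>2) (Im (w * cnj z) / (cmod z)\<^sup>2)"
    unfolding south_coordinate_def st_components flip by (simp only: quotient_cancel[OF n])
  also have "\<dots> = w * cnj z / complex_of_real ((cmod z)\<^sup>2)"
    by (simp add: complex_eq_iff Re_divide_of_real Im_divide_of_real del: of_real_power)
  also have "\<dots> = w / z" unfolding complex_norm_square using assms by simp
  finally show ?thesis .
qed

lemma st_zero_right: "z \<noteq> 0 \<Longrightarrow> st z 0 = axis 3 1" and st_zero_left: "w \<noteq> 0 \<Longrightarrow> st 0 w = - axis 3 1"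
  unfolding vec3_eq_iff st_components by simp_all

lemma st_eq_north_pole: assumes "z \<noteq> 0 \<or> w \<noteq> 0" shows "st z w = axis 3 1 \<longleftrightarrow> w = 0"
proof
  assume e: "st z w = axis 3 1"
  have "st z w $ 3 = 1" unfolding e by simp
  then have "(cmod w)\<^sup>2 = 0" using st_denominator[OF assms] unfolding st_components by (simp add: field_simps)
  then show "w = 0" by simp
qed (use assms st_zero_right in auto)

lemma st_eq_south_pole: assumes "z \<noteq> 0 \<or> w \<noteq> 0" shows "st z w = - axis 3 1 \<longleftrightarrow> z = 0"
proof
  assume e: "st z w = - axis 3 1"
  have "st z w $ 3 = - 1" unfolding e by simp
  then have "(cmod z)\<^sup>2 - (cmod w)\<^sup>2 = - 1 * ((cmod z)\<^sup>2 + (cmod w)\<^sup>2)" 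
    using less_imp_neq[OF st_denominator[OF assms]] unfolding st_components 
    by (metis nonzero_divide_eq_eq)
  then have "(cmod z)\<^sup>2 = 0" by simp
  then show "z = 0" by simp
qed (use assms st_zero_left in auto)

lemma st_eq_iff:
  assumes "z \<noteq> 0 \<or> w \<noteq> 0" "z' \<noteq> 0 \<or> w' \<noteq> 0"
  shows "st z w = st z' w' \<longleftrightarrow> z * w' = z' * w"
proof (cases "w = 0 \<or> w' = 0")
  case True
  then show ?thesis using st_eq_north_pole[OF assms(1)] st_eq_north_pole[OF assms(2)] assms st_zero_right by (metis mult_eq_0_iff)
next
  case False
  have "st z w = st z' w'" if "z / w = z' / w'"
  proof -
    have "st z w = st (w * (z / w)) (w * 1)" "st z' w' = st (w' * (z' / w')) (w' * 1)" using False by simp_all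
    then show ?thesis using False st_scale that by metis
  qed
  moreover have "z / w = z' / w'" if "st z w = st z' w'" using that north_st False by metis
  ultimately show ?thesis using False by (auto simp: field_simps)
qed

lemma st_north:
  assumes x: "x \<in> sphere 0 1" "x \<noteq> axis 3 1" shows "st (north_coordinate x) 1 = x"
proof -
  have s: "(x $ 1)\<^sup>2 + (x $ 2)\<^sup>2 + (x $ 3)\<^sup>2 = 1" using x(1) sphere3_iff by blast
  have "x $ 3 \<noteq> 1"
  proof
    assume "x $ 3 = 1"
    then have "(x $ 1)\<^sup>2 + (x $ 2)\<^sup>2 = 0" using s by simp
    then have "x $ 1 = 0" "x $ 2 = 0" by (simp_all add: sum_power2_eq_zero_iff)
    then show False using x(2) \<open>x $ 3 = 1\<close> by (simp add: vec3_eq_iff)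
  qed
  then have d: "1 - x $ 3 \<noteq> 0" by simp
  have q: "(cmod (north_coordinate x))\<^sup>2 = (1 + x $ 3) / (1 - x $ 3)"
  proof -
    have "(cmod (north_coordinate x))\<^sup>2 = ((x $ 1)\<^sup>2 + (x $ 2)\<^sup>2) / (1 - x $ 3)\<^sup>2"
      by (simp add: north_coordinate_def cmod_power2 power_divide add_divide_distrib)
    also have "(x $ 1)\<^sup>2 + (x $ 2)\<^sup>2 = (1 + x $ 3) * (1 - x $ 3)" using s by (simp add: power2_eq_square algebra_simps)
    finally show ?thesis using d by (simp add: power2_eq_square)
  qed
  have n: "(cmod (north_coordinate x))\<^sup>2 + (cmod 1)\<^sup>2 = 2 / (1 - x $ 3)"
      "(cmod (north_coordinate x))\<^sup>2 - (cmod 1)\<^sup>2 = 2 * x $ 3 / (1 - x $ 3)" 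
    unfolding q using d by (simp_all add: field_simps)
  show ?thesis unfolding vec3_eq_iff st_components n
    using d by (simp add: north_coordinate_def)
qed

text \<open>The half-turn about the first axis. It interchanges the two homogeneous coordinates,
  hence the two charts, so facts about the south chart follow from the north chart; later it also
  serves as a dihedral symmetry.\<close>

definition xflip :: "real^3 \<Rightarrow> real^3" where "xflip x = vector [x $ 1, - x $ 2, - x $ 3]"

lemma xflip_components [simp]: "xflip x $ 1 = x $ 1" "xflip x $ 2 = - x $ 2" "xflip x $ 3 = - x $ 3"
  by (simp_all add: xflip_def)

lemma xflip_xflip [simp]: "xflip (xflip x) = x" by (simp add: vec3_eq_iff)

lemma xflip_st: "xflip (st z w) = st w z"
  unfolding vec3_eq_iff xflip_components st_components by (simp add: algebra_simps minus_divide_left)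

lemma south_xflip: "south_coordinate x = north_coordinate (xflip x)"
  by (simp add: south_coordinate_def north_coordinate_def)

lemma st_south:
  assumes x: "x \<in> sphere 0 1" "x \<noteq> - axis 3 1" shows "st 1 (south_coordinate x) = x"
proof -
  have "xflip x \<in> sphere 0 1" using x(1) unfolding sphere3_iff by simp
  moreover have "xflip x \<noteq> axis 3 1" using x(2) by (auto simp: vec3_eq_iff)
  ultimately have "st (south_coordinate x) 1 = xflip x" unfolding south_xflip by (rule st_north)
  then show ?thesis using xflip_st[of "south_coordinate x" 1] by simp
qed

lemma sphere_eq_st:
  assumes "x \<in> sphere 0 1"
  obtains z w where "z \<noteq> 0 \<or> w \<noteq> 0" "x = st z w"
  using st_north[OF assms] st_zero_right[of 1] that by (metis zero_neq_one)

lemma continuous_on_st: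
  assumes "continuous_on D p" "continuous_on D q" "\<And>t. t \<in> D \<Longrightarrow> p t \<noteq> 0 \<or> q t \<noteq> 0"
  shows "continuous_on D (\<lambda>t. st (p t) (q t))"
proof -
  have nz: "\<forall>t\<in>D. (cmod (p t))\<^sup>2 + (cmod (q t))\<^sup>2 \<noteq> 0" using st_denominator assms(3) by force
  have "continuous_on D (\<lambda>t. st (p t) (q t) $ 1)" "continuous_on D (\<lambda>t. st (p t) (q t) $ 2)"
    "continuous_on D (\<lambda>t. st (p t) (q t) $ 3)"
    unfolding st_components by (intro continuous_intros assms(1,2) nz)+
  then have "continuous_on D (\<lambda>t. st (p t) (q t) $ i)" for i using exhaust_3[of i] by auto
  then have "continuous_on D (\<lambda>t. \<chi> i. st (p t) (q t) $ i)" by (rule continuous_on_vec_lambda)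
  then show ?thesis by simp
qed

section \<open>The sphere as a compact connected Riemann surface\<close>

lemma riemann_sphere_simps [simp]:
  "carrier_top riemann_sphere = top_of_set (sphere 0 1)"
  "atlas riemann_sphere = {(sphere 0 1 - {axis 3 1}, north_coordinate), (sphere 0 1 - {- axis 3 1}, south_coordinate)}"
  by (simp_all add: riemann_sphere_def)

lemma inv_into_north: "inv_into (sphere 0 1 - {axis 3 1}) north_coordinate z = st z 1"
proof (rule inv_into_f_eq)
  show "inj_on north_coordinate (sphere 0 1 - {axis 3 1})"
    by (rule inj_on_inverseI[of _ "\<lambda>z. st z 1"]) (simp add: st_north del: mem_sphere_0)
  show "st z 1 \<in> sphere 0 1 - {axis 3 1}" using st_in_sphere[of z 1] st_eq_north_pole[of z 1] by simp
qed (simp add: north_st)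

lemma inv_into_south: "inv_into (sphere 0 1 - {- axis 3 1}) south_coordinate z = st 1 z"
proof (rule inv_into_f_eq)
  show "inj_on south_coordinate (sphere 0 1 - {- axis 3 1})"
    by (rule inj_on_inverseI[of _ "\<lambda>z. st 1 z"]) (simp add: st_south del: mem_sphere_0)
  show "st 1 z \<in> sphere 0 1 - {- axis 3 1}" using st_in_sphere[of 1 z] st_eq_south_pole[of 1 z] by simp
qed (simp add: south_st)

lemma complex_chart_sphere:
  fixes p :: "real^3" and c :: "real^3 \<Rightarrow> complex" and s :: "complex \<Rightarrow> real^3"
  assumes c: "continuous_on (sphere 0 1 - {p}) c" and s: "continuous_on UNIV s"
    and cs: "\<And>z. c (s z) = z" "\<And>z. s z \<in> sphere 0 1 - {p}" and sc: "\<And>x. x \<in> sphere 0 1 - {p} \<Longrightarrow> s (c x) = x"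
  shows "complex_chart (top_of_set (sphere 0 1)) (sphere 0 1 - {p}) c"
proof (rule complex_chartI)
  show o: "openin (top_of_set (sphere 0 1)) (sphere 0 1 - {p})" by (simp add: openin_delete)
  show "inj_on c (sphere 0 1 - {p})" by (rule inj_on_inverseI[of _ s]) (rule sc)
  show "open (c ` W)" if W: "openin (top_of_set (sphere 0 1)) W" "W \<subseteq> sphere 0 1 - {p}" for W
  proof -
    obtain W' where W': "open W'" "W = sphere 0 1 \<inter> W'" using W(1) by (auto simp: openin_open)
    have "c ` W = s -` W'"
    proof (intro subset_antisym subsetI)
      fix z assume "z \<in> c ` W" then show "z \<in> s -` W'" using sc W(2) W'(2) by (fastforce simp del: mem_sphere_0)
    next
      fix z assume "z \<in> s -` W'" 
      then have "s z \<in> W" using cs(2)[of z] W'(2) by blast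
      then show "z \<in> c ` W" using cs(1)[of z] by (metis image_eqI)
    qed
    then show ?thesis using s W'(1) open_vimage continuous_on_eq_continuous_within by (metis continuous_open_vimage)
  qed
  show "openin (top_of_set (sphere 0 1)) {x \<in> sphere 0 1 - {p}. c x \<in> B}" if "open B" for B
  proof -
    have "{x \<in> sphere 0 1 - {p}. c x \<in> B} = (sphere 0 1 - {p}) \<inter> c -` B" by auto
    moreover have "openin (top_of_set (sphere 0 1 - {p})) ((sphere 0 1 - {p}) \<inter> c -` B)"
      using continuous_openin_preimage_gen[OF c that] .
    ultimately show ?thesis using openin_trans[OF _ o] by simp
  qed
qed

lemma complex_chart_north: "complex_chart (top_of_set (sphere 0 1)) (sphere 0 1 - {axis 3 1}) north_coordinate"
proof (rule complex_chart_sphere[where s = "\<lambda>z. st z 1"])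
  have nz: "1 - x $ 3 \<noteq> 0" if "x \<in> sphere 0 1 - {axis 3 1}" for x :: "real^3"
  proof
    assume "1 - x $ 3 = 0"
    then have "(x $ 1)\<^sup>2 + (x $ 2)\<^sup>2 = 0" "x $ 3 = 1" using that sphere3_iff[of x] by auto
    then have "x = axis 3 1" by (simp add: vec3_eq_iff sum_power2_eq_zero_iff)
    then show False using that by blast
  qed
  show "continuous_on (sphere 0 1 - {axis 3 1}) north_coordinate"
    unfolding north_coordinate_def Complex_eq using nz by (intro continuous_intros) blast+
qed (auto simp: north_st st_north st_eq_north_pole norm_st intro!: continuous_on_st continuous_intros)

lemma complex_chart_south: "complex_chart (top_of_set (sphere 0 1)) (sphere 0 1 - {- axis 3 1}) south_coordinate"
proof (rule complex_chart_sphere[where s = "\<lambda>z. st 1 z"])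
  have nz: "1 + x $ 3 \<noteq> 0" if "x \<in> sphere 0 1 - {- axis 3 1}" for x :: "real^3"
  proof
    assume "1 + x $ 3 = 0"
    then have x3: "x $ 3 = - 1" by simp
    then have "(x $ 1)\<^sup>2 + (x $ 2)\<^sup>2 = 0" using that sphere3_iff[of x] by auto
    then have "x = - axis 3 1" using x3 by (simp add: vec3_eq_iff sum_power2_eq_zero_iff)
    then show False using that by blast
  qed
  show "continuous_on (sphere 0 1 - {- axis 3 1}) south_coordinate"
    unfolding south_coordinate_def Complex_eq using nz by (intro continuous_intros) blast+
qed (auto simp: south_st st_south st_eq_south_pole norm_st intro!: continuous_on_st continuous_intros)

lemma north_south_image:
  "north_coordinate ` ((sphere 0 1 - {axis 3 1}) \<inter> (sphere 0 1 - {- axis 3 1})) \<subseteq> - {0}"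
  "south_coordinate ` ((sphere 0 1 - {- axis 3 1}) \<inter> (sphere 0 1 - {axis 3 1})) \<subseteq> - {0}"
proof -
  show "north_coordinate ` ((sphere 0 1 - {axis 3 1}) \<inter> (sphere 0 1 - {- axis 3 1})) \<subseteq> - {0}"
  proof
    fix z assume "z \<in> north_coordinate ` ((sphere 0 1 - {axis 3 1}) \<inter> (sphere 0 1 - {- axis 3 1}))"
    then obtain x where x: "x \<in> sphere 0 1" "x \<noteq> axis 3 1" "x \<noteq> - axis 3 1" "z = north_coordinate x" by blast
    then show "z \<in> - {0}" using st_north[OF x(1,2)] st_zero_left[of 1] by auto
  qed
  show "south_coordinate ` ((sphere 0 1 - {- axis 3 1}) \<inter> (sphere 0 1 - {axis 3 1})) \<subseteq> - {0}"
  proof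
    fix z assume "z \<in> south_coordinate ` ((sphere 0 1 - {- axis 3 1}) \<inter> (sphere 0 1 - {axis 3 1}))"
    then obtain x where x: "x \<in> sphere 0 1" "x \<noteq> axis 3 1" "x \<noteq> - axis 3 1" "z = south_coordinate x" by blast
    then show "z \<in> - {0}" using st_south[OF x(1,3)] st_zero_right[of 1] by auto
  qed
qed

lemma riemann_surface_sphere: "riemann_surface riemann_sphere"
proof -
  let ?N = "sphere 0 1 - {axis 3 1 :: real^3}" and ?S = "sphere 0 1 - {- axis 3 1 :: real^3}"
  have t1: "holomorphic_transition (?N, north_coordinate) (?S, south_coordinate)"
    unfolding holomorphic_transition_def prod.case
  proof (rule holomorphic_on_subset[OF _ north_south_image(1)])
    show "(south_coordinate \<circ> inv_into ?N north_coordinate) holomorphic_on - {0}"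
      by (rule holomorphic_transform[where f = "\<lambda>z. 1 / z"]) (auto simp: inv_into_north south_st intro!: holomorphic_intros)
  qed
  have t2: "holomorphic_transition (?S, south_coordinate) (?N, north_coordinate)"
    unfolding holomorphic_transition_def prod.case
  proof (rule holomorphic_on_subset[OF _ north_south_image(2)])
    show "(north_coordinate \<circ> inv_into ?S south_coordinate) holomorphic_on - {0}"
      by (rule holomorphic_transform[where f = "\<lambda>z. 1 / z"]) (auto simp: inv_into_south north_st intro!: holomorphic_intros)
  qed
  have t3: "holomorphic_transition (?N, north_coordinate) (?N, north_coordinate)"
    unfolding holomorphic_transition_def prod.case
    by (rule holomorphic_transform[where f = "\<lambda>z. z"]) (auto simp: inv_into_north north_st intro!: holomorphic_intros)
  have t4: "holomorphic_transition (?S, south_coordinate) (?S, south_coordinate)"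
    unfolding holomorphic_transition_def prod.case
    by (rule holomorphic_transform[where f = "\<lambda>z. z"]) (auto simp: inv_into_south south_st intro!: holomorphic_intros)
  have "axis 3 1 \<noteq> (- axis 3 1 :: real^3)" by (simp add: vec3_eq_iff)
  then have "?N \<union> ?S = sphere 0 1" by blast
  moreover have "Hausdorff_space (top_of_set (sphere (0::real^3) 1))"
    by (rule Hausdorff_space_subtopology[OF Hausdorff_space_euclidean])
  ultimately show ?thesis
    unfolding riemann_surface_def using complex_chart_north complex_chart_south t1 t2 t3 t4 by simp
qed

lemma compact_connected_sphere: "compact_connected_riemann_surface riemann_sphere"
proof -
  have "connected (sphere (0::real^3) 1)" by (rule connected_sphere) simp
  then have "connectedin euclidean (sphere (0::real^3) 1)" by simp
  then have "connected_space (top_of_set (sphere (0::real^3) 1))" unfolding connectedin_def by blast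
  moreover have "compact_space (top_of_set (sphere (0::real^3) 1))"
    by (simp add: compact_space_subtopology)
  ultimately show ?thesis
    unfolding compact_connected_riemann_surface_def using riemann_surface_sphere by simp
qed

lemma hol_at_st:
  assumes p: "p holomorphic_on D" and q: "q holomorphic_on D" and D: "open D" "z \<in> D" and nz: "p z \<noteq> 0 \<or> q z \<noteq> 0"
  shows "hol_at riemann_sphere (\<lambda>t. st (p t) (q t)) z"
proof -
  have pre: "open (D \<inter> f -` (- {0}))" if "f holomorphic_on D" for f :: "complex \<Rightarrow> complex"
    using holomorphic_on_imp_continuous_on[OF that] D by (intro continuous_open_preimage) auto
  show ?thesis
  proof (cases "q z = 0")
    case False
    show ?thesis
    proof (rule hol_atI[where U = "sphere 0 1 - {axis 3 1}" and \<phi> = north_coordinate and D = "D \<inter> q -` (- {0})"])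
      show "(north_coordinate \<circ> (\<lambda>t. st (p t) (q t))) holomorphic_on D \<inter> q -` (- {0})"
        by (rule holomorphic_transform[where f = "\<lambda>t. p t / q t"])
           (auto simp: north_st intro!: holomorphic_intros intro: holomorphic_on_subset[OF p] holomorphic_on_subset[OF q])
      show "(\<lambda>t. st (p t) (q t)) ` (D \<inter> q -` (- {0})) \<subseteq> sphere 0 1 - {axis 3 1}"
        by (auto simp: st_eq_north_pole simp del: mem_sphere_0 intro!: st_in_sphere)
    qed (use pre[OF q] D False in auto)
  next
    case True
    then have p0: "p z \<noteq> 0" using nz by simp
    show ?thesis
    proof (rule hol_atI[where U = "sphere 0 1 - {- axis 3 1}" and \<phi> = south_coordinate and D = "D \<inter> p -` (- {0})"])
      show "(south_coordinate \<circ> (\<lambda>t. st (p t) (q t))) holomorphic_on D \<inter> p -` (- {0})"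
        by (rule holomorphic_transform[where f = "\<lambda>t. q t / p t"])
           (auto simp: south_st intro!: holomorphic_intros intro: holomorphic_on_subset[OF p] holomorphic_on_subset[OF q])
      show "(\<lambda>t. st (p t) (q t)) ` (D \<inter> p -` (- {0})) \<subseteq> sphere 0 1 - {- axis 3 1}"
        by (auto simp: st_eq_south_pole simp del: mem_sphere_0 intro!: st_in_sphere)
    qed (use pre[OF p] D p0 in auto)
  qed
qed

text \<open>The curves [t : 1] and [1 : t] are the inverses of the two charts. From here on,
  questions about maps on the sphere are settled on these two curves.\<close>

lemma holomorphic_map_from_sphere:
  assumes Y: "riemann_surface Y" 
    and "\<And>z. hol_at Y (\<lambda>t. f (st t 1)) z" "\<And>z. hol_at Y (\<lambda>t. f (st 1 t)) z"
  shows "holomorphic_map riemann_sphere Y f"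
proof (rule holomorphic_mapI[OF riemann_surface_sphere Y])
  fix U \<phi> z assume "(U, \<phi>) \<in> atlas riemann_sphere" "z \<in> \<phi> ` U"
  then consider "U = sphere 0 1 - {axis 3 1}" "\<phi> = north_coordinate" | "U = sphere 0 1 - {- axis 3 1}" "\<phi> = south_coordinate" by auto
  then show "hol_at Y (f \<circ> inv_into U \<phi>) z"
    by cases (use assms in \<open>simp_all add: o_def inv_into_north inv_into_south\<close>)
qed

lemma holomorphic_map_sphere_curves:
  assumes Y: "riemann_surface Y" and f: "holomorphic_map riemann_sphere Y f"
  shows "hol_at Y (\<lambda>t. f (st t 1)) z" "hol_at Y (\<lambda>t. f (st 1 t)) z"
proof -
  have "hol_at riemann_sphere (\<lambda>t. st t 1) z" "hol_at riemann_sphere (\<lambda>t. st 1 t) z"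
    by (rule hol_at_st[where D = UNIV]; auto intro!: holomorphic_intros)+
  from this[THEN holomorphic_map_hol_at[OF riemann_surface_sphere Y f]]
  show "hol_at Y (\<lambda>t. f (st t 1)) z" "hol_at Y (\<lambda>t. f (st 1 t)) z" by (simp_all add: o_def)
qed


section \<open>Moebius transformations and rotations\<close>


unbundle cross3_syntax

text \<open>The self-map of the sphere that two binary forms \<open>A\<close>, \<open>B\<close> of the same degree induce on
  homogeneous coordinates.\<close>

definition hom_map :: "(complex \<Rightarrow> complex \<Rightarrow> complex) \<Rightarrow> (complex \<Rightarrow> complex \<Rightarrow> complex) \<Rightarrow> real^3 \<Rightarrow> real^3" where
  "hom_map A B x = (if x = axis 3 1 then st (A 1 0) (B 1 0) else st (A (north_coordinate x) 1) (B (north_coordinate x) 1))"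

lemma hom_map_st:
  assumes A: "\<And>k z w. A (k * z) (k * w) = k ^ N * A z w" and B: "\<And>k z w. B (k * z) (k * w) = k ^ N * B z w"
    and nz: "z \<noteq> 0 \<or> w \<noteq> 0"
  shows "hom_map A B (st z w) = st (A z w) (B z w)"
proof (cases "w = 0")
  case True
  then have z: "z \<noteq> 0" using nz by simp
  have "st (A z w) (B z w) = st (z ^ N * A 1 0) (z ^ N * B 1 0)" using A[of z 1 0] B[of z 1 0] True by simp
  also have "\<dots> = st (A 1 0) (B 1 0)" using z by (simp add: st_scale)
  finally show ?thesis using True z by (simp add: hom_map_def st_zero_right)
next
  case False
  have "st (A z w) (B z w) = st (w ^ N * A (z / w) 1) (w ^ N * B (z / w) 1)" 
    using A[of w "z / w" 1] B[of w "z / w" 1] False by simp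
  also have "\<dots> = st (A (z / w) 1) (B (z / w) 1)" using False by (simp add: st_scale)
  finally show ?thesis using False by (simp add: hom_map_def st_eq_north_pole north_st)
qed

lemma holomorphic_hom_map:
  assumes A: "\<And>k z w. A (k * z) (k * w) = k ^ N * A z w" and B: "\<And>k z w. B (k * z) (k * w) = k ^ N * B z w"
    and nz: "\<And>z w. z \<noteq> 0 \<or> w \<noteq> 0 \<Longrightarrow> A z w \<noteq> 0 \<or> B z w \<noteq> 0"
    and hol: "(\<lambda>t. A t 1) holomorphic_on UNIV" "(\<lambda>t. B t 1) holomorphic_on UNIV"
       "(\<lambda>t. A 1 t) holomorphic_on UNIV" "(\<lambda>t. B 1 t) holomorphic_on UNIV"
  shows "holomorphic_map riemann_sphere riemann_sphere (hom_map A B)"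
proof (rule holomorphic_map_from_sphere[OF riemann_surface_sphere])
  fix z
  have "(\<lambda>t. hom_map A B (st t 1)) = (\<lambda>t. st (A t 1) (B t 1))" by (rule ext, rule hom_map_st[where A = A and B = B and N = N, OF A B]) simp
  moreover have "hol_at riemann_sphere (\<lambda>t. st (A t 1) (B t 1)) z"
    by (rule hol_at_st[OF hol(1,2)]) (use nz[of z 1] in auto)
  ultimately show "hol_at riemann_sphere (\<lambda>t. hom_map A B (st t 1)) z" by simp
  have "(\<lambda>t. hom_map A B (st 1 t)) = (\<lambda>t. st (A 1 t) (B 1 t))" by (rule ext, rule hom_map_st[where A = A and B = B and N = N, OF A B]) simp
  moreover have "hol_at riemann_sphere (\<lambda>t. st (A 1 t) (B 1 t)) z"
    by (rule hol_at_st[OF hol(3,4)]) (use nz[of 1 z] in auto)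
  ultimately show "hol_at riemann_sphere (\<lambda>t. hom_map A B (st 1 t)) z" by simp
qed

definition moebius :: "complex \<Rightarrow> complex \<Rightarrow> complex \<Rightarrow> complex \<Rightarrow> real^3 \<Rightarrow> real^3" where
  "moebius a b c d = hom_map (\<lambda>z w. a * z + b * w) (\<lambda>z w. c * z + d * w)"

lemma moebius_nonzero:
  fixes a b c d z w :: complex
  assumes "a * d - b * c \<noteq> 0" "z \<noteq> 0 \<or> w \<noteq> 0"
  shows "a * z + b * w \<noteq> 0 \<or> c * z + d * w \<noteq> 0"
proof (rule ccontr)
  assume "\<not> ?thesis"
  then have e: "a * z + b * w = 0" "c * z + d * w = 0" by auto
  have "(a * d - b * c) * z = d * (a * z + b * w) - b * (c * z + d * w)"
    "(a * d - b * c) * w = a * (c * z + d * w) - c * (a * z + b * w)" by (simp_all add: algebra_simps)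
  then show False using e assms by simp
qed

lemma moebius_st: "z \<noteq> 0 \<or> w \<noteq> 0 \<Longrightarrow> moebius a b c d (st z w) = st (a * z + b * w) (c * z + d * w)"
  unfolding moebius_def by (rule hom_map_st[where N = 1]) (simp_all add: algebra_simps)

lemma holomorphic_moebius: "a * d - b * c \<noteq> 0 \<Longrightarrow> holomorphic_map riemann_sphere riemann_sphere (moebius a b c d)"
  unfolding moebius_def
proof (rule holomorphic_hom_map[where N = 1])
  show "a * z + b * w \<noteq> 0 \<or> c * z + d * w \<noteq> 0" if "a * d - b * c \<noteq> 0" "z \<noteq> 0 \<or> w \<noteq> 0" for z w
    using moebius_nonzero[OF that] .
qed (simp_all add: algebra_simps holomorphic_intros)

lemma moebius_in_sphere: 
  assumes "a * d - b * c \<noteq> 0" "x \<in> sphere 0 1" shows "moebius a b c d x \<in> sphere 0 1"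
proof -
  obtain z w where "z \<noteq> 0 \<or> w \<noteq> 0" "x = st z w" using sphere_eq_st[OF assms(2)] .
  then show ?thesis using moebius_st moebius_nonzero[OF assms(1)] st_in_sphere by metis
qed

lemma moebius_inverse:
  assumes d: "a * d - b * c \<noteq> 0" and x: "x \<in> sphere 0 1"
  shows "moebius d (- b) (- c) a (moebius a b c d x) = x"
proof -
  obtain z w where zw: "z \<noteq> 0 \<or> w \<noteq> 0" "x = st z w" using sphere_eq_st[OF x] .
  have "d * (a * z + b * w) + - b * (c * z + d * w) = (a * d - b * c) * z"
    "- c * (a * z + b * w) + a * (c * z + d * w) = (a * d - b * c) * w" by (simp_all add: algebra_simps)
  then show ?thesis
    using zw moebius_st[OF zw(1)] moebius_st[OF moebius_nonzero[OF d zw(1)]] st_scale[OF d] by simp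
qed

lemma moebius_inj: 
  assumes "a * d - b * c \<noteq> 0" shows "inj_on (moebius a b c d) (sphere 0 1)"
  by (rule inj_on_inverseI[of _ "moebius d (- b) (- c) a"]) (rule moebius_inverse[OF assms])

lemma moebius_standard_triple:
  assumes q: "q1 \<in> sphere 0 1" "q2 \<in> sphere 0 1" "q3 \<in> sphere 0 1" "q1 \<noteq> q2" "q1 \<noteq> q3" "q2 \<noteq> q3"
  obtains a b c d where "a * d - b * c \<noteq> 0" "moebius a b c d q1 = st 0 1" "moebius a b c d q2 = st 1 0" "moebius a b c d q3 = st 1 1"
proof -
  obtain x1 y1 where 1: "x1 \<noteq> 0 \<or> y1 \<noteq> 0" "q1 = st x1 y1" using sphere_eq_st[OF q(1)] .
  obtain x2 y2 where 2: "x2 \<noteq> 0 \<or> y2 \<noteq> 0" "q2 = st x2 y2" using sphere_eq_st[OF q(2)] .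
  obtain x3 y3 where 3: "x3 \<noteq> 0 \<or> y3 \<noteq> 0" "q3 = st x3 y3" using sphere_eq_st[OF q(3)] .
  \<comment> \<open>The forms y1 * z - x1 * w and y2 * z - x2 * w vanish at \<open>q1\<close> and at
    \<open>q2\<close>. Weighted by \<open>k1\<close> and \<open>k2\<close> they take the same value
    k1 * k2 at \<open>q3\<close>; the determinant of the resulting map is k1 * k2 * k3.\<close>
  define k1 where "k1 = x3 * y2 - y3 * x2"
  define k2 where "k2 = x3 * y1 - y3 * x1"
  define k3 where "k3 = x1 * y2 - y1 * x2"
  have k: "k1 \<noteq> 0" "k2 \<noteq> 0" "k3 \<noteq> 0" 
    using q(4-6) st_eq_iff[OF 3(1) 2(1)] st_eq_iff[OF 3(1) 1(1)] st_eq_iff[OF 1(1) 2(1)] 1(2) 2(2) 3(2)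
    unfolding k1_def k2_def k3_def by (auto simp: algebra_simps)
  have det: "(y1 * k1) * (- x2 * k2) - (- x1 * k1) * (y2 * k2) \<noteq> 0"
  proof -
    have "(y1 * k1) * (- x2 * k2) - (- x1 * k1) * (y2 * k2) = k1 * k2 * k3" by (simp add: k3_def algebra_simps)
    then show ?thesis using k by simp
  qed
  let ?m = "moebius (y1 * k1) (- x1 * k1) (y2 * k2) (- x2 * k2)"
  have "?m q1 = st 0 (k2 * k3)" unfolding 1(2) moebius_st[OF 1(1)] by (simp add: k3_def algebra_simps)
  also have "\<dots> = st 0 1" using st_zero_left k by simp
  finally have m1: "?m q1 = st 0 1" .
  have "?m q2 = st (- k1 * k3) 0" unfolding 2(2) moebius_st[OF 2(1)] by (simp add: k3_def algebra_simps)
  also have "\<dots> = st 1 0" using st_zero_right k by simp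
  finally have m2: "?m q2 = st 1 0" .
  have "?m q3 = st (k1 * k2 * 1) (k1 * k2 * 1)" unfolding 3(2) moebius_st[OF 3(1)] by (simp add: k1_def k2_def algebra_simps)
  also have "\<dots> = st 1 1" using k by (intro st_scale) simp
  finally show ?thesis using that[OF det m1 m2] by simp
qed

lemma moebius_three_transitive:
  assumes q: "q1 \<in> sphere 0 1" "q2 \<in> sphere 0 1" "q3 \<in> sphere 0 1" "q1 \<noteq> q2" "q1 \<noteq> q3" "q2 \<noteq> q3"
    and p: "p1 \<in> sphere 0 1" "p2 \<in> sphere 0 1" "p3 \<in> sphere 0 1" "p1 \<noteq> p2" "p1 \<noteq> p3" "p2 \<noteq> p3"
  obtains M where "holomorphic_map riemann_sphere riemann_sphere M" "inj_on M (sphere 0 1)"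
    "M q1 = p1" "M q2 = p2" "M q3 = p3"
proof -
  obtain a b c d where m: "a * d - b * c \<noteq> 0" "moebius a b c d q1 = st 0 1" "moebius a b c d q2 = st 1 0" "moebius a b c d q3 = st 1 1"
    by (rule moebius_standard_triple[OF q]) (rule that)
  obtain a' b' c' d' where m': "a' * d' - b' * c' \<noteq> 0" "moebius a' b' c' d' p1 = st 0 1" "moebius a' b' c' d' p2 = st 1 0" "moebius a' b' c' d' p3 = st 1 1"
    by (rule moebius_standard_triple[OF p]) (rule that)
  have dd: "d' * a' - (- b') * (- c') \<noteq> 0" using m'(1) by (simp add: algebra_simps)
  show ?thesis
  proof
    show "holomorphic_map riemann_sphere riemann_sphere (moebius d' (- b') (- c') a' \<circ> moebius a b c d)"
      by (rule holomorphic_map_compose[OF riemann_surface_sphere riemann_surface_sphere riemann_surface_sphere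
            holomorphic_moebius[OF m(1)] holomorphic_moebius[OF dd]])
    show "inj_on (moebius d' (- b') (- c') a' \<circ> moebius a b c d) (sphere 0 1)"
      by (rule comp_inj_on[OF moebius_inj[OF m(1)] inj_on_subset[OF moebius_inj[OF dd]]]) (use moebius_in_sphere[OF m(1)] in blast)
    note inv = moebius_inverse[OF m'(1)]
    show "(moebius d' (- b') (- c') a' \<circ> moebius a b c d) q1 = p1"
      using inv[OF p(1)] unfolding comp_apply m(2) m'(2) .
    show "(moebius d' (- b') (- c') a' \<circ> moebius a b c d) q2 = p2"
      using inv[OF p(2)] unfolding comp_apply m(3) m'(3) .
    show "(moebius d' (- b') (- c') a' \<circ> moebius a b c d) q3 = p3"
      using inv[OF p(3)] unfolding comp_apply m(4) m'(4) .
  qed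
qed

text \<open>An orthogonal map satisfies the cross product law up to the factor det, so determinant 1
  amounts to preserving the cross product. This turns membership checks for concrete rotations into
  identities between coordinates.\<close>

lemma rotation_iff:
  "rotation g \<longleftrightarrow> linear g \<and> (\<forall>x y. g x \<bullet> g y = x \<bullet> y) \<and> (\<forall>x y. (g x) \<times> (g y) = g (x \<times> y))"
proof
  assume r: "rotation g"
  then have l: "linear g" and m: "rotation_matrix (matrix g)" by (auto simp: rotation_def)
  have "orthogonal_transformation g" using l m by (simp add: orthogonal_transformation_matrix rotation_matrix_def)
  moreover have "(g x) \<times> (g y) = g (x \<times> y)" for x y
  proof -
    have "matrix g *v v = g v" for v 
      using matrix_works[of g v] l by (simp add: scalar_mult_eq_scaleR[abs_def])
    then show ?thesis using cross_rotation_matrix[OF m, of x y] by simp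
  qed
  ultimately show "linear g \<and> (\<forall>x y. g x \<bullet> g y = x \<bullet> y) \<and> (\<forall>x y. (g x) \<times> (g y) = g (x \<times> y))"
    using l by (simp add: orthogonal_transformation_def)
next
  assume r: "linear g \<and> (\<forall>x y. g x \<bullet> g y = x \<bullet> y) \<and> (\<forall>x y. (g x) \<times> (g y) = g (x \<times> y))"
  then have o: "orthogonal_transformation g" by (simp add: orthogonal_transformation_def)
  have "(axis 1 1 :: real^3) \<times> (axis 2 1) \<noteq> 0" by (simp add: cross_basis axis_eq_0_iff)
  then have "g ((axis 1 1) \<times> (axis 2 1)) \<noteq> 0" using r by (metis inner_eq_zero_iff)
  moreover have "g ((axis 1 1) \<times> (axis 2 1)) = det (matrix g) *\<^sub>R g ((axis 1 1) \<times> (axis 2 1))"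
    using cross_orthogonal_transformation[OF o, of "axis 1 1" "axis 2 1"] r by simp
  ultimately have "det (matrix g) = 1" by (metis scaleR_cancel_right scaleR_one)
  then show "rotation g" using o r by (simp add: rotation_def rotation_matrix_def orthogonal_transformation_matrix)
qed

lemma rotation_linear: "rotation g \<Longrightarrow> linear g"
  and rotation_inner: "rotation g \<Longrightarrow> g x \<bullet> g y = x \<bullet> y"
  and rotation_cross: "rotation g \<Longrightarrow> (g x) \<times> (g y) = g (x \<times> y)"
  by (simp_all add: rotation_iff)

lemma rotation_norm: "rotation g \<Longrightarrow> norm (g x) = norm x"
  by (simp add: norm_eq_sqrt_inner rotation_inner)

lemma rotation_sphere: "rotation g \<Longrightarrow> x \<in> sphere 0 1 \<Longrightarrow> g x \<in> sphere 0 1"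
  by (simp add: rotation_norm)

lemma rotation_dist: assumes "rotation g" shows "dist (g x) (g y) = dist x y"
  using rotation_norm[OF assms, of "x - y"] linear_diff[OF rotation_linear[OF assms]] by (simp add: dist_norm)

lemma rotation_id: "rotation id"
  by (simp add: rotation_iff linear_id)

lemma rotation_compose: "rotation g \<Longrightarrow> rotation h \<Longrightarrow> rotation (g \<circ> h)"
  by (simp add: rotation_iff linear_compose)

lemma rotation_inj: assumes "rotation g" shows "inj g"
  by (rule injI) (use rotation_dist[OF assms] in \<open>metis dist_eq_0_iff\<close>)

text \<open>Coordinates of x in the basis u, v, u x v, with denominators cleared. A rotation is
  known on the third vector once it is known on the first two, so two independent directions
  determine it.\<close>

lemma cross_basis_expansion:
  fixes u v x :: "real^3"
  shows "((u \<times> v) \<bullet> (u \<times> v)) *\<^sub>R x = (x \<bullet> (v \<times> (u \<times> v))) *\<^sub>R u + (x \<bullet> ((u \<times> v) \<times> u)) *\<^sub>R v + (x \<bullet> (u \<times> v)) *\<^sub>R (u \<times> v)"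
  by (simp add: vec3_eq_iff cross_components inner_vec_def sum_3) (simp add: algebra_simps)

lemma rotation_eqI:
  assumes g: "rotation g" and h: "rotation h" and eq: "g u = h u" "g v = h v" and uv: "u \<times> v \<noteq> 0"
  shows "g = h"
proof
  fix x
  let ?c = "(u \<times> v) \<bullet> (u \<times> v)"
  have eqc: "g (u \<times> v) = h (u \<times> v)" using rotation_cross[OF g, of u v] rotation_cross[OF h, of u v] eq by simp
  note lg = rotation_linear[OF g] and lh = rotation_linear[OF h]
  have "?c *\<^sub>R g x = g (?c *\<^sub>R x)" using linear_cmul[OF lg] by simp
  also have "\<dots> = h (?c *\<^sub>R x)" 
    unfolding cross_basis_expansion[of u v x] linear_add[OF lg] linear_add[OF lh] linear_cmul[OF lg] linear_cmul[OF lh] eq eqc ..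
  also have "\<dots> = ?c *\<^sub>R h x" using linear_cmul[OF lh] by simp
  finally show "g x = h x" using uv by simp
qed

text \<open>For a unit vector u this is the rotation by pi about u. Half-turns are preferred to
  general rotations because they are involutions and their Moebius coefficients are linear in
  u.\<close>

definition halfturn :: "real^3 \<Rightarrow> real^3 \<Rightarrow> real^3" where
  "halfturn u x = (2 * (u \<bullet> x)) *\<^sub>R u - x"

lemma inner3: "(x::real^3) \<bullet> y = x $ 1 * y $ 1 + x $ 2 * y $ 2 + x $ 3 * y $ 3"
  by (simp add: inner_vec_def sum_3)

lemma halfturn_halfturn: assumes "norm u = 1" shows "halfturn u (halfturn u x) = x"
  using assms by (simp add: halfturn_def inner_diff_right norm_eq_1 algebra_simps)

lemma rotation_halfturn: assumes u: "norm u = 1" shows "rotation (halfturn u)"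
  unfolding rotation_iff
proof (intro conjI allI)
  show "linear (halfturn u)"
    by (rule linearI) (simp_all add: halfturn_def inner_add_right algebra_simps)
  have uu: "u $ 1 * u $ 1 + u $ 2 * u $ 2 + u $ 3 * u $ 3 = 1" using u by (simp add: norm_eq_1 inner3)
  show "halfturn u x \<bullet> halfturn u y = x \<bullet> y" for x y
    using u by (simp add: halfturn_def inner_diff_left inner_diff_right norm_eq_1 inner_commute algebra_simps)
  show "(halfturn u x) \<times> (halfturn u y) = halfturn u (x \<times> y)" for x y
    unfolding vec3_eq_iff
  proof (intro conjI)
    show "((halfturn u x) \<times> (halfturn u y)) $ 1 = halfturn u (x \<times> y) $ 1"
      unfolding halfturn_def by (simp add: cross_components inner3) (use uu in algebra)
    show "((halfturn u x) \<times> (halfturn u y)) $ 2 = halfturn u (x \<times> y) $ 2"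
      unfolding halfturn_def by (simp add: cross_components inner3) (use uu in algebra)
    show "((halfturn u x) \<times> (halfturn u y)) $ 3 = halfturn u (x \<times> y) $ 3"
      unfolding halfturn_def by (simp add: cross_components inner3) (use uu in algebra)
  qed
qed

text \<open>The coefficients form a trace-free Hermitian matrix built from u, whose square is the
  squared norm of u times the identity. So for unit u it acts as an involution on homogeneous
  coordinates.\<close>

lemma halfturn_st:
  assumes u: "norm u = 1" and nz: "z \<noteq> 0 \<or> w \<noteq> 0"
  shows "halfturn u (st z w) = 
    st (complex_of_real (u $ 3) * z + Complex (u $ 1) (u $ 2) * w) (Complex (u $ 1) (- u $ 2) * z + - complex_of_real (u $ 3) * w)"
proof -
  define a where "a = Re z"
  define b where "b = Im z"
  define c where "c = Re w"
  define d where "d = Im w"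
  define p q r where "p = u $ 1" "q = u $ 2" "r = u $ 3"
  let ?z = "complex_of_real r * z + Complex p q * w" and ?w = "Complex p (- q) * z + - complex_of_real r * w"
  have uu: "p * p + q * q + r * r = 1" using u by (simp add: norm_eq_1 inner3 p_q_r_def)
  have n: "(cmod z)\<^sup>2 + (cmod w)\<^sup>2 = a * a + b * b + c * c + d * d"
    "(cmod z)\<^sup>2 - (cmod w)\<^sup>2 = a * a + b * b - c * c - d * d"
    "Re (z * cnj w) = a * c + b * d" "Im (z * cnj w) = b * c - a * d"
    unfolding cmod_power2 by (simp_all add: a_def b_def c_def d_def power2_eq_square)
  have z: "Re ?z = r * a + p * c - q * d" "Im ?z = r * b + p * d + q * c" "Re ?w = p * a + q * b - r * c" "Im ?w = p * b - q * a - r * d"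
    by (simp_all add: a_def b_def c_def d_def algebra_simps)
  \<comment> \<open>Each of the following identities is a polynomial identity as long as
    \<open>?uu\<close> is carried along; the norm condition is used only afterwards, to replace
    \<open>?uu\<close> by 1.\<close>
  let ?uu = "p * p + q * q + r * r"
  let ?x = "2 * (a * c + b * d)" and ?y = "2 * (b * c - a * d)" and ?h = "a * a + b * b - c * c - d * d"
  have "(cmod ?z)\<^sup>2 + (cmod ?w)\<^sup>2 = ?uu * (a * a + b * b + c * c + d * d)"
    unfolding cmod_power2 z unfolding power2_eq_square by (simp add: algebra_simps)
  then have n': "(cmod ?z)\<^sup>2 + (cmod ?w)\<^sup>2 = a * a + b * b + c * c + d * d" unfolding uu by simp
  have "(cmod ?z)\<^sup>2 - (cmod ?w)\<^sup>2 = 2 * (p * ?x + q * ?y + r * ?h) * r - ?uu * ?h"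
    unfolding cmod_power2 z unfolding power2_eq_square by (simp add: algebra_simps)
  then have m: "(cmod ?z)\<^sup>2 - (cmod ?w)\<^sup>2 = 2 * (p * ?x + q * ?y + r * ?h) * r - ?h" unfolding uu by simp
  have "2 * Re (?z * cnj ?w) = 2 * (p * ?x + q * ?y + r * ?h) * p - ?uu * ?x"
    unfolding times_complex.sel cnj.sel z by (simp add: algebra_simps)
  then have re: "2 * Re (?z * cnj ?w) = 2 * (p * ?x + q * ?y + r * ?h) * p - ?x" unfolding uu by simp
  have "2 * Im (?z * cnj ?w) = 2 * (p * ?x + q * ?y + r * ?h) * q - ?uu * ?y"
    unfolding times_complex.sel cnj.sel z by (simp add: algebra_simps)
  then have im: "2 * Im (?z * cnj ?w) = 2 * (p * ?x + q * ?y + r * ?h) * q - ?y" unfolding uu by simp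
  let ?n = "a * a + b * b + c * c + d * d"
  have pos: "?n \<noteq> 0" using less_imp_neq[OF st_denominator[OF nz]] unfolding n(1) by (rule not_sym)
  have s1: "(2 * (u \<bullet> st z w)) * t = 2 * (p * ?x + q * ?y + r * ?h) * t / ?n" for t
  proof -
    have aux: "(2 * (p * (x / n) + q * (y / n) + r * (h / n))) * t = 2 * (p * x + q * y + r * h) * t / n" 
      if "n \<noteq> 0" for x y h n :: real using that by (simp add: field_simps)
    show ?thesis unfolding inner3 st_components n p_q_r_def[symmetric] by (rule aux[OF pos])
  qed
  have "halfturn u (st z w) = st ?z ?w"
    unfolding vec3_eq_iff st_components n' m re im halfturn_def vector_minus_component vector_scaleR_component real_scaleR_def s1 
    unfolding n p_q_r_def[symmetric] diff_divide_distrib by simp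
  then show ?thesis by (simp add: p_q_r_def)
qed

text \<open>The image of the first axis is a horizontal unit vector; read as a complex number it is
  the factor l by which the rotation multiplies the horizontal plane.\<close>

lemma rotation_about_e3:
  assumes g: "rotation g" and e3: "g (axis 3 1) = axis 3 1"
  obtains l where "cmod l = 1" "\<And>z w. z \<noteq> 0 \<or> w \<noteq> 0 \<Longrightarrow> g (st z w) = st (l * z) w"
proof -
  define p where "p = g (axis 1 1)"
  have "p \<bullet> axis 3 1 = axis 1 1 \<bullet> (axis 3 1 :: real^3)" using rotation_inner[OF g, of "axis 1 1" "axis 3 1"] e3 by (simp add: p_def)
  then have p3: "p $ 3 = 0" by (simp add: inner3) (simp add: axis_def)
  have "p \<bullet> p = 1" using rotation_inner[OF g, of "axis 1 1" "axis 1 1"] by (simp add: p_def inner3) (simp add: axis_def)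
  then have pp: "(p $ 1)\<^sup>2 + (p $ 2)\<^sup>2 = 1" using p3 by (simp add: inner3 power2_eq_square)
  have g2: "g (axis 2 1) = axis 3 1 \<times> p"
    using rotation_cross[OF g, of "axis 3 1" "axis 1 1"] e3 by (simp add: p_def cross_basis)
  have gx: "g x = x $ 1 *\<^sub>R p + x $ 2 *\<^sub>R (axis 3 1 \<times> p) + x $ 3 *\<^sub>R axis 3 1" for x
  proof -
    have "x = x $ 1 *\<^sub>R axis 1 1 + x $ 2 *\<^sub>R axis 2 1 + x $ 3 *\<^sub>R axis 3 1"
      unfolding vec3_eq_iff by (simp add: axis_def)
    then have "g x = g (x $ 1 *\<^sub>R axis 1 1 + x $ 2 *\<^sub>R axis 2 1 + x $ 3 *\<^sub>R axis 3 1)" by simp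
    also have "\<dots> = x $ 1 *\<^sub>R p + x $ 2 *\<^sub>R (axis 3 1 \<times> p) + x $ 3 *\<^sub>R axis 3 1"
      using rotation_linear[OF g] by (simp add: linear_add linear_cmul g2 e3 p_def)
    finally show ?thesis .
  qed
  let ?l = "Complex (p $ 1) (p $ 2)"
  have l: "cmod ?l = 1" using pp by (simp add: cmod_def)
  have "g (st z w) = st (?l * z) w" if "z \<noteq> 0 \<or> w \<noteq> 0" for z w
    unfolding vec3_eq_iff gx by (simp add: cross_components p3 st_components norm_mult l add_divide_distrib diff_divide_distrib algebra_simps)
  then show ?thesis using that l by blast
qed

text \<open>The half-turn about the bisector of two unit vectors exchanges them. The bisector of a
  and the north pole degenerates only if a is the south pole, and then a horizontal axis
  serves.\<close>

lemma halfturn_to_e3: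
  assumes "norm a = 1"
  obtains u where "norm u = 1" "halfturn u a = axis 3 1"
proof (cases "a = - axis 3 1")
  case True
  have "halfturn (axis 1 1) a = axis 3 1" unfolding True vec3_eq_iff halfturn_def by (simp add: inner3) (simp add: axis_def)
  then show ?thesis using that[of "axis 1 1"] by simp
next
  case False
  let ?s = "a + axis 3 1"
  have s: "?s \<noteq> 0" using False by (simp add: eq_neg_iff_add_eq_0)
  have n: "(norm ?s)\<^sup>2 = 2 * (?s \<bullet> a)" using assms 
    by (simp add: power2_norm_eq_inner inner_add_left inner_add_right norm_eq_1 inner_commute algebra_simps)
  let ?u = "(1 / norm ?s) *\<^sub>R ?s"
  have "halfturn ?u a = (2 * (?s \<bullet> a) / (norm ?s)\<^sup>2) *\<^sub>R ?s - a" by (simp add: halfturn_def power2_eq_square)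
  also have "\<dots> = axis 3 1" unfolding n[symmetric] using s by simp
  finally show ?thesis using that[of ?u] s by simp
qed

text \<open>A half-turn brings the image of the north pole back to the pole, so a rotation is a half-turn
  composed with a rotation about the vertical axis; both are Moebius transformations.\<close>

lemma rotation_moebius:
  assumes g: "rotation g"
  obtains a b c d where "a * d - b * c \<noteq> 0" "\<And>z w. z \<noteq> 0 \<or> w \<noteq> 0 \<Longrightarrow> g (st z w) = st (a * z + b * w) (c * z + d * w)"
proof -
  have "norm (g (axis 3 1)) = 1" using rotation_norm[OF g] by simp
  then obtain u where u: "norm u = 1" "halfturn u (g (axis 3 1)) = axis 3 1" using halfturn_to_e3 by blast
  have "rotation (halfturn u \<circ> g)" by (rule rotation_compose[OF rotation_halfturn[OF u(1)] g])
  then obtain l where l: "cmod l = 1" "\<And>z w. z \<noteq> 0 \<or> w \<noteq> 0 \<Longrightarrow> (halfturn u \<circ> g) (st z w) = st (l * z) w"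
    using rotation_about_e3[of "halfturn u \<circ> g"] u(2) by auto
  have l0: "l \<noteq> 0" using l(1) by auto
  let ?r = "complex_of_real (u $ 3)" and ?p = "Complex (u $ 1) (u $ 2)" and ?q = "Complex (u $ 1) (- u $ 2)"
  have uu: "u $ 1 * u $ 1 + u $ 2 * u $ 2 + u $ 3 * u $ 3 = 1" using u by (simp add: norm_eq_1 inner3)
  have "?r * ?r + ?p * ?q = 1" unfolding complex_eq_iff using uu by (simp add: algebra_simps)
  moreover have "(?r * l) * (- ?r) - ?p * (?q * l) = - l * (?r * ?r + ?p * ?q)" by (simp add: algebra_simps)
  ultimately have det: "(?r * l) * (- ?r) - ?p * (?q * l) \<noteq> 0" using l0 by simp
  have "g (st z w) = st ((?r * l) * z + ?p * w) ((?q * l) * z + (- ?r) * w)" if nz: "z \<noteq> 0 \<or> w \<noteq> 0" for z w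
  proof -
    have "g (st z w) = halfturn u ((halfturn u \<circ> g) (st z w))" by (simp add: halfturn_halfturn[OF u(1)])
    also have "\<dots> = halfturn u (st (l * z) w)" unfolding l(2)[OF nz] ..
    also have "\<dots> = st ((?r * l) * z + ?p * w) ((?q * l) * z + (- ?r) * w)"
      using halfturn_st[OF u(1), of "l * z" w] nz l0 by (simp add: mult.assoc)
    finally show ?thesis .
  qed
  then show ?thesis using that det by blast
qed

lemma rotation_eq_moebius:
  assumes g: "rotation g"
  obtains a b c d where "a * d - b * c \<noteq> 0" "\<And>x. x \<in> sphere 0 1 \<Longrightarrow> g x = moebius a b c d x"
proof -
  obtain a b c d where 1: "a * d - b * c \<noteq> 0" "\<And>z w. z \<noteq> 0 \<or> w \<noteq> 0 \<Longrightarrow> g (st z w) = st (a * z + b * w) (c * z + d * w)"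
    by (rule rotation_moebius[OF g]) (rule that)
  have "g x = moebius a b c d x" if "x \<in> sphere 0 1" for x
    using 1(2) moebius_st sphere_eq_st[OF that] by metis
  then show ?thesis using that 1(1) by blast
qed

lemma rotation_holomorphic: assumes g: "rotation g" shows "holomorphic_map riemann_sphere riemann_sphere g"
proof -
  obtain a b c d where 1: "a * d - b * c \<noteq> 0" "\<And>x. x \<in> sphere 0 1 \<Longrightarrow> g x = moebius a b c d x"
    by (rule rotation_eq_moebius[OF g]) (rule that)
  have "hol_at riemann_sphere (\<lambda>t. g (st t 1)) z" "hol_at riemann_sphere (\<lambda>t. g (st 1 t)) z" for z
    using holomorphic_map_sphere_curves[OF riemann_surface_sphere holomorphic_moebius[OF 1(1)]] 1(2) st_in_sphere
    by simp_all
  then show ?thesis by (rule holomorphic_map_from_sphere[OF riemann_surface_sphere])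
qed


section \<open>Quotients by finite rotation groups\<close>


text \<open>Closure under composition together with finiteness already gives inverses: left
  translation by an element is injective on \<open>G\<close>, hence onto.\<close>

definition rotation_group :: "(real^3 \<Rightarrow> real^3) set \<Rightarrow> bool" where
  "rotation_group G \<longleftrightarrow> finite G \<and> id \<in> G \<and> (\<forall>g\<in>G. rotation g) \<and> (\<forall>g\<in>G. \<forall>h\<in>G. g \<circ> h \<in> G)"

lemma rotation_groupD:
  assumes "rotation_group G"
  shows "finite G" "id \<in> G" "\<And>g. g \<in> G \<Longrightarrow> rotation g" "\<And>g h. g \<in> G \<Longrightarrow> h \<in> G \<Longrightarrow> g \<circ> h \<in> G"
  using assms unfolding rotation_group_def by blast+

lemma rotation_group_translate:
  assumes G: "rotation_group G" and g: "g \<in> G"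
  shows "bij_betw (\<lambda>h. g \<circ> h) G G"
proof -
  note * = rotation_groupD[OF G]
  have inj: "inj_on (\<lambda>h. g \<circ> h) G"
  proof (rule inj_onI)
    fix h k assume "g \<circ> h = g \<circ> k"
    then have "g (h x) = g (k x)" for x by (metis comp_apply)
    then show "h = k" using injD[OF rotation_inj[OF *(3)[OF g]]] by blast
  qed
  then have "(\<lambda>h. g \<circ> h) ` G = G" using *(4)[OF g] by (intro endo_inj_surj[OF *(1)]) auto
  then show ?thesis using inj by (simp add: bij_betw_def)
qed

lemma rotation_group_inverse:
  assumes G: "rotation_group G" and g: "g \<in> G"
  obtains h where "h \<in> G" "g \<circ> h = id" "h \<circ> g = id"
proof -
  note * = rotation_groupD[OF G]
  have "id \<in> (\<lambda>h. g \<circ> h) ` G" using rotation_group_translate[OF G g] *(2) by (simp add: bij_betw_def)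
  then obtain h where h: "h \<in> G" "g \<circ> h = id" by force
  have "g (h (g x)) = g x" for x using h(2) by (metis comp_apply id_apply)
  then have "h (g x) = x" for x using rotation_inj[OF *(3)[OF g]] by (meson injD)
  then have "h \<circ> g = id" by (simp add: fun_eq_iff)
  then show ?thesis using that h by blast
qed

lemma rotation_group_translate_right:
  assumes G: "rotation_group G" and g: "g \<in> G"
  shows "bij_betw (\<lambda>h. h \<circ> g) G G"
proof -
  obtain k where k: "k \<in> G" "g \<circ> k = id" "k \<circ> g = id" using rotation_group_inverse[OF G g] .
  note * = rotation_groupD[OF G]
  have c: "(h \<circ> g) \<circ> k = h" "(h \<circ> k) \<circ> g = h" for h
    by (simp_all only: comp_assoc k comp_id)
  show ?thesis
    by (rule bij_betwI[of _ _ _ "\<lambda>h. h \<circ> k"]) (use *(4) g k(1) c in auto)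
qed

lemma orbit_eq_iff:
  assumes G: "rotation_group G"
  shows "orbit G x = orbit G y \<longleftrightarrow> (\<exists>g\<in>G. y = g x)"
proof
  assume "orbit G x = orbit G y"
  moreover have "y \<in> orbit G y" unfolding orbit_def using rotation_groupD(2)[OF G] by (auto intro!: exI[of _ id])
  ultimately show "\<exists>g\<in>G. y = g x" unfolding orbit_def by blast
next
  assume "\<exists>g\<in>G. y = g x"
  then obtain g where g: "g \<in> G" "y = g x" by blast
  have "orbit G y = (\<lambda>h. h x) ` ((\<lambda>h. h \<circ> g) ` G)" unfolding orbit_def g(2) image_image by auto
  also have "(\<lambda>h. h \<circ> g) ` G = G" using rotation_group_translate_right[OF G g(1)] by (simp add: bij_betw_def)
  finally show "orbit G x = orbit G y" unfolding orbit_def by auto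
qed

lemma cross_zero_unit:
  fixes x y :: "real^3"
  assumes "norm x = 1" "norm y = 1" "x \<times> y = 0"
  shows "y = x \<or> y = - x"
proof -
  have "(x \<bullet> y)\<^sup>2 = 1" using norm_cross_dot[of x y] assms by simp
  then have "x \<bullet> y = 1 \<or> x \<bullet> y = - 1" by (simp add: power2_eq_1_iff)
  then have "(x - y) \<bullet> (x - y) = 0 \<or> (x + y) \<bullet> (x + y) = 0"
    using assms(1,2) by (auto simp: inner_diff_left inner_diff_right inner_add_left inner_add_right norm_eq_1 inner_commute)
  then show ?thesis by (metis add_eq_0_iff eq_iff_diff_eq_0 inner_eq_zero_iff)
qed

text \<open>Since two independent directions determine a rotation, distinct rotations that agree at
  x can agree on the sphere only at x and -x.\<close>

lemma finite_rotation_coincidence: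
  assumes g: "rotation g" "rotation h" "g \<noteq> h"
  shows "finite {x \<in> sphere 0 1. g x = h x}"
proof (cases "{x \<in> sphere 0 1. g x = h x} = {}")
  case False
  then obtain x where x: "x \<in> sphere 0 1" "g x = h x" by blast
  have "{x \<in> sphere 0 1. g x = h x} \<subseteq> {x, - x}"
  proof
    fix y assume y: "y \<in> {x \<in> sphere 0 1. g x = h x}"
    then have "x \<times> y = 0" using rotation_eqI[OF g(1,2) x(2), of y] g(3) by blast
    then show "y \<in> {x, - x}" using cross_zero_unit[of x y] x(1) y by auto
  qed
  then show ?thesis using finite_subset by blast
next
  case True
  then show ?thesis by (simp only: finite.emptyI)
qed

text \<open>A finite open set would be closed too, hence all of the connected sphere, which is
  infinite. This is how finite sets of exceptional values are avoided later.\<close>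

lemma infinite_openin_sphere:
  assumes "openin (top_of_set (sphere (0::real^3) 1)) W" "W \<noteq> {}"
  shows "infinite W"
proof
  assume fin: "finite W"
  have sub: "W \<subseteq> sphere 0 1" using assms(1) openin_imp_subset by blast
  have "closedin (top_of_set (sphere (0::real^3) 1)) W"
    using finite_imp_closed[OF fin] sub by (simp add: closed_subset)
  moreover have "connected (sphere (0::real^3) 1)" by (rule connected_sphere) simp
  ultimately have "W = sphere 0 1" using assms connected_clopen by blast
  moreover have "range (\<lambda>z. st z 1) \<subseteq> sphere 0 1" using st_in_sphere[of _ 1] by auto
  ultimately have "finite (range (\<lambda>z. st z 1))" using fin finite_subset by blast
  moreover have "inj (\<lambda>z. st z 1)" by (rule injI) (simp add: st_eq_iff)
  ultimately show False using finite_imageD infinite_UNIV_char_0 by blast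
qed

lemma st_eq_scale:
  assumes "z \<noteq> 0 \<or> w \<noteq> 0" "z' \<noteq> 0 \<or> w' \<noteq> 0" "st z w = st z' w'"
  shows "\<exists>k. k \<noteq> 0 \<and> z = k * z' \<and> w = k * w'"
proof -
  have e: "z * w' = z' * w" using st_eq_iff[OF assms(1,2)] assms(3) by blast
  show ?thesis
  proof (cases "w' = 0")
    case True
    then have "w = 0" "z' \<noteq> 0" "z \<noteq> 0" using e assms by auto
    then show ?thesis using True by (intro exI[of _ "z / z'"]) simp
  next
    case False
    then have w: "w \<noteq> 0" using e assms by auto
    then show ?thesis using e False by (intro exI[of _ "w / w'"]) (simp add: field_simps)
  qed
qed

text \<open>A coincidence of values spreads to nearby points since the map is open, so fibres need only be
  computed over a dense set of values.\<close>

lemma rotation_group_fibres: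
  assumes G: "rotation_group G" and bc: "branched_covering riemann_sphere Y R"
    and generic: "\<And>x y. x \<in> sphere 0 1 \<Longrightarrow> y \<in> sphere 0 1 \<Longrightarrow> R x = R y \<Longrightarrow> R x \<notin> Z \<Longrightarrow> \<exists>g\<in>G. y = g x"
    and dense: "\<And>W. openin (carrier_top Y) W \<Longrightarrow> W \<noteq> {} \<Longrightarrow> W - Z \<noteq> {}"
    and x: "x \<in> sphere 0 1" and y: "y \<in> sphere 0 1" and eq: "R x = R y"
  shows "\<exists>g\<in>G. y = g x"
proof (rule ccontr)
  let ?S = "sphere (0::real^3) 1"
  note * = rotation_groupD[OF G]
  assume neg: "\<not> ?thesis"
  \<comment> \<open>The distance from y to the orbit of x. Rotations are isometries, so the balls of
    radius r/2 about x and y contain no two points of one orbit.\<close>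
  define r where "r = Min ((\<lambda>g. dist (g x) y) ` G)"
  have r: "r > 0" unfolding r_def using *(1,2) neg by (subst Min_gr_iff) auto
  have rle: "r \<le> dist (g x) y" if "g \<in> G" for g unfolding r_def using *(1) that by (intro Min_le) auto
  let ?Wx = "?S \<inter> ball x (r/2)" and ?Wy = "?S \<inter> ball y (r/2)"
  have o: "openin (top_of_set ?S) ?Wx" "openin (top_of_set ?S) ?Wy" by (simp_all add: openin_open_Int)
  have sep: "y' \<noteq> g x'" if "g \<in> G" "x' \<in> ?Wx" "y' \<in> ?Wy" for g x' y'
  proof
    assume "y' = g x'"
    moreover have "dist (g x) (g x') = dist x x'" using rotation_dist[OF *(3)[OF that(1)]] .
    ultimately have "dist (g x) y < r" using that(2,3) dist_triangle[of "g x" y y'] by (simp add: dist_commute)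
    then show False using rle[OF that(1)] by simp
  qed
  let ?O = "R ` ?Wx \<inter> R ` ?Wy"
  have "openin (carrier_top Y) ?O"
    using branched_covering_open_map[OF bc, of ?Wx] branched_covering_open_map[OF bc, of ?Wy] o by (simp add: openin_Int)
  moreover have "x \<in> ?Wx" "y \<in> ?Wy" using x y r by simp_all
  then have "R x \<in> R ` ?Wx" "R x \<in> R ` ?Wy" unfolding eq by (auto simp: eq[symmetric] intro: rev_image_eqI)
  then have "?O \<noteq> {}" by blast
  ultimately have "?O - Z \<noteq> {}" by (rule dense)
  then obtain s where s: "s \<in> ?O" "s \<notin> Z" by blast
  then obtain x' y' where xy: "x' \<in> ?Wx" "y' \<in> ?Wy" "s = R x'" "s = R y'" by blast
  then have "\<exists>g\<in>G. y' = g x'" using generic[of x' y'] s(2) by simp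
  then show False using sep xy by blast
qed

text \<open>The quotient map is the quotient \<open>A / B\<close> of two products, over the group, of linear forms
  vanishing at \<open>0\<close> and at a point \<open>p\<close> outside the orbit of \<open>0\<close>. Its degree is at most the order
  of the group, so a generic fibre, which contains an orbit, is one.\<close>

lemma rotation_group_quotient:
  assumes G: "rotation_group G"
  obtains R where "branched_covering riemann_sphere riemann_sphere R"
    "\<And>x y. x \<in> sphere 0 1 \<Longrightarrow> y \<in> sphere 0 1 \<Longrightarrow> R x = R y \<longleftrightarrow> (\<exists>g\<in>G. y = g x)"
proof -
  note * = rotation_groupD[OF G]
  let ?S = "sphere (0::real^3) 1"
  have "\<exists>M. \<forall>g\<in>G. case M g of (a, b, c, d) \<Rightarrow> a * d - b * c \<noteq> 0 \<and> (\<forall>z w. z \<noteq> 0 \<or> w \<noteq> 0 \<longrightarrow> g (st z w) = st (a * z + b * w) (c * z + d * w))"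
    (is "\<exists>M. \<forall>g\<in>G. ?P g (M g)")
  proof (rule bchoice, rule ballI)
    fix g assume "g \<in> G"
    then have r: "rotation g" by (rule *(3))
    obtain a b c d where "a * d - b * c \<noteq> 0" "\<And>z w. z \<noteq> 0 \<or> w \<noteq> 0 \<Longrightarrow> g (st z w) = st (a * z + b * w) (c * z + d * w)"
      by (rule rotation_moebius[OF r]) (rule that)
    then show "\<exists>m. ?P g m" by (intro exI[of _ "(a, b, c, d)"]) simp
  qed
  then obtain M where M: "\<forall>g\<in>G. ?P g (M g)" by (elim exE)
  define a where "a = (\<lambda>g. fst (M g))"
  define b where "b = (\<lambda>g. fst (snd (M g)))"
  define c where "c = (\<lambda>g. fst (snd (snd (M g))))"
  define d where "d = (\<lambda>g. snd (snd (snd (M g))))"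
  have M': "a g * d g - b g * c g \<noteq> 0 \<and> g (st z w) = st (a g * z + b g * w) (c g * z + d g * w)" if "g \<in> G" "z \<noteq> 0 \<or> w \<noteq> 0" for g z w
    using bspec[OF M that(1)] that(2) by (simp add: a_def b_def c_def d_def split_beta)
  define u where "u = (\<lambda>g z w. a g * z + b g * w)"
  define v where "v = (\<lambda>g z w. c g * z + d g * w)"
  have gst: "g (st z w) = st (u g z w) (v g z w)" "u g z w \<noteq> 0 \<or> v g z w \<noteq> 0" if "g \<in> G" "z \<noteq> 0 \<or> w \<noteq> 0" for g z w
    using M'[OF that] moebius_nonzero[of "a g" "d g" "b g" "c g" z w] that(2) by (auto simp: u_def v_def)
  have uhom: "u g (k * z) (k * w) = k * u g z w" "v g (k * z) (k * w) = k * v g z w" for g k z w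
    by (simp_all add: u_def v_def algebra_simps)
  have "\<exists>p. st p 1 \<notin> (\<lambda>g. g (st 0 1)) ` G"
  proof (rule ccontr)
    assume "\<not> ?thesis"
    then have "range (\<lambda>p. st p 1) \<subseteq> (\<lambda>g. g (st 0 1)) ` G" by blast
    then have "finite (range (\<lambda>z. st z 1))" using *(1) finite_subset by blast
    moreover have "inj (\<lambda>z. st z 1)" by (rule injI) (simp add: st_eq_iff)
    ultimately show False using finite_imageD infinite_UNIV_char_0 by blast
  qed
  then obtain p where p': "st p 1 \<notin> (\<lambda>g. g (st 0 1)) ` G" by (elim exE)
  have p: "g (st 0 1) \<noteq> st p 1" if "g \<in> G" for g
  proof
    assume "g (st 0 1) = st p 1"
    then have "st p 1 \<in> (\<lambda>g. g (st 0 1)) ` G" using that by (intro image_eqI[of _ _ g]) simp_all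
    then show False using p' by contradiction
  qed
  define A where "A = (\<lambda>z w. \<Prod>g\<in>G. u g z w)"
  define B where "B = (\<lambda>z w. \<Prod>g\<in>G. u g z w - p * v g z w)"
  define N where "N = card G"
  have A0: "A z w = 0 \<longleftrightarrow> (\<exists>g\<in>G. g (st z w) = st 0 1)" if nz: "z \<noteq> 0 \<or> w \<noteq> 0" for z w
  proof -
    have "u g z w = 0 \<longleftrightarrow> g (st z w) = st 0 1" if g: "g \<in> G" for g
      using gst[OF g nz] st_eq_iff[OF gst(2)[OF g nz], of 0 1] by auto
    then show ?thesis unfolding A_def using *(1) by simp
  qed
  have B0: "B z w = 0 \<longleftrightarrow> (\<exists>g\<in>G. g (st z w) = st p 1)" if nz: "z \<noteq> 0 \<or> w \<noteq> 0" for z w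
  proof -
    have "u g z w - p * v g z w = 0 \<longleftrightarrow> g (st z w) = st p 1" if g: "g \<in> G" for g
      using gst[OF g nz] st_eq_iff[OF gst(2)[OF g nz], of p 1] by auto
    then show ?thesis unfolding B_def using *(1) by simp
  qed
  \<comment> \<open>A common zero of the two products would put 0 and \<open>p\<close> into one
    orbit, against the choice of \<open>p\<close>.\<close>
  have AB: "A z w \<noteq> 0 \<or> B z w \<noteq> 0" if nz: "z \<noteq> 0 \<or> w \<noteq> 0" for z w
  proof (rule ccontr)
    assume "\<not> ?thesis"
    then obtain g h where g: "g \<in> G" "g (st z w) = st 0 1" and h: "h \<in> G" "h (st z w) = st p 1"
      using A0[OF nz] B0[OF nz] by auto
    obtain k where k: "k \<in> G" "k \<circ> g = id" using rotation_group_inverse[OF G g(1)] by blast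
    have "(h \<circ> k) (st 0 1) = h ((k \<circ> g) (st z w))" using g(2) by simp
    also have "\<dots> = st p 1" using k(2) h(2) by simp
    finally show False using p[OF *(4)[OF h(1) k(1)]] by blast
  qed
  have Ahom: "A (k * z) (k * w) = k ^ N * A z w" for k z w
    unfolding A_def N_def uhom by (simp add: prod.distrib)
  have Bhom: "B (k * z) (k * w) = k ^ N * B z w" for k z w
  proof -
    have "u g (k * z) (k * w) - p * v g (k * z) (k * w) = k * (u g z w - p * v g z w)" for g
      unfolding uhom by (simp add: algebra_simps)
    then show ?thesis unfolding B_def N_def by (simp add: prod.distrib)
  qed
  define R where "R = hom_map A B"
  have Rst: "R (st z w) = st (A z w) (B z w)" if "z \<noteq> 0 \<or> w \<noteq> 0" for z w
    unfolding R_def by (rule hom_map_st[where A = A and B = B and N = N, OF Ahom Bhom that])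
  have holR: "holomorphic_map riemann_sphere riemann_sphere R"
    unfolding R_def
    by (rule holomorphic_hom_map[where A = A and B = B and N = N, OF Ahom Bhom AB])
       (simp_all add: A_def B_def u_def v_def holomorphic_intros)
  have A01: "A 0 1 = 0" using A0[of 0 1] *(2) by force
  have Bp1: "B p 1 = 0" using B0[of p 1] *(2) by force
  have B01: "B 0 1 \<noteq> 0" "A p 1 \<noteq> 0" using AB[of 0 1] AB[of p 1] A01 Bp1 by auto
  have "R (st 0 1) \<noteq> R (st p 1)" unfolding Rst[of 0 1, simplified] Rst[of p 1, simplified] A01 Bp1 
    using st_eq_iff[of 0 "B 0 1" "A p 1" 0] B01 by simp
  moreover have "st 0 1 \<in> ?S" "st p 1 \<in> ?S" by (rule st_in_sphere; simp)+
  ultimately have "\<exists>x\<in>?S. \<exists>y\<in>?S. R x \<noteq> R y" by (intro bexI[of _ "st 0 1"] bexI[of _ "st p 1"])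
  then have bc: "branched_covering riemann_sphere riemann_sphere R"
    unfolding branched_covering_def using compact_connected_sphere holR by simp
  \<comment> \<open>Moving the argument by \<open>h\<close> permutes the linear forms, up to a
    scalar for each group element, because homogeneous coordinates are only determined up to a
    factor. The same product of scalars multiplies \<open>A\<close> and \<open>B\<close> and
    cancels.\<close>
  have invar: "R (h x) = R x" if h: "h \<in> G" and x: "x \<in> ?S" for h x
  proof -
    obtain z w where zw: "z \<noteq> 0 \<or> w \<noteq> 0" "x = st z w" using sphere_eq_st[OF x] .
    let ?z = "u h z w" and ?w = "v h z w"
    have nz: "?z \<noteq> 0 \<or> ?w \<noteq> 0" using gst(2)[OF h zw(1)] .
    have "\<exists>k. k \<noteq> 0 \<and> u g ?z ?w = k * u (g \<circ> h) z w \<and> v g ?z ?w = k * v (g \<circ> h) z w" if g: "g \<in> G" for g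
    proof (rule st_eq_scale[OF gst(2)[OF g nz] gst(2)[OF *(4)[OF g h] zw(1)]])
      show "st (u g ?z ?w) (v g ?z ?w) = st (u (g \<circ> h) z w) (v (g \<circ> h) z w)"
        using gst(1)[OF g nz] gst(1)[OF *(4)[OF g h] zw(1)] gst(1)[OF h zw(1)] by simp
    qed
    then obtain k where k: "\<And>g. g \<in> G \<Longrightarrow> k g \<noteq> 0 \<and> u g ?z ?w = k g * u (g \<circ> h) z w \<and> v g ?z ?w = k g * v (g \<circ> h) z w"
      by metis
    have reindex: "(\<Prod>g\<in>G. F (g \<circ> h)) = (\<Prod>g\<in>G. F g)" for F :: "(real^3 \<Rightarrow> real^3) \<Rightarrow> complex"
      by (rule prod.reindex_bij_betw[OF rotation_group_translate_right[OF G h]])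
    have "A ?z ?w = (\<Prod>g\<in>G. k g * u (g \<circ> h) z w)" unfolding A_def by (rule prod.cong) (use k in auto)
    also have "\<dots> = prod k G * A z w" unfolding A_def prod.distrib reindex[of "\<lambda>g. u g z w"] ..
    finally have 1: "A ?z ?w = prod k G * A z w" .
    have "B ?z ?w = (\<Prod>g\<in>G. k g * (u (g \<circ> h) z w - p * v (g \<circ> h) z w))" 
      unfolding B_def by (rule prod.cong) (use k in \<open>auto simp: algebra_simps\<close>)
    also have "\<dots> = prod k G * B z w" unfolding B_def prod.distrib reindex[of "\<lambda>g. u g z w - p * v g z w"] ..
    finally have 2: "B ?z ?w = prod k G * B z w" .
    have "prod k G \<noteq> 0" using k *(1) by simp
    then show ?thesis unfolding zw(2) gst(1)[OF h zw(1)] Rst[OF nz] Rst[OF zw(1)] 1 2 by (rule st_scale)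
  qed
  \<comment> \<open>Excluded are the points with a nontrivial stabiliser, whose orbits are too
    short, and those whose orbit contains the north pole, which the affine polynomial below cannot
    see.\<close>
  define Bad where "Bad = (\<Union>g\<in>G. \<Union>h\<in>G - {g}. {x \<in> ?S. g x = h x}) \<union> (\<Union>g\<in>G. {x. g x = axis 3 1})"
  have finBad: "finite Bad"
  proof -
    have "finite {x. g x = axis 3 1}" if "g \<in> G" for g
      using finite_vimageI[OF _ rotation_inj[OF *(3)[OF that]], of "{axis 3 1}"] by (simp add: vimage_def)
    then show ?thesis unfolding Bad_def using *(1,3) finite_rotation_coincidence by blast
  qed
  have generic: "\<exists>g\<in>G. x = g y" if x: "x \<in> ?S - Bad" and y: "y \<in> ?S - Bad" and eq: "R x = R y" for x y
  proof -
    have xN: "x \<noteq> axis 3 1" using x *(2) unfolding Bad_def by force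
    have gN: "g y \<noteq> axis 3 1" if "g \<in> G" for g using y that unfolding Bad_def by blast
    have inj: "inj_on (\<lambda>g. north_coordinate (g y)) G"
    proof (rule inj_onI)
      fix g h assume gh: "g \<in> G" "h \<in> G" "north_coordinate (g y) = north_coordinate (h y)"
      then have "g y = h y" using st_north gN rotation_sphere[OF *(3)] y by (metis DiffD1)
      then show "g = h" using y gh(1,2) unfolding Bad_def by blast
    qed
    define \<omega> where "\<omega> = north_coordinate y"
    define z where "z = north_coordinate x"
    have x': "x = st z 1" using st_north xN x by (simp add: z_def)
    have y': "y = st \<omega> 1" using st_north gN[OF *(2)] y by (simp add: \<omega>_def)
    define PA where "PA = (\<Prod>g\<in>G. [:b g, a g:])"
    define PB where "PB = (\<Prod>g\<in>G. [:b g - p * d g, a g - p * c g:])"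
    have PA: "poly PA t = A t 1" for t unfolding PA_def A_def u_def poly_prod by (rule prod.cong) (simp_all add: algebra_simps)
    have PB: "poly PB t = B t 1" for t unfolding PB_def B_def u_def v_def poly_prod by (rule prod.cong) (simp_all add: algebra_simps)
    have deg1: "(\<Sum>g\<in>G. degree [:r g, s g:]) \<le> card G" for r s :: "_ \<Rightarrow> complex"
      using sum_bounded_above[of G "\<lambda>g. degree [:r g, s g:]" 1] by simp
    have dA: "degree PA \<le> N" unfolding PA_def N_def
      by (rule order_trans[OF degree_prod_sum_le[OF *(1)]]) (use deg1 in \<open>simp add: o_def del: degree_pCons_eq_if\<close>)
    have dB: "degree PB \<le> N" unfolding PB_def N_def
      by (rule order_trans[OF degree_prod_sum_le[OF *(1)]]) (use deg1 in \<open>simp add: o_def del: degree_pCons_eq_if\<close>)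
    \<comment> \<open>The roots of \<open>E\<close> are the affine points in the fibre through y.
      The orbit of y supplies card G distinct roots and the degree allows no more, so the fibre is
      the orbit.\<close>
    define E where "E = smult (B \<omega> 1) PA - smult (A \<omega> 1) PB"
    have dE: "degree E \<le> N" unfolding E_def using dA dB by (intro degree_diff_le) (auto intro: order_trans[OF degree_smult_le])
    have E: "poly E t = 0 \<longleftrightarrow> R (st t 1) = R y" for t
    proof -
      have "R (st t 1) = R y \<longleftrightarrow> A t 1 * B \<omega> 1 = A \<omega> 1 * B t 1"
        unfolding y' Rst[of t 1, simplified] Rst[of \<omega> 1, simplified] by (rule st_eq_iff) (use AB[of t 1] AB[of \<omega> 1] in auto)
      then show ?thesis unfolding E_def by (auto simp: PA PB algebra_simps)
    qed
    have E0: "E \<noteq> 0"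
    proof
      assume "E = 0"
      then have "R (st 0 1) = R y" "R (st p 1) = R y" using E by auto
      then show False using \<open>R (st 0 1) \<noteq> R (st p 1)\<close> by simp
    qed
    let ?roots = "{t. poly E t = 0}"
    let ?O = "(\<lambda>g. north_coordinate (g y)) ` G"
    have "?O \<subseteq> ?roots"
    proof
      fix t assume "t \<in> ?O"
      then obtain g where g: "g \<in> G" "t = north_coordinate (g y)" by blast
      then have "st t 1 = g y" using st_north gN[OF g(1)] rotation_sphere[OF *(3)[OF g(1)]] y by simp
      then show "t \<in> ?roots" using E invar[OF g(1)] y by simp
    qed
    moreover have "card ?roots \<le> card ?O"
      using card_poly_roots_bound[OF E0] dE card_image[OF inj] by (simp add: N_def)
    moreover have "finite ?roots" using poly_roots_finite[OF E0] .
    ultimately have "?O = ?roots" by (metis card_seteq)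
    moreover have "z \<in> ?roots" using E eq x' by simp
    ultimately obtain g where g: "g \<in> G" "z = north_coordinate (g y)" by blast
    then have "x = g y" using x' st_north gN[OF g(1)] rotation_sphere[OF *(3)[OF g(1)]] y by simp
    then show ?thesis using g(1) by blast
  qed
  have "\<exists>g\<in>G. y = g x" if x: "x \<in> ?S" and y: "y \<in> ?S" and eq: "R x = R y" for x y
  proof (rule rotation_group_fibres[OF G bc _ _ x y eq, where Z = "R ` Bad"])
    fix x y assume xy: "x \<in> ?S" "y \<in> ?S" "R x = R y" "R x \<notin> R ` Bad"
    then have "x \<notin> Bad" using imageI[of x Bad R] by blast
    moreover have "y \<notin> Bad" using imageI[of y Bad R] xy(3,4) by auto
    ultimately show "\<exists>g\<in>G. y = g x" using generic[of y x] xy by simp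
  next
    fix W assume W: "openin (carrier_top riemann_sphere) W" "W \<noteq> {}"
    then have "infinite (W - R ` Bad)" 
      by (intro Diff_infinite_finite[OF finite_imageI[OF finBad]] infinite_openin_sphere) simp_all
    then show "W - R ` Bad \<noteq> {}" by (rule infinite_imp_nonempty)
  qed
  then show ?thesis using that[OF bc] invar by metis
qed


section \<open>Local lifting\<close>


lemma holomorphic_function_hol_at:
  assumes X: "riemann_surface X" and F: "holomorphic_function X W F" and h: "hol_at X h z" and z: "h z \<in> W"
  shows "\<exists>e>0. h ` ball z e \<subseteq> W \<and> (F \<circ> h) holomorphic_on ball z e"
proof -
  obtain U \<phi> where U: "(U, \<phi>) \<in> atlas X" "h z \<in> U" using riemann_surface_cover[OF X hol_at_points[OF X h]] .
  have oW: "openin (carrier_top X) W" using F by (simp add: holomorphic_function_def)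
  have inj: "inj_on \<phi> U" using riemann_surface_chart[OF X U(1)] by (rule complex_chart_inj)
  obtain e where e: "e > 0" "h ` ball z e \<subseteq> U \<inter> W" "(\<phi> \<circ> h) holomorphic_on ball z e"
    using hol_at_chart[OF X h U(1) oW U(2) z] by blast
  have "(F \<circ> inv_into U \<phi>) holomorphic_on \<phi> ` (U \<inter> W)"
    using F U(1) unfolding holomorphic_function_def by blast
  then have "((F \<circ> inv_into U \<phi>) \<circ> (\<phi> \<circ> h)) holomorphic_on ball z e"
    by (rule holomorphic_on_compose_gen[OF e(3)]) (use e in auto)
  then have "(F \<circ> h) holomorphic_on ball z e"
    by (rule holomorphic_transform) (use e inj in \<open>auto simp: image_subset_iff\<close>)
  then show ?thesis using e by blast
qed

lemma holomorphic_functionI: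
  assumes X: "riemann_surface X" and W: "openin (carrier_top X) W"
    and F: "\<And>h z. hol_at X h z \<Longrightarrow> h z \<in> W \<Longrightarrow> \<exists>e>0. (F \<circ> h) holomorphic_on ball z e"
  shows "holomorphic_function X W F"
  unfolding holomorphic_function_def
proof (intro conjI W ballI, clarify)
  fix U \<phi> assume U: "(U, \<phi>) \<in> atlas X"
  have inj: "inj_on \<phi> U" using riemann_surface_chart[OF X U] by (rule complex_chart_inj)
  show "F \<circ> inv_into U \<phi> holomorphic_on \<phi> ` (U \<inter> W)"
  proof (rule holomorphic_on_locally)
    fix z assume "z \<in> \<phi> ` (U \<inter> W)"
    then have "z \<in> \<phi> ` U" "inv_into U \<phi> z \<in> W" using inj by auto
    then show "\<exists>e>0. F \<circ> inv_into U \<phi> holomorphic_on ball z e"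
      using F[OF hol_at_inv_chart[OF X U]] by blast
  qed
qed

text \<open>If \<open>F\<close> vanishes at \<open>0\<close> to order \<open>k\<close>, invariance gives \<open>l ^ k = 1\<close>, hence \<open>n\<close> divides \<open>k\<close>.\<close>

lemma rotation_invariant_power_series:
  assumes F: "F holomorphic_on ball 0 r" "r > 0" "F 0 = 0" "\<not> F constant_on ball 0 r"
    and l: "cmod l = 1" "\<And>z. z \<in> ball 0 r \<Longrightarrow> F (l * z) = F z" 
    and n: "n \<ge> 1" "\<And>k. l ^ k = 1 \<Longrightarrow> n dvd k"
  obtains r1 \<theta> where "r1 > 0" "r1 \<le> r" "\<theta> holomorphic_on ball 0 r1" "\<And>z. z \<in> ball 0 r1 \<Longrightarrow> F z = \<theta> z ^ n"
proof -
  obtain G r1 k where k: "0 < k" "0 < r1" "ball (0::complex) r1 \<subseteq> ball 0 r" "G holomorphic_on ball 0 r1"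
      "\<And>w. w \<in> ball 0 r1 \<Longrightarrow> F w = (w - 0) ^ k * G w" "\<And>w. w \<in> ball 0 r1 \<Longrightarrow> G w \<noteq> 0"
    by (rule holomorphic_factor_zero_nonconstant[OF F(1) open_ball convex_connected[OF convex_ball] _ F(3,4)])
       (use F(2) in simp, rule that)
  have lz: "l * z \<in> ball 0 r1" if "z \<in> ball 0 r1" for z using that l(1) by (simp add: norm_mult)
  have contG: "isCont G 0" 
    using holomorphic_on_imp_continuous_on[OF k(4)] k(2) by (simp add: continuous_on_eq_continuous_at)
  \<comment> \<open>Off 0 the invariance can be divided by z ^ k. Passing to the limit at 0 gives l
    ^ k * G 0 = G 0, where \<open>G 0\<close> is not zero.\<close>
  have "((\<lambda>z. l ^ k * G (l * z)) \<longlongrightarrow> l ^ k * G (l * 0)) (at 0)"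
    using contG by (intro tendsto_intros isCont_tendsto_compose[of _ G]) (auto simp: isCont_def)
  moreover have "\<forall>\<^sub>F z in at 0. l ^ k * G (l * z) = G z"
  proof -
    have "\<forall>\<^sub>F z in at 0. z \<in> ball 0 r1 \<and> z \<noteq> (0::complex)"
      using k(2) by (intro eventually_conj eventually_at_in_open' eventually_neq_at_within) auto
    then show ?thesis
    proof (rule eventually_mono)
      fix z assume z: "z \<in> ball 0 r1 \<and> z \<noteq> (0::complex)"
      have "z \<in> ball 0 r" using z k(3) by blast
      then have "(l * z) ^ k * G (l * z) = z ^ k * G z" using l(2)[of z] k(5)[of z] k(5)[OF lz] z by simp
      then have "z ^ k * (l ^ k * G (l * z)) = z ^ k * G z" by (simp add: power_mult_distrib mult_ac)
      then show "l ^ k * G (l * z) = G z" using z by simp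
    qed
  qed
  ultimately have "(G \<longlongrightarrow> l ^ k * G 0) (at 0)" by (simp add: Lim_transform_eventually)
  moreover have "(G \<longlongrightarrow> G 0) (at 0)" using contG by (simp add: isCont_def)
  ultimately have "l ^ k * G 0 = G 0" using tendsto_unique[OF at_neq_bot] by blast
  then have "l ^ k = 1" using k(6)[of 0] k(2) by simp
  then obtain m where m: "k = n * m" using n(2) dvdE by blast
  obtain L where L: "L holomorphic_on ball 0 r1" "\<And>z. z \<in> ball 0 r1 \<Longrightarrow> G z = exp (L z)"
    by (rule contractible_imp_holomorphic_log[OF k(4) convex_imp_contractible[OF convex_ball] k(6)]) (assumption, rule that)
  show ?thesis
  proof (rule that[of r1 "\<lambda>z. z ^ m * exp (L z / of_nat n)"])
    show "r1 \<le> r" using k(2,3) F(2) by (simp add: ball_subset_ball_iff)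
    show "(\<lambda>z. z ^ m * exp (L z / of_nat n)) holomorphic_on ball 0 r1"
      by (intro holomorphic_intros L(1)) (use n(1) in auto)
    show "F z = (z ^ m * exp (L z / of_nat n)) ^ n" if z: "z \<in> ball 0 r1" for z
    proof -
      have "exp (L z / of_nat n) ^ n = G z" using n(1) L(2)[OF z] by (simp add: exp_of_nat_mult[symmetric])
      then show ?thesis using k(5)[OF z] by (simp add: power_mult_distrib m power_mult[symmetric] mult.commute)
    qed
  qed (use k in auto)
qed

text \<open>Conjugation by a half-turn \<open>A\<close> moves s to the point with coordinate 0,
  where the rotation becomes multiplication by a number l of modulus 1. If l ^ k = 1, then the k-th
  power of the rotation is trivial and n divides k, so the power series lemma yields the n-th
  root.\<close>

lemma rotation_invariant_root:
  assumes g: "branched_covering riemann_sphere Y g" and s: "s \<in> sphere 0 1" and V: "(V, \<psi>) \<in> atlas Y" "g s \<in> V"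
    and \<rho>: "rotation \<rho>" "\<rho> s = s" "\<And>x. x \<in> sphere 0 1 \<Longrightarrow> g (\<rho> x) = g x"
    and n: "n \<ge> 1" "\<And>j. (\<And>x. x \<in> sphere 0 1 \<Longrightarrow> (\<rho> ^^ j) x = x) \<Longrightarrow> n dvd j"
  obtains W \<theta> where "s \<in> W" "holomorphic_function riemann_sphere W \<theta>" "\<And>x. x \<in> W \<Longrightarrow> g x \<in> V \<and> \<psi> (g x) - \<psi> (g s) = \<theta> x ^ n"
proof -
  note * = branched_covering_rs[OF g]
  let ?S = "sphere (0::real^3) 1"
  \<comment> \<open>The half-turn is chosen for the antipode: as \<open>- s\<close> goes to the
    north pole, s itself goes to the south pole, whose north coordinate is 0.\<close>
  have "norm (- s) = 1" using s by simp
  then obtain u where u: "norm u = 1" "halfturn u (- s) = axis 3 1" using halfturn_to_e3 by blast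
  define A where "A = halfturn u"
  have rA: "rotation A" unfolding A_def by (rule rotation_halfturn[OF u(1)])
  have AA: "A (A x) = x" for x unfolding A_def by (rule halfturn_halfturn[OF u(1)])
  have An: "A (- x) = - A x" for x by (rule linear_neg[OF rotation_linear[OF rA]])
  have "- A s = axis 3 1" using u(2) An[of s] by (simp add: A_def)
  then have "A s = - axis 3 1" by (metis minus_minus)
  then have As: "A s = st 0 1" by (simp add: st_zero_left)
  have r': "rotation (A \<circ> \<rho> \<circ> A)" by (intro rotation_compose rA \<rho>(1))
  have "A (axis 3 1) = - s" using AA[of "- s"] u(2) by (simp add: A_def)
  then have "(A \<circ> \<rho> \<circ> A) (axis 3 1) = A (- \<rho> s)" using linear_neg[OF rotation_linear[OF \<rho>(1)]] by simp
  then have "(A \<circ> \<rho> \<circ> A) (axis 3 1) = axis 3 1" using \<rho>(2) u(2) by (simp add: A_def)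
  then obtain l where l: "cmod l = 1" "\<And>z w. z \<noteq> 0 \<or> w \<noteq> 0 \<Longrightarrow> (A \<circ> \<rho> \<circ> A) (st z w) = st (l * z) w"
    by (rule rotation_about_e3[OF r']) (rule that)
  have l0: "l \<noteq> 0" using l(1) by auto
  have rhoA: "\<rho> (A (st z w)) = A (st (l * z) w)" if "z \<noteq> 0 \<or> w \<noteq> 0" for z w
    using l(2)[OF that] AA by (metis comp_apply)
  have iter: "(\<rho> ^^ j) (A (st z w)) = A (st (l ^ j * z) w)" if "z \<noteq> 0 \<or> w \<noteq> 0" for z w j
  proof (induction j)
    case (Suc j)
    then show ?case using rhoA[of "l ^ j * z" w] that l0 by (simp add: mult.assoc)
  qed simp
  have nl: "n dvd k" if "l ^ k = 1" for k
  proof (rule n(2))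
    fix x :: "real^3" assume "x \<in> ?S"
    then have "A x \<in> ?S" by (rule rotation_sphere[OF rA])
    then obtain z w where zw: "z \<noteq> 0 \<or> w \<noteq> 0" "A x = st z w" by (rule sphere_eq_st)
    then have "x = A (st z w)" using AA by metis
    then show "(\<rho> ^^ k) x = x" using iter[OF zw(1)] that by simp
  qed
  define \<beta> where "\<beta> = (\<lambda>z. A (st z 1))"
  have hb: "hol_at riemann_sphere \<beta> z" for z
    using holomorphic_map_sphere_curves(1)[OF riemann_surface_sphere rotation_holomorphic[OF rA]] by (simp add: \<beta>_def)
  have b0: "\<beta> 0 = s" using As AA[of s] by (simp add: \<beta>_def)
  have hgb: "hol_at Y (g \<circ> \<beta>) 0" by (rule holomorphic_map_hol_at[OF *(1,2,7) hb])
  have oV: "openin (carrier_top Y) V" using riemann_surface_chart[OF *(2) V(1)] by (rule complex_chart_openin)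
  have injV: "inj_on \<psi> V" using riemann_surface_chart[OF *(2) V(1)] by (rule complex_chart_inj)
  obtain r where r: "r > 0" "(g \<circ> \<beta>) ` ball 0 r \<subseteq> V" "(\<psi> \<circ> (g \<circ> \<beta>)) holomorphic_on ball 0 r"
    using hol_at_chart[OF *(2) hgb V(1) oV] V(2) b0 by auto
  define F where "F = (\<lambda>z. \<psi> (g (\<beta> z)) - \<psi> (g s))"
  have hF: "F holomorphic_on ball 0 r" using r(3) unfolding F_def o_def by (intro holomorphic_intros)
  \<comment> \<open>\<open>\<beta>\<close> inverts the chart
    \<open>north_coordinate \<circ> A\<close>, so its image of an open set is the preimage of that
    set under this chart.\<close>
  have bop: "openin (top_of_set ?S) (\<beta> ` B)" if B: "open B" for B
  proof -
    have b1: "openin (top_of_set ?S) {x \<in> ?S - {axis 3 1}. north_coordinate x \<in> B}" 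
      by (rule complex_chart_inv_open[OF complex_chart_north B])
    have "continuous_map (top_of_set ?S) (top_of_set ?S) A"
      using rotation_holomorphic[OF rA] by (simp add: holomorphic_map_def)
    then have "openin (top_of_set ?S) {x \<in> ?S. A x \<in> {x \<in> ?S - {axis 3 1}. north_coordinate x \<in> B}}"
      using b1 unfolding continuous_map_def by auto
    moreover have "{x \<in> ?S. A x \<in> {x \<in> ?S - {axis 3 1}. north_coordinate x \<in> B}} = \<beta> ` B"
    proof (intro subset_antisym subsetI)
      fix x assume x: "x \<in> {x \<in> ?S. A x \<in> {x \<in> ?S - {axis 3 1}. north_coordinate x \<in> B}}"
      then have "st (north_coordinate (A x)) 1 = A x" by (intro st_north) auto
      then have "x = \<beta> (north_coordinate (A x))" using AA by (simp add: \<beta>_def)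
      then show "x \<in> \<beta> ` B" using x by blast
    next
      fix x assume "x \<in> \<beta> ` B"
      then obtain z where z: "z \<in> B" "x = A (st z 1)" by (auto simp: \<beta>_def)
      have "st z 1 \<in> ?S" by (rule st_in_sphere) simp
      then show "x \<in> {x \<in> ?S. A x \<in> {x \<in> ?S - {axis 3 1}. north_coordinate x \<in> B}}"
        using z rotation_sphere[OF rA] AA by (simp add: north_st st_eq_north_pole rotation_norm[OF rA])
    qed
    ultimately show ?thesis by simp
  qed
  have nc: "\<not> F constant_on ball 0 r"
  proof
    assume "F constant_on ball 0 r"
    then obtain c where c: "\<And>z. z \<in> ball 0 r \<Longrightarrow> F z = c" by (auto simp: constant_on_def)
    have "g x = g y" if "x \<in> \<beta> ` ball 0 r" "y \<in> \<beta> ` ball 0 r" for x y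
    proof -
      obtain z w where zw: "z \<in> ball 0 r" "x = \<beta> z" "w \<in> ball 0 r" "y = \<beta> w" using \<open>x \<in> \<beta> ` ball 0 r\<close> \<open>y \<in> \<beta> ` ball 0 r\<close> by blast
      have "F z = F w" using c zw by simp
      then have "\<psi> (g (\<beta> z)) = \<psi> (g (\<beta> w))" unfolding F_def by simp
      moreover have "g (\<beta> z) \<in> V" "g (\<beta> w) \<in> V" using r(2) zw by auto
      ultimately show ?thesis using injV zw by (metis inj_onD)
    qed
    moreover have "openin (carrier_top riemann_sphere) (\<beta> ` ball 0 r)" using bop[OF open_ball] by simp
    moreover have "\<beta> ` ball 0 r \<noteq> {}" using r(1) by simp
    ultimately show False using branched_covering_not_locally_constant[OF g] by blast
  qed
  have Fl: "F (l * z) = F z" if "z \<in> ball 0 r" for z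
  proof -
    have "\<rho> (\<beta> z) = \<beta> (l * z)" using rhoA[of z 1] by (simp add: \<beta>_def)
    moreover have "\<beta> z \<in> ?S" unfolding \<beta>_def by (intro rotation_sphere[OF rA] st_in_sphere) simp
    ultimately show ?thesis using \<rho>(3)[of "\<beta> z"] by (simp add: F_def)
  qed
  have F0: "F 0 = 0" by (simp add: F_def b0)
  obtain r1 \<theta> where t: "r1 > 0" "r1 \<le> r" "\<theta> holomorphic_on ball 0 r1" "\<And>z. z \<in> ball 0 r1 \<Longrightarrow> F z = \<theta> z ^ n"
    by (rule rotation_invariant_power_series[OF hF r(1) F0 nc l(1) Fl n(1) nl]) (assumption | rule that)+
  have north: "north_coordinate (A (\<beta> z)) = z" for z by (simp add: \<beta>_def AA north_st)
  show ?thesis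
  proof (rule that[of "\<beta> ` ball 0 r1" "\<theta> \<circ> north_coordinate \<circ> A"])
    show "s \<in> \<beta> ` ball 0 r1" using b0 t(1) by (intro image_eqI[of _ _ 0]) auto
    show "g x \<in> V \<and> \<psi> (g x) - \<psi> (g s) = (\<theta> \<circ> north_coordinate \<circ> A) x ^ n" if x: "x \<in> \<beta> ` ball 0 r1" for x
    proof -
      obtain z where z: "z \<in> ball 0 r1" "x = \<beta> z" using x by blast
      have "z \<in> ball 0 r" using z(1) t(2) by simp
      then show ?thesis using t(4)[OF z(1)] r(2) unfolding z(2) by (auto simp: north F_def)
    qed
    show "holomorphic_function riemann_sphere (\<beta> ` ball 0 r1) (\<theta> \<circ> north_coordinate \<circ> A)"
    proof (rule holomorphic_functionI[OF riemann_surface_sphere])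
      show "openin (carrier_top riemann_sphere) (\<beta> ` ball 0 r1)" using bop by simp
      fix h z assume h: "hol_at riemann_sphere h z" "h z \<in> \<beta> ` ball 0 r1"
      have hA: "hol_at riemann_sphere (A \<circ> h) z"
        by (rule holomorphic_map_hol_at[OF riemann_surface_sphere riemann_surface_sphere rotation_holomorphic[OF rA] h(1)])
      have "openin (carrier_top riemann_sphere) (?S - {axis 3 1})" using complex_chart_openin[OF complex_chart_north] by simp
      moreover have nc: "north_coordinate (A (h z)) \<in> ball 0 r1" and "A (h z) \<in> ?S - {axis 3 1}"
        using h(2) by (auto simp: north) (auto simp: \<beta>_def AA norm_st st_eq_north_pole)
      ultimately obtain e where e: "e > 0" "(north_coordinate \<circ> (A \<circ> h)) holomorphic_on ball z e"
        using hol_at_chart[OF riemann_surface_sphere hA, of "?S - {axis 3 1}" north_coordinate "?S - {axis 3 1}"] by auto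
      let ?D = "ball z e \<inter> (north_coordinate \<circ> (A \<circ> h)) -` ball 0 r1"
      have "open ?D" using holomorphic_on_imp_continuous_on[OF e(2)] by (intro continuous_open_preimage) auto
      moreover have "z \<in> ?D" using e(1) nc by simp
      ultimately obtain e' where e': "e' > 0" "ball z e' \<subseteq> ?D" using openE by blast
      have "(\<theta> \<circ> (north_coordinate \<circ> (A \<circ> h))) holomorphic_on ball z e'"
        by (rule holomorphic_on_compose_gen[OF holomorphic_on_subset[OF e(2)] t(3)]) (use e'(2) in auto)
      then show "\<exists>e>0. (\<theta> \<circ> north_coordinate \<circ> A) \<circ> h holomorphic_on ball z e" using e'(1) by (auto simp: o_assoc)
    qed
  qed
qed

section \<open>Lifts of a curve along a branched covering\<close>

definition lift_on :: "'a surface \<Rightarrow> ('a \<Rightarrow> 'b) \<Rightarrow> (complex \<Rightarrow> 'b) \<Rightarrow> complex set \<Rightarrow> (complex \<Rightarrow> 'a) \<Rightarrow> bool" where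
  "lift_on X f k D h \<longleftrightarrow> (\<forall>w\<in>D. hol_at X h w \<and> f (h w) = k w)"

text \<open>The lift may be prescribed at any parameter of the ball, not just at the centre, and
  always exists on the same ball. This uniformity passes to smaller balls with other centres, which
  the continuation by discs of fixed radius relies on.\<close>

definition liftable :: "'a surface \<Rightarrow> ('a \<Rightarrow> 'b) \<Rightarrow> (complex \<Rightarrow> 'b) \<Rightarrow> complex \<Rightarrow> real \<Rightarrow> bool" where
  "liftable X f k c e \<longleftrightarrow> (\<forall>z\<in>ball c e. \<forall>x\<in>points X. f x = k z \<longrightarrow> (\<exists>h. lift_on X f k (ball c e) h \<and> h z = x))"

text \<open>In suitable coordinates \<open>f\<close> is \<open>t ^ d\<close> and \<open>k\<close> is \<open>\<theta> ^ N\<close> with \<open>d\<close> dividing \<open>N\<close>, so the lifts are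
  \<open>\<zeta> * \<theta> ^ (N / d)\<close> for the \<open>d\<close>-th roots of unity \<open>\<zeta>\<close>.\<close>

lemma local_lift:
  assumes bc: "branched_covering X Y f" and V: "(V, \<psi>) \<in> atlas Y" "k c \<in> V" and k: "hol_at Y k c"
    and \<theta>: "e0 > 0" "\<theta> holomorphic_on ball c e0" "\<And>z. z \<in> ball c e0 \<Longrightarrow> k z \<in> V \<and> \<psi> (k z) - \<psi> (k c) = \<theta> z ^ N" and N: "N \<ge> 1"
    and dvd: "\<And>x. x \<in> points X \<Longrightarrow> f x = k c \<Longrightarrow> branching_order X Y f x dvd N"
  shows "\<exists>e>0. liftable X f k c e"
proof -
  note * = branched_covering_rs[OF bc]
  have injV: "inj_on \<psi> V" using riemann_surface_chart[OF *(2) V(1)] by (rule complex_chart_inj)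
  let ?F = "{x \<in> points X. f x = k c}"
  let ?d = "branching_order X Y f"
  have "\<forall>x\<in>?F. \<exists>m. fst m > 0 \<and> (\<forall>t\<in>ball 0 (fst m). hol_at X (snd m) t) \<and> openin (carrier_top X) (snd m ` ball 0 (fst m)) \<and>
     snd m 0 = x \<and> ?d x \<ge> 1 \<and> (\<forall>t\<in>ball 0 (fst m). f (snd m t) \<in> V \<and> \<psi> (f (snd m t)) - \<psi> (k c) = t ^ ?d x)"
    (is "\<forall>x\<in>?F. \<exists>m. ?P x m")
  proof
    fix x assume "x \<in> ?F"
    then have x: "x \<in> points X" "f x = k c" by auto
    have fV: "f x \<in> V" using x V by simp
    obtain r \<alpha> where 1: "?d x \<ge> 1" "r > 0" "\<And>t. t \<in> ball 0 r \<Longrightarrow> hol_at X \<alpha> t" 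
      "inj_on \<alpha> (ball 0 r)" "\<alpha> 0 = x" "openin (carrier_top X) (\<alpha> ` ball 0 r)" 
      "\<And>t. t \<in> ball 0 r \<Longrightarrow> f (\<alpha> t) \<in> V \<and> \<psi> (f (\<alpha> t)) - \<psi> (f x) = t ^ ?d x"
      by (rule branching_order_normal_form[OF bc x(1) V(1) fV]) (rule that)
    show "\<exists>m. ?P x m"
      by (rule exI[of _ "(r, \<alpha>)"]) (use 1 x(2) in simp)
  qed
  then obtain m where m: "\<forall>x\<in>?F. ?P x (m x)" by (rule bchoice[THEN exE])
  define r where "r = (\<lambda>x. fst (m x))"
  define \<alpha> where "\<alpha> = (\<lambda>x. snd (m x))"
  have r: "r x > 0" "\<And>t. t \<in> ball 0 (r x) \<Longrightarrow> hol_at X (\<alpha> x) t" "openin (carrier_top X) (\<alpha> x ` ball 0 (r x))" "\<alpha> x 0 = x"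
    "?d x \<ge> 1" "\<And>t. t \<in> ball 0 (r x) \<Longrightarrow> f (\<alpha> x t) \<in> V" "\<And>t. t \<in> ball 0 (r x) \<Longrightarrow> \<psi> (f (\<alpha> x t)) - \<psi> (k c) = t ^ ?d x" 
    if "x \<in> ?F" for x using bspec[OF m that] by (simp_all add: r_def \<alpha>_def)
  define U where "U = (\<lambda>x. \<alpha> x ` ball 0 (r x))"
  have xU: "x \<in> U x" if "x \<in> ?F" for x using r(1,4)[OF that] unfolding U_def by (intro image_eqI[of _ _ 0]) auto
  have oU: "openin (carrier_top X) (U x)" if "x \<in> ?F" for x using r(3)[OF that] by (simp add: U_def)
  have kc: "k c \<in> points Y" by (rule hol_at_points[OF *(2) k])
  have "closedin (carrier_top Y) {k c}" using *(10) kc by (simp add: closedin_Hausdorff_singleton)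
  then have "closedin (carrier_top X) {x \<in> points X. f x \<in> {k c}}" using *(8) closedin_continuous_map_preimage by blast
  then have "compactin (carrier_top X) ?F" using *(3) closedin_compact_space by simp
  moreover have "openin (carrier_top X) A" if "A \<in> U ` ?F" for A using that oU by (elim imageE) simp
  moreover have "?F \<subseteq> \<Union>(U ` ?F)" 
  proof
    fix x assume x: "x \<in> ?F"
    show "x \<in> \<Union>(U ` ?F)" using xU[OF x] x by (rule UN_I[where B = U, rotated])
  qed
  ultimately have "\<exists>C. finite C \<and> C \<subseteq> U ` ?F \<and> ?F \<subseteq> \<Union>C" by (rule compactinD)
  then obtain C where C: "finite C" "C \<subseteq> U ` ?F" "?F \<subseteq> \<Union>C" by (elim exE conjE)
  from finite_subset_image[OF C(1,2)]
  obtain F0 where F0: "F0 \<subseteq> ?F" "finite F0" "C = U ` F0" by (elim exE conjE) (rule that)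
  \<comment> \<open>The fibre is compact, so finitely many normal-form discs cover it. The rest
    \<open>Q\<close> of \<open>X\<close> is compact with a closed image that misses
    \<open>k c\<close>; hence for parameters near c the entire fibre stays inside the chosen
    discs.\<close>
  define Q where "Q = points X - \<Union>(U ` F0)"
  have "openin (carrier_top X) (\<Union>(U ` F0))" 
  proof (rule openin_Union, elim imageE)
    fix S x assume "S = U x" "x \<in> F0"
    then show "openin (carrier_top X) S" using oU[OF subsetD[OF F0(1)]] by simp
  qed
  then have "closedin (carrier_top X) Q" unfolding Q_def by (simp add: closedin_diff)
  then have "compactin (carrier_top X) Q" by (rule closedin_compact_space[OF *(3)])
  then have "compactin (carrier_top Y) (f ` Q)" by (rule image_compactin[OF _ *(8)])
  then have "closedin (carrier_top Y) (f ` Q)" by (rule compactin_imp_closedin[OF *(10)])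
  then have oV': "openin (carrier_top Y) (points Y - f ` Q)" by (rule openin_diff[OF openin_topspace])
  have kV': "k c \<in> points Y - f ` Q" 
  proof
    show "k c \<in> points Y" by (rule kc)
    show "k c \<notin> f ` Q"
    proof
      assume "k c \<in> f ` Q"
      then obtain x where x: "x \<in> Q" "k c = f x" by (elim imageE)
      then have "x \<in> ?F" unfolding Q_def by simp
      then have "x \<in> \<Union>(U ` F0)" using C(3) unfolding F0(3) by (rule subsetD[rotated])
      then show False using x(1) unfolding Q_def by simp
    qed
  qed
  obtain e1 where e1: "e1 > 0" "k ` ball c e1 \<subseteq> points Y - f ` Q" using hol_at_open_ball[OF *(2) k oV' kV'] by blast
  have t0: "\<theta> c = 0" using \<theta>(3)[of c] \<theta>(1) N by simp
  have ct: "isCont \<theta> c" using holomorphic_on_imp_continuous_on[OF \<theta>(2)] \<theta>(1) by (simp add: continuous_on_eq_continuous_at)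
  \<comment> \<open>The value \<open>\<zeta> * \<theta> w ^ j\<close> has to stay in the disc of its
    normal form. Its d-th power is \<open>\<theta> w ^ N\<close>, so bounding this one function is
    enough for every disc and every root of unity.\<close>
  have "\<forall>\<^sub>F z in nhds c. \<forall>x\<in>F0. cmod (\<theta> z ^ N) < r x ^ ?d x"
  proof (rule eventually_ball_finite[OF F0(2)], rule ballI)
    fix x assume "x \<in> F0"
    then have x: "x \<in> ?F" using F0(1) by blast
    have "isCont (\<lambda>z. cmod (\<theta> z ^ N)) c" using ct by (intro continuous_intros)
    then have "((\<lambda>z. cmod (\<theta> z ^ N)) \<longlongrightarrow> 0) (nhds c)" 
      using tendsto_at_iff_tendsto_nhds[of "\<lambda>z. cmod (\<theta> z ^ N)" c] t0 N by (simp add: isCont_def zero_power)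
    then show "\<forall>\<^sub>F z in nhds c. cmod (\<theta> z ^ N) < r x ^ ?d x"
      by (rule order_tendstoD(2)) (use r(1)[OF x] in simp)
  qed
  then obtain e2 where e2: "e2 > 0" "\<And>z x. z \<in> ball c e2 \<Longrightarrow> x \<in> F0 \<Longrightarrow> cmod (\<theta> z ^ N) < r x ^ ?d x"
    unfolding eventually_nhds_metric by (metis dist_commute mem_ball)
  define e where "e = min e0 (min e1 e2)"
  have e: "e > 0" "ball c e \<subseteq> ball c e0" "ball c e \<subseteq> ball c e1" "ball c e \<subseteq> ball c e2" using \<theta>(1) e1(1) e2(1) by (auto simp: e_def)
  have "\<exists>h. lift_on X f k (ball c e) h \<and> h z = x" if z: "z \<in> ball c e" and x: "x \<in> points X" "f x = k z" for z x
  proof -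
    have "k z \<notin> f ` Q" using e1(2) e(3) z by blast
    then have "x \<notin> Q" unfolding x(2)[symmetric] by (rule contrapos_nn) (rule imageI)
    then have "x \<in> \<Union>(U ` F0)" using x(1) unfolding Q_def by simp
    then obtain y where y: "y \<in> F0" "x \<in> U y" by blast
    then have yF: "y \<in> ?F" using F0(1) by blast
    obtain t where t: "t \<in> ball 0 (r y)" "x = \<alpha> y t" using y(2) unfolding U_def by blast
    let ?n = "?d y"
    obtain j where j: "N = ?n * j" by (rule dvdE[OF dvd[OF CollectD[OF yF, THEN conjunct1] CollectD[OF yF, THEN conjunct2]]])
    have n1: "?n \<ge> 1" by (rule r(5)[OF yF])
    have tpow: "t ^ ?n = (\<theta> z ^ j) ^ ?n"
      using r(7)[OF yF t(1)] t(2) x(2) \<theta>(3)[of z] z e(2) by (auto simp: j power_mult[symmetric] mult.commute)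
    \<comment> \<open>Both t and \<open>\<theta> z ^ j\<close> have the same d-th power, so they
      differ by a root of unity; if they vanish, 1 will do.\<close>
    obtain \<zeta> where zeta: "\<zeta> ^ ?n = 1" "t = \<zeta> * \<theta> z ^ j"
    proof (cases "\<theta> z ^ j = 0")
      case True
      then have "t ^ ?n = 0" unfolding tpow using n1 by (simp add: zero_power)
      then show ?thesis using that[of 1] True by simp
    next
      case False
      then show ?thesis using that[of "t / \<theta> z ^ j"] tpow by (simp add: power_divide)
    qed
    define h where "h = \<alpha> y \<circ> (\<lambda>w. \<zeta> * \<theta> w ^ j)"
    have "lift_on X f k (ball c e) h"
      unfolding lift_on_def
    proof (intro ballI conjI)
      fix w assume w: "w \<in> ball c e"
      have pw: "(\<zeta> * \<theta> w ^ j) ^ ?n = \<theta> w ^ N" using zeta(1) by (simp add: power_mult_distrib j power_mult[symmetric] mult.commute)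
      have "cmod (\<zeta> * \<theta> w ^ j) ^ ?n < r y ^ ?n" using e2(2)[of w y] w e(4) y(1) pw by (auto simp flip: norm_power)
      then have inb: "\<zeta> * \<theta> w ^ j \<in> ball 0 (r y)"
        using power_less_imp_less_base[of _ ?n "r y"] r(1)[OF yF] by simp
      show "hol_at X h w" unfolding h_def
      proof (rule hol_at_compose[where D = "ball c e"])
        show "hol_at X (\<alpha> y) (\<zeta> * \<theta> w ^ j)" by (rule r(2)[OF yF inb])
        show "(\<lambda>w. \<zeta> * \<theta> w ^ j) holomorphic_on ball c e"
          by (intro holomorphic_intros holomorphic_on_subset[OF \<theta>(2) e(2)])
      qed (use w in auto)
      have "\<psi> (f (h w)) - \<psi> (k c) = \<psi> (k w) - \<psi> (k c)"
        using r(7)[OF yF inb] pw \<theta>(3)[of w] w e(2) by (auto simp: h_def)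
      moreover have "f (h w) \<in> V" "k w \<in> V" using r(6)[OF yF inb] \<theta>(3)[of w] w e(2) by (auto simp: h_def)
      ultimately show "f (h w) = k w" using injV by (simp add: inj_onD)
    qed
    moreover have "h z = x" using zeta(2) t(2) by (simp add: h_def)
    ultimately show ?thesis by blast
  qed
  then show ?thesis using e(1) unfolding liftable_def by blast
qed

text \<open>Near an unbranched point \<open>f\<close> is injective, which makes the lifts agree on a
  small ball; the identity theorem extends this to the connected domain, branched points
  included.\<close>

lemma lift_unique:
  assumes bc: "branched_covering X Y f" and D: "open D" "connected D"
    and h: "lift_on X f k D h" "lift_on X f k D h'" and z: "z \<in> D" "h z = h' z" "branching_order X Y f (h z) = 1"
    and w: "w \<in> D"
  shows "h w = h' w"
proof -
  note * = branched_covering_rs[OF bc]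
  have hol: "hol_at X h w" "hol_at X h' w" "f (h w) = f (h' w)" if "w \<in> D" for w using h that by (auto simp: lift_on_def)
  obtain W where W: "openin (carrier_top X) W" "h z \<in> W" "inj_on f W"
    using unbranched_locally_injective[OF bc hol_at_points[OF *(1) hol(1)[OF z(1)]] z(3)] by blast
  obtain e1 where e1: "e1 > 0" "h ` ball z e1 \<subseteq> W" using hol_at_open_ball[OF *(1) hol(1)[OF z(1)] W(1,2)] by blast
  obtain e2 where e2: "e2 > 0" "h' ` ball z e2 \<subseteq> W" using hol_at_open_ball[OF *(1) hol(2)[OF z(1)] W(1)] W(2) z(2) by auto
  obtain e3 where e3: "e3 > 0" "ball z e3 \<subseteq> D" using openE[OF D(1) z(1)] by blast
  define e where "e = min e1 (min e2 e3)"
  have e: "e > 0" "ball z e \<subseteq> ball z e1" "ball z e \<subseteq> ball z e2" "ball z e \<subseteq> D" using e1(1) e2(1) e3 by (auto simp: e_def)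
  show ?thesis
  proof (rule hol_at_identity[OF *(1) D hol(1,2), where B = "ball z e"])
    fix v assume v: "v \<in> ball z e"
    have "v \<in> ball z e1" "v \<in> ball z e2" "v \<in> D" using v e(2-4) by blast+
    then have "h v \<in> W" "h' v \<in> W" "v \<in> D" using e1(2) e2(2) unfolding image_subset_iff by blast+
    then show "h v = h' v" using hol(3) W(3) by (simp add: inj_onD)
  qed (use e w in auto)
qed


section \<open>Global lifting\<close>


lemma lift_on_subset: "lift_on X f k D h \<Longrightarrow> D' \<subseteq> D \<Longrightarrow> lift_on X f k D' h"
  by (auto simp: lift_on_def)

lemma liftable_subset:
  assumes "liftable X f k c e" "ball c' e' \<subseteq> ball c e"
  shows "liftable X f k c' e'"
  unfolding liftable_def
proof (intro ballI impI)
  fix z x assume z: "z \<in> ball c' e'" and x: "x \<in> points X" "f x = k z"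
  then obtain h where "lift_on X f k (ball c e) h" "h z = x" using assms unfolding liftable_def by blast
  then show "\<exists>h. lift_on X f k (ball c' e') h \<and> h z = x" using lift_on_subset[OF _ assms(2)] by blast
qed

lemma lift_identity:
  assumes X: "riemann_surface X" and D: "open D" "connected D"
    and h: "lift_on X f k D h" "lift_on X f k D h'" and B: "open B" "B \<noteq> {}" "B \<subseteq> D" "\<And>z. z \<in> B \<Longrightarrow> h z = h' z"
    and w: "w \<in> D"
  shows "h w = h' w"
  by (rule hol_at_identity[OF X D _ _ B w]) (use h in \<open>auto simp: lift_on_def\<close>)

text \<open>Lifts that meet at a branched point may still differ. Every open set of parameters must
  therefore offer one over which the whole fibre of \<open>f\<close> is unbranched, so that lifts
  can be matched there.\<close>

definition generic_curve :: "'a surface \<Rightarrow> 'b surface \<Rightarrow> ('a \<Rightarrow> 'b) \<Rightarrow> (complex \<Rightarrow> 'b) \<Rightarrow> bool" where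
  "generic_curve X Y f k \<longleftrightarrow> 
     (\<forall>B. open B \<longrightarrow> B \<noteq> {} \<longrightarrow> (\<exists>z\<in>B. \<forall>x\<in>points X. f x = k z \<longrightarrow> branching_order X Y f x = 1))"

text \<open>Discs of equal radius centred at two points of a circle meet, if at all, inside the circle;
  so lifts on such discs that extend one on the inside agree on their overlap.\<close>

lemma lift_extend:
  assumes bc: "branched_covering X Y f" and gen: "generic_curve X Y f k"
    and h: "lift_on X f k (ball 0 r) h" and r: "r > 0" and d: "d > 0"
    and lift: "\<And>s. s \<in> sphere 0 r \<Longrightarrow> liftable X f k s d"
  shows "\<exists>h'. lift_on X f k (ball 0 (r + d/2)) h' \<and> (\<forall>z\<in>ball 0 r. h' z = h z)"
proof -
  note * = branched_covering_rs[OF bc]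
  have near: "ball s d \<inter> ball 0 r \<noteq> {}" if s: "s \<in> sphere 0 r" for s :: complex
  proof -
    have "s \<in> closure (ball 0 r)" using s r by simp
    then obtain y where "y \<in> ball 0 r" "dist y s < d" using d closure_approachable by blast
    then show ?thesis by (auto simp: dist_commute)
  qed
  have "\<exists>g. lift_on X f k (ball s d) g \<and> (\<forall>z\<in>ball s d \<inter> ball 0 r. g z = h z)" if s: "s \<in> sphere 0 r" for s
  proof -
    let ?B = "ball s d \<inter> ball 0 r"
    have conv: "connected ?B" by (intro convex_connected convex_Int convex_ball)
    obtain c where c: "c \<in> ?B" "\<And>x. x \<in> points X \<Longrightarrow> f x = k c \<Longrightarrow> branching_order X Y f x = 1"
      using gen near[OF s] unfolding generic_curve_def by (metis open_Int open_ball)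
    have hc: "hol_at X h c" "f (h c) = k c" using h c(1) by (auto simp: lift_on_def)
    note px = hol_at_points[OF *(1) hc(1)]
    obtain g where g: "lift_on X f k (ball s d) g" "g c = h c"
      using lift[OF s] c(1) px hc(2) unfolding liftable_def by blast
    have "g z = h z" if "z \<in> ?B" for z
      by (rule lift_unique[OF bc _ conv lift_on_subset[OF g(1)] lift_on_subset[OF h] c(1) g(2) _ that])
         (use c(2)[OF px hc(2)] g(2) in auto)
    then show ?thesis using g(1) by blast
  qed
  then obtain g where g: "\<And>s. s \<in> sphere 0 r \<Longrightarrow> lift_on X f k (ball s d) (g s)"
      "\<And>s z. s \<in> sphere 0 r \<Longrightarrow> z \<in> ball s d \<Longrightarrow> z \<in> ball 0 r \<Longrightarrow> g s z = h z"
    by (metis IntI)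
  have agree: "g s z = g t z" if st: "s \<in> sphere 0 r" "t \<in> sphere 0 r" and z: "z \<in> ball s d" "z \<in> ball t d" for s t z
  proof (cases "s = t")
    case False
    let ?D = "ball s d \<inter> ball t d"
    \<comment> \<open>By the parallelogram law the midpoint of two different points of the circle
      lies strictly inside it. It lies in both discs as well, because overlapping discs of radius d
      have centres less than 2 * d apart.\<close>
    define p where "p = (1/2) *\<^sub>R s + (1/2) *\<^sub>R t"
    have st': "dist s t < 2 * d" using z dist_triangle[of s t z] by (simp add: dist_commute)
    have "norm p < r"
    proof -
      have "(norm (s + t))\<^sup>2 + (norm (s - t))\<^sup>2 = 2 * (norm s)\<^sup>2 + 2 * (norm t)\<^sup>2"
        by (simp add: power2_norm_eq_inner inner_add_left inner_add_right inner_diff_left inner_diff_right)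
      then have "(norm (s + t))\<^sup>2 + (norm (s - t))\<^sup>2 = (2 * r)\<^sup>2" using st by (simp add: power_mult_distrib)
      moreover have "(norm (s - t))\<^sup>2 > 0" using False by simp
      ultimately have "(norm (s + t))\<^sup>2 < (2 * r)\<^sup>2" by linarith
      then have "norm (s + t) < 2 * r" by (rule power2_less_imp_less) (use r in simp)
      moreover have "norm p = norm (s + t) / 2" unfolding p_def scaleR_add_right[symmetric] by simp
      ultimately show ?thesis by simp
    qed
    then have p0: "p \<in> ball 0 r" by simp
    have "s - p = (1/2) *\<^sub>R (s - t)" "t - p = (1/2) *\<^sub>R (t - s)" by (simp_all add: p_def scaleR_conv_of_real algebra_simps)
    then have ps: "p \<in> ball s d" "p \<in> ball t d" using st' by (simp_all add: dist_norm norm_minus_commute)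
    show ?thesis
    proof (rule lift_identity[OF *(1), of ?D f k "g s" "g t" "?D \<inter> ball 0 r"])
      show "connected ?D" by (intro convex_connected convex_Int convex_ball)
      show "?D \<inter> ball 0 r \<noteq> {}" using p0 ps by blast
      show "lift_on X f k ?D (g s)" "lift_on X f k ?D (g t)" using g(1)[OF st(1)] g(1)[OF st(2)] by (auto intro: lift_on_subset)
      show "g s y = g t y" if "y \<in> ?D \<inter> ball 0 r" for y using that g(2) st by simp
    qed (use z in auto)
  qed simp
  \<comment> \<open>Radial projection onto the circle. A point of the ring is closer than d/2 to its
    projection, so the disc of radius d about the projection contains it.\<close>
  define \<pi> where "\<pi> = (\<lambda>z::complex. (r / norm z) *\<^sub>R z)"
  have pi: "\<pi> z \<in> sphere 0 r" "dist (\<pi> z) z < d / 2" if "z \<notin> ball 0 r" "z \<in> ball 0 (r + d/2)" for z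
  proof -
    have z: "norm z \<ge> r" "norm z < r + d/2" "norm z \<noteq> 0" using that r by auto
    show "\<pi> z \<in> sphere 0 r" using z r by (simp add: \<pi>_def)
    have "z - \<pi> z = (1 - r / norm z) *\<^sub>R z" by (simp add: \<pi>_def algebra_simps)
    then have "norm (z - \<pi> z) = \<bar>1 - r / norm z\<bar> * norm z" by simp
    also have "\<dots> = norm z - r" using z by (simp add: abs_if field_simps)
    finally show "dist (\<pi> z) z < d / 2" using z by (simp add: dist_norm norm_minus_commute)
  qed
  define h' where "h' = (\<lambda>z. if z \<in> ball 0 r then h z else g (\<pi> z) z)"
  have key: "h' z = g s z" if s: "s \<in> sphere 0 r" "z \<in> ball s d" "z \<in> ball 0 (r + d/2)" for s z
  proof (cases "z \<in> ball 0 r")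
    case True
    then show ?thesis using g(2)[OF s(1,2)] by (simp add: h'_def)
  next
    case False
    have "z \<in> ball (\<pi> z) d" using pi(2)[OF False s(3)] d by simp
    then show ?thesis using agree[OF pi(1)[OF False s(3)] s(1) _ s(2)] False by (simp add: h'_def)
  qed
  have "hol_at X h' z \<and> f (h' z) = k z" if z: "z \<in> ball 0 (r + d/2)" for z
  proof (cases "z \<in> ball 0 r")
    case True
    then have "hol_at X h z" "f (h z) = k z" using h by (auto simp: lift_on_def)
    moreover have "h' w = h w" if "w \<in> ball 0 r" for w using that by (simp add: h'_def)
    ultimately show ?thesis using hol_at_cong[OF _ open_ball True] True by metis
  next
    case False
    let ?s = "\<pi> z" and ?D = "ball (\<pi> z) d \<inter> ball 0 (r + d/2)"
    have zs: "z \<in> ball ?s d" using pi(2)[OF False z] d by simp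
    have "hol_at X (g ?s) z" "f (g ?s z) = k z" using g(1)[OF pi(1)[OF False z]] zs by (auto simp: lift_on_def)
    moreover have "h' w = g ?s w" if "w \<in> ?D" for w using key[OF pi(1)[OF False z]] that by blast
    moreover have "open ?D" "z \<in> ?D" using zs z by auto
    ultimately show ?thesis using hol_at_cong[of X "g ?s" z ?D h'] by simp
  qed
  then have "lift_on X f k (ball 0 (r + d/2)) h'" by (simp add: lift_on_def)
  moreover have "\<forall>z\<in>ball 0 r. h' z = h z" by (simp add: h'_def)
  ultimately show ?thesis by blast
qed

text \<open>On a closed disc of radius M a Lebesgue number of the cover by liftable balls gives one
  d for all centres, and the radius of the lift grows by d/2 until it reaches M. All these lifts
  continue the same germ \<open>h0\<close>, so by the identity theorem the lifts for different M fit
  together.\<close>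

lemma lift_plane:
  assumes bc: "branched_covering X Y f" and gen: "generic_curve X Y f k"
    and hol: "\<And>z. hol_at Y k z" and loc: "\<And>c. \<exists>e>0. liftable X f k c e"
  shows "\<exists>h. lift_on X f k UNIV h"
proof -
  note * = branched_covering_rs[OF bc]
  obtain e where e: "\<And>c. e c > 0" "\<And>c. liftable X f k c (e c)" using loc by metis
  have "k 0 \<in> f ` points X" using branched_covering_surj[OF bc] hol_at_points[OF *(2) hol] by simp
  then obtain x where "x \<in> points X" "f x = k 0" by (elim imageE) simp
  then obtain h0 where h0: "lift_on X f k (ball 0 (e 0)) h0"
    using e(2)[of 0] e(1)[of 0] unfolding liftable_def by (meson centre_in_ball)
  have ext: "\<exists>h. lift_on X f k (ball 0 M) h \<and> (\<forall>z\<in>ball 0 (e 0). h z = h0 z)" if M: "M \<ge> e 0" for M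
  proof -
    have "cball (0::complex) M \<subseteq> (\<Union>c. ball c (e c))" using e(1) by (meson UN_iff centre_in_ball iso_tuple_UNIV_I subsetI)
    then obtain d where d: "d > 0" "\<forall>s\<in>cball 0 M. \<exists>G\<in>range (\<lambda>c. ball c (e c)). ball s d \<subseteq> G"
      using Heine_Borel_lemma[of "cball (0::complex) M" "range (\<lambda>c. ball c (e c))"] by (metis (no_types, lifting) compact_cball imageE open_ball)
    have lift: "liftable X f k s d" if "norm s \<le> M" for s
    proof -
      have "s \<in> cball 0 M" using that by simp
      then obtain c where "ball s d \<subseteq> ball c (e c)" using d(2) by blast
      then show ?thesis using liftable_subset[OF e(2)] by blast
    qed
    have step: "\<exists>h. lift_on X f k (ball 0 (min M (e 0 + real j * (d/2)))) h \<and> (\<forall>z\<in>ball 0 (e 0). h z = h0 z)" for j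
    proof (induction j)
      case 0
      show ?case using h0 M by (auto simp: min_def)
    next
      case (Suc j)
      let ?r = "min M (e 0 + real j * (d/2))"
      obtain h where h: "lift_on X f k (ball 0 ?r) h" "\<And>z. z \<in> ball 0 (e 0) \<Longrightarrow> h z = h0 z" using Suc by blast
      have r: "?r > 0" "e 0 \<le> ?r" using M e(1)[of 0] d(1) by (auto intro: add_pos_nonneg)
      have "\<exists>h'. lift_on X f k (ball 0 (?r + d/2)) h' \<and> (\<forall>z\<in>ball 0 ?r. h' z = h z)"
        by (rule lift_extend[OF bc gen h(1) r(1) d(1)], rule lift) auto
      then obtain h' where h': "lift_on X f k (ball 0 (?r + d/2)) h'" "\<And>z. z \<in> ball 0 ?r \<Longrightarrow> h' z = h z" by blast
      have "min M (e 0 + real (Suc j) * (d/2)) \<le> ?r + d/2" using d(1) by (auto simp: min_def algebra_simps add_divide_distrib)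
      then have "lift_on X f k (ball 0 (min M (e 0 + real (Suc j) * (d/2)))) h'"
        by (intro lift_on_subset[OF h'(1)] subset_ball)
      moreover have "h' z = h0 z" if "z \<in> ball 0 (e 0)" for z
      proof -
        have "z \<in> ball 0 ?r" using that r(2) by simp
        then show ?thesis using h'(2) h(2)[OF that] by simp
      qed
      ultimately show ?case by blast
    qed
    obtain j :: nat where "(M - e 0) / (d/2) < real j" using reals_Archimedean2 by blast
    then have "min M (e 0 + real j * (d/2)) = M" using d(1) by (simp add: field_simps min_def)
    then show ?thesis using step[of j] by simp
  qed
  define m where "m = (\<lambda>z::complex. e 0 + norm z + 1)"
  have mz: "m z \<ge> e 0" "z \<in> ball 0 (m z)" for z using e(1)[of 0] by (auto simp: m_def)
  obtain H where H: "\<And>M. M \<ge> e 0 \<Longrightarrow> lift_on X f k (ball 0 M) (H M)" "\<And>M z. M \<ge> e 0 \<Longrightarrow> z \<in> ball 0 (e 0) \<Longrightarrow> H M z = h0 z"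
    using ext by metis
  have cons: "H M z = H M' z" if M: "e 0 \<le> M" "M \<le> M'" and z: "z \<in> ball 0 M" for M M' z
  proof (rule lift_identity[OF *(1) open_ball convex_connected[OF convex_ball] H(1)[OF M(1)], where B = "ball 0 (e 0)"])
    show "lift_on X f k (ball 0 M) (H M')" by (rule lift_on_subset[OF H(1)]) (use M in auto)
    show "ball 0 (e 0) \<subseteq> ball (0::complex) M" "ball 0 (e 0) \<noteq> ({}::complex set)" using M e(1)[of 0] by auto
    fix y :: complex assume y: "y \<in> ball 0 (e 0)"
    have "H M y = h0 y" by (rule H(2)[OF M(1) y])
    moreover have "H M' y = h0 y" by (rule H(2)[OF order_trans[OF M] y])
    ultimately show "H M y = H M' y" by (rule trans[OF _ sym])
  next
    show "open (ball (0::complex) (e 0))" by (rule open_ball)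
    show "z \<in> ball 0 M" by (rule z)
  qed
  define h where "h = (\<lambda>z. H (m z) z)"
  have hM: "h z = H M z" if "M \<ge> e 0" "z \<in> ball 0 M" for M z
  proof (cases "M \<le> m z")
    case True
    show ?thesis unfolding h_def by (rule sym, rule cons[OF that(1) True that(2)])
  next
    case False
    then have "m z \<le> M" by simp
    from cons[OF mz(1) this mz(2)] show ?thesis unfolding h_def .
  qed
  have "hol_at X h z \<and> f (h z) = k z" for z
  proof -
    have 1: "hol_at X (H (m z)) z" "f (H (m z) z) = k z" using H(1)[OF mz(1)] mz(2)[of z] by (auto simp: lift_on_def)
    show ?thesis using hol_at_cong[OF 1(1) open_ball mz(2) hM[OF mz(1)]] 1(2) by (simp add: h_def)
  qed
  then show ?thesis by (auto simp: lift_on_def)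
qed

text \<open>A disc about infinity is lifted starting from the value of the plane lift at a generic
  parameter. The punctured disc is connected, so both lifts agree on it, and the second one supplies
  the missing value at infinity.\<close>

lemma lift_sphere:
  assumes bc: "branched_covering X Y f" and g: "holomorphic_map riemann_sphere Y g"
    and gen: "generic_curve X Y f (\<lambda>t. g (st t 1))" "generic_curve X Y f (\<lambda>t. g (st 1 t))"
    and loc: "\<And>c. \<exists>e>0. liftable X f (\<lambda>t. g (st t 1)) c e" "\<And>c. \<exists>e>0. liftable X f (\<lambda>t. g (st 1 t)) c e"
  obtains h where "holomorphic_map riemann_sphere X h" "\<And>x. x \<in> sphere 0 1 \<Longrightarrow> f (h x) = g x"
proof -
  note * = branched_covering_rs[OF bc]
  let ?k = "\<lambda>t. g (st 1 t)"
  obtain h1 where "lift_on X f (\<lambda>t. g (st t 1)) UNIV h1"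
    using lift_plane[OF bc gen(1) holomorphic_map_sphere_curves(1)[OF *(2) g] loc(1)] by blast
  then have h1: "hol_at X h1 t" "f (h1 t) = g (st t 1)" for t by (auto simp: lift_on_def)
  obtain e where e: "e > 0" "liftable X f ?k 0 e" using loc(2) by blast
  let ?D = "ball 0 e - {0::complex}"
  have D: "open ?D" "connected ?D" by (auto simp: open_delete intro!: connected_open_delete)
  have "complex_of_real (e / 2) \<in> ?D" using e(1) by simp
  then have "?D \<noteq> {}" by blast
  then obtain c where c: "c \<in> ?D" "\<And>x. x \<in> points X \<Longrightarrow> f x = ?k c \<Longrightarrow> branching_order X Y f x = 1"
    using gen(2) D(1) unfolding generic_curve_def by blast
  have inv: "st (1 / t) 1 = st 1 t" if "t \<noteq> 0" for t :: complex
    using st_scale[of t "1 / t" 1] that by simp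
  have c0: "c \<noteq> 0" "c \<in> ball 0 e" using c(1) by auto
  have fx: "h1 (1 / c) \<in> points X" "f (h1 (1 / c)) = ?k c" using hol_at_points[OF *(1) h1(1)] h1(2) inv[OF c0(1)] by auto
  obtain h2 where h2: "lift_on X f ?k (ball 0 e) h2" "h2 c = h1 (1 / c)"
    using e(2) c0(2) fx unfolding liftable_def by blast
  define h1' where "h1' = h1 \<circ> (\<lambda>t. 1 / t)"
  have hol1': "hol_at X h1' t" if "t \<noteq> 0" for t unfolding h1'_def
    by (rule hol_at_compose[where D = "- {0}"]) (use that h1 in \<open>auto intro!: holomorphic_intros\<close>)
  have l1: "lift_on X f ?k ?D h1'" unfolding lift_on_def
    using hol1' h1(2) inv by (auto simp: h1'_def)
  have eq: "h1' t = h2 t" if "t \<in> ?D" for t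
    by (rule lift_unique[OF bc D l1 lift_on_subset[OF h2(1)] c(1) _ _ that]) (use h2(2) c(2)[OF fx] in \<open>auto simp: h1'_def\<close>)
  define h where "h = (\<lambda>x. if x = axis 3 1 then h2 0 else h1 (north_coordinate x))"
  have h_st1: "h (st t 1) = h1 t" for t by (simp add: h_def st_eq_north_pole north_st)
  have h_st2: "h (st 1 t) = (if t = 0 then h2 0 else h1' t)" for t by (simp add: h_def st_eq_north_pole north_st h1'_def)
  have "hol_at X (\<lambda>t. h (st 1 t)) z" for z
  proof (cases "z = 0")
    case True
    have "hol_at X h2 0" using h2(1) e(1) by (simp add: lift_on_def)
    then show ?thesis unfolding True by (rule hol_at_cong[OF _ open_ball[of 0 e]]) (use e(1) eq in \<open>auto simp: h_st2\<close>)
  next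
    case False
    show ?thesis by (rule hol_at_cong[OF hol1'[OF False], of "- {0}"]) (use False in \<open>auto simp: h_st2\<close>)
  qed
  moreover have "hol_at X (\<lambda>t. h (st t 1)) z" for z using h1(1) by (simp add: h_st1[abs_def])
  ultimately have "holomorphic_map riemann_sphere X h" by (intro holomorphic_map_from_sphere[OF *(1)])
  moreover have "f (h x) = g x" if x: "x \<in> sphere 0 1" for x
  proof (cases "x = axis 3 1")
    case True
    have "f (h2 0) = g (st 1 0)" using h2(1) e(1) by (simp add: lift_on_def)
    then show ?thesis using True by (simp add: h_def st_zero_right)
  next
    case False
    then show ?thesis using h1(2)[of "north_coordinate x"] st_north[OF x False] by (simp add: h_def)
  qed
  ultimately show ?thesis using that by blast
qed


section \<open>Domination by a quotient map\<close>


text \<open>Functions are total, and only their values on the points of a surface matter. This is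
  wanted for \<open>F \<circ> orbit G\<close>, which is known to agree with the constructed covering
  on the sphere.\<close>

lemma holomorphic_map_cong:
  assumes X: "riemann_surface X" and Y: "riemann_surface Y" and f: "holomorphic_map X Y f"
    and eq: "\<And>x. x \<in> points X \<Longrightarrow> f' x = f x"
  shows "holomorphic_map X Y f'"
proof (rule holomorphic_mapI[OF X Y])
  fix U \<phi> z assume U: "(U, \<phi>) \<in> atlas X" and z: "z \<in> \<phi> ` U"
  show "hol_at Y (f' \<circ> inv_into U \<phi>) z"
  proof (rule hol_at_cong[OF holomorphic_map_hol_at[OF X Y f hol_at_inv_chart[OF X U z]] _ z])
    show "open (\<phi> ` U)" by (rule complex_chart_open_image[OF riemann_surface_chart[OF X U]])
    fix w assume "w \<in> \<phi> ` U"
    then have "inv_into U \<phi> w \<in> points X" by (rule subsetD[OF riemann_surface_chart_subset[OF X U] inv_into_into])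
    then show "(f' \<circ> inv_into U \<phi>) w = (f \<circ> inv_into U \<phi>) w" using eq by simp
  qed
qed

lemma sphere_chart_parametrization:
  assumes "\<sigma> = (\<lambda>t. st t 1) \<or> \<sigma> = (\<lambda>t. st 1 t)"
  shows "\<And>t. hol_at riemann_sphere \<sigma> t" "\<And>t. \<sigma> t \<in> sphere 0 1"
    "\<And>B. open B \<Longrightarrow> openin (top_of_set (sphere 0 1)) (\<sigma> ` B)"
proof -
  show "hol_at riemann_sphere \<sigma> t" for t
    using assms by (elim disjE) (auto intro!: hol_at_st[where D = UNIV] holomorphic_intros)
  show "\<sigma> t \<in> sphere 0 1" for t using assms by (elim disjE) (auto simp: norm_st)
  have n: "(sphere 0 1 - {axis 3 1}, north_coordinate) \<in> atlas riemann_sphere" 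
    and s: "(sphere 0 1 - {- axis 3 1}, south_coordinate) \<in> atlas riemann_sphere" by simp_all
  have nU: "B \<subseteq> north_coordinate ` (sphere 0 1 - {axis 3 1})" for B
  proof
    fix z show "z \<in> north_coordinate ` (sphere 0 1 - {axis 3 1})"
      by (rule image_eqI[of _ _ "st z 1"]) (simp_all add: north_st norm_st st_eq_north_pole)
  qed
  have sU: "B \<subseteq> south_coordinate ` (sphere 0 1 - {- axis 3 1})" for B
  proof
    fix z show "z \<in> south_coordinate ` (sphere 0 1 - {- axis 3 1})"
      by (rule image_eqI[of _ _ "st 1 z"]) (simp_all add: south_st norm_st st_eq_south_pole)
  qed
  show "openin (top_of_set (sphere 0 1)) (\<sigma> ` B)" if "open B" for B
    using assms
  proof
    assume e: "\<sigma> = (\<lambda>t. st t 1)"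
    show ?thesis using chart_inv_ball_openin[OF riemann_surface_sphere n that nU] by (simp add: e inv_into_north[abs_def])
  next
    assume e: "\<sigma> = (\<lambda>t. st 1 t)"
    show ?thesis using chart_inv_ball_openin[OF riemann_surface_sphere s that sU] by (simp add: e inv_into_south[abs_def])
  qed
qed

text \<open>Along an open set of parameters \<open>g\<close> takes infinitely many values, so some
  value lies outside the finite set \<open>P\<close>, and over it \<open>f\<close> is
  unbranched.\<close>

lemma lift_generic_curve:
  assumes sub: "subject_to X riemann_sphere f P n" and P: "finite P" 
    and g: "branched_covering riemann_sphere riemann_sphere g"
    and \<sigma>: "\<sigma> = (\<lambda>t. st t 1) \<or> \<sigma> = (\<lambda>t. st 1 t)"
  shows "generic_curve X riemann_sphere f (\<lambda>t. g (\<sigma> t))"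
  unfolding generic_curve_def
proof (intro allI impI)
  fix B :: "complex set" assume B: "open B" "B \<noteq> {}"
  have "openin (carrier_top riemann_sphere) (g ` \<sigma> ` B)"
    using sphere_chart_parametrization(3)[OF \<sigma> B(1)] by (intro branched_covering_open_map[OF g]) simp
  then have "infinite (g ` \<sigma> ` B)" using B(2) by (intro infinite_openin_sphere) simp_all
  then have "g ` \<sigma> ` B - P \<noteq> {}" using P by (intro infinite_imp_nonempty Diff_infinite_finite)
  then obtain z where "z \<in> B" "g (\<sigma> z) \<notin> P" by blast
  then show "\<exists>z\<in>B. \<forall>x\<in>points X. f x = g (\<sigma> z) \<longrightarrow> branching_order X riemann_sphere f x = 1"
    using sub unfolding subject_to_def by metis
qed

text \<open>Over a point of the datum the stabilising rotation turns \<open>g\<close> into a power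
  whose exponent is the weight, and the branching orders of \<open>f\<close> divide it. Over any
  other point \<open>f\<close> is unbranched and exponent 1 serves, with the coordinate of
  \<open>g\<close> itself as the root.\<close>

lemma lift_liftable:
  assumes f: "branched_covering X riemann_sphere f" and sub: "subject_to X riemann_sphere f P n"
    and g: "branched_covering riemann_sphere riemann_sphere g"
    and root: "\<And>s. s \<in> sphere 0 1 \<Longrightarrow> g s \<in> P \<Longrightarrow> n (g s) \<ge> 1 \<and> 
      (\<exists>\<rho>. rotation \<rho> \<and> \<rho> s = s \<and> (\<forall>x\<in>sphere 0 1. g (\<rho> x) = g x) \<and> (\<forall>j. (\<forall>x\<in>sphere 0 1. (\<rho> ^^ j) x = x) \<longrightarrow> n (g s) dvd j))"
    and \<sigma>: "\<sigma> = (\<lambda>t. st t 1) \<or> \<sigma> = (\<lambda>t. st 1 t)"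
  shows "\<exists>e>0. liftable X f (\<lambda>t. g (\<sigma> t)) c e"
proof -
  note par = sphere_chart_parametrization[OF \<sigma>]
  let ?S = "riemann_sphere"
  let ?k = "\<lambda>t. g (\<sigma> t)"
  have k: "hol_at ?S ?k c" 
    using holomorphic_map_hol_at[OF riemann_surface_sphere riemann_surface_sphere branched_covering_rs(7)[OF g] par(1)] by (simp add: o_def)
  obtain V \<psi> where V: "(V, \<psi>) \<in> atlas ?S" "?k c \<in> V" 
    by (rule riemann_surface_cover[OF riemann_surface_sphere hol_at_points[OF riemann_surface_sphere k]]) (rule that)
  have fib: "branching_order X ?S f x dvd n (?k c)" if "x \<in> points X" "f x = ?k c" "?k c \<in> P" for x
    using sub that unfolding subject_to_def by metis
  have fib1: "branching_order X ?S f x dvd 1" if "x \<in> points X" "f x = ?k c" "?k c \<notin> P" for x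
    using sub that unfolding subject_to_def by simp
  show ?thesis
  proof (cases "?k c \<in> P")
    case True
    obtain \<rho> where \<rho>: "rotation \<rho>" "\<rho> (\<sigma> c) = \<sigma> c" "\<And>x. x \<in> sphere 0 1 \<Longrightarrow> g (\<rho> x) = g x"
      "\<And>j. (\<And>x. x \<in> sphere 0 1 \<Longrightarrow> (\<rho> ^^ j) x = x) \<Longrightarrow> n (?k c) dvd j" and n1: "n (?k c) \<ge> 1"
      using root[OF par(2) True] by blast
    obtain W \<theta> where W: "\<sigma> c \<in> W" "holomorphic_function ?S W \<theta>" 
        "\<And>x. x \<in> W \<Longrightarrow> g x \<in> V \<and> \<psi> (g x) - \<psi> (?k c) = \<theta> x ^ n (?k c)"
      by (rule rotation_invariant_root[OF g par(2) V \<rho>(1,2,3) n1 \<rho>(4)]) (assumption | rule that)+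
    obtain e where e: "e > 0" "\<sigma> ` ball c e \<subseteq> W" "(\<theta> \<circ> \<sigma>) holomorphic_on ball c e"
      using holomorphic_function_hol_at[OF riemann_surface_sphere W(2) par(1) W(1)] by blast
    show ?thesis
    proof (rule local_lift[OF f V k e(1,3) _ n1])
      show "g (\<sigma> z) \<in> V \<and> \<psi> (g (\<sigma> z)) - \<psi> (g (\<sigma> c)) = (\<theta> \<circ> \<sigma>) z ^ n (g (\<sigma> c))" if "z \<in> ball c e" for z
        using W(3)[OF subsetD[OF e(2) imageI[OF that]]] by simp
    qed (use fib True in blast)
  next
    case False
    have oV: "openin (carrier_top ?S) V" using riemann_surface_chart[OF riemann_surface_sphere V(1)] by (rule complex_chart_openin)
    obtain e where e: "e > 0" "?k ` ball c e \<subseteq> V \<inter> V" "(\<psi> \<circ> ?k) holomorphic_on ball c e"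
      using hol_at_chart[OF riemann_surface_sphere k V(1) oV V(2) V(2)] by blast
    have "(\<lambda>z. \<psi> (?k z) - \<psi> (?k c)) holomorphic_on ball c e" using e(3) unfolding o_def by (intro holomorphic_intros)
    then show ?thesis
    proof (rule local_lift[OF f V k e(1), where N = 1])
      show "g (\<sigma> z) \<in> V \<and> \<psi> (g (\<sigma> z)) - \<psi> (g (\<sigma> c)) = (\<psi> (g (\<sigma> z)) - \<psi> (g (\<sigma> c))) ^ 1" if "z \<in> ball c e" for z
        using e(2) that by auto
    qed (use fib1 False in auto)
  qed
qed

text \<open>The lift \<open>h\<close> identifies \<open>X\<close> with the quotient of the sphere by the subgroup of those elements of
  \<open>G\<close> that preserve \<open>h\<close>, because two lifts of \<open>g\<close> that agree at an unbranched point are equal.\<close>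

lemma quotient_of_sphere_biholomorphic:
  assumes f: "branched_covering X riemann_sphere f" and sub: "subject_to X riemann_sphere f P n" and P: "finite P"
    and g: "branched_covering riemann_sphere riemann_sphere g"
    and G: "rotation_group G" and fib: "\<And>x y. x \<in> sphere 0 1 \<Longrightarrow> y \<in> sphere 0 1 \<Longrightarrow> g x = g y \<longleftrightarrow> (\<exists>\<gamma>\<in>G. y = \<gamma> x)"
    and h: "holomorphic_map riemann_sphere X h" and fh: "\<And>x. x \<in> sphere 0 1 \<Longrightarrow> f (h x) = g x"
  shows "biholomorphic X riemann_sphere"
proof -
  let ?S = "sphere (0::real^3) 1"
  note * = rotation_groupD[OF G]
  note X = branched_covering_rs[OF f]
  note S = riemann_surface_sphere
  have "\<exists>x\<in>?S. \<exists>y\<in>?S. g x \<noteq> g y" using g by (simp add: branched_covering_def)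
  then have "\<exists>x\<in>?S. \<exists>y\<in>?S. h x \<noteq> h y" using fh by metis
  moreover have "compact_connected_riemann_surface X" using f by (simp add: branched_covering_def)
  ultimately have bh: "branched_covering riemann_sphere X h"
    unfolding branched_covering_def using compact_connected_sphere h by simp
  define H where "H = {\<gamma> \<in> G. \<forall>x\<in>?S. h (\<gamma> x) = h x}"
  have H: "rotation_group H"
    unfolding rotation_group_def H_def using * rotation_sphere by (auto intro: finite_subset)
  have unique: "h (\<gamma> x) = h x" if \<gamma>: "\<gamma> \<in> G" and x0: "x0 \<in> ?S" "x0 \<noteq> axis 3 1" "h (\<gamma> x0) = h x0" "g x0 \<notin> P" and x: "x \<in> ?S" for \<gamma> x0 x
  proof -
    have rg: "rotation \<gamma>" by (rule *(3)[OF \<gamma>])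
    have hg: "holomorphic_map riemann_sphere X (h \<circ> \<gamma>)"
      by (rule holomorphic_map_compose[OF S S X(1) rotation_holomorphic[OF rg] h])
    have ginv: "g (\<gamma> y) = g y" if "y \<in> ?S" for y using fib[OF that rotation_sphere[OF rg that]] \<gamma> by auto
    have l: "lift_on X f (\<lambda>t. g (\<sigma> t)) UNIV (\<lambda>t. h (\<sigma> t))" "lift_on X f (\<lambda>t. g (\<sigma> t)) UNIV (\<lambda>t. h (\<gamma> (\<sigma> t)))"
      if \<sigma>: "\<sigma> = (\<lambda>t. st t 1) \<or> \<sigma> = (\<lambda>t. st 1 t)" for \<sigma>
      using holomorphic_map_hol_at[OF S X(1) h sphere_chart_parametrization(1)[OF \<sigma>]] 
        holomorphic_map_hol_at[OF S X(1) hg sphere_chart_parametrization(1)[OF \<sigma>]] 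
        sphere_chart_parametrization(2)[OF \<sigma>] fh ginv rotation_sphere[OF rg]
      by (simp_all add: lift_on_def o_def rotation_norm[OF rg])
    define t0 where "t0 = north_coordinate x0"
    have t0: "st t0 1 = x0" using st_north x0 by (simp add: t0_def)
    have hx0: "h x0 \<in> points X" using h x0(1) by (simp add: holomorphic_map_def continuous_map_def Pi_iff)
    have b1: "branching_order X riemann_sphere f (h x0) = 1"
      using sub hx0 fh[OF x0(1)] x0(4) by (simp add: subject_to_def)
    have e1: "h (st t 1) = h (\<gamma> (st t 1))" for t
      by (rule lift_unique[OF f open_UNIV connected_UNIV l, of "\<lambda>t. st t 1" t0 t]) (use t0 x0(3) b1 in auto)
    have flip: "st 1 t = st (1 / t) 1" if "t \<noteq> 0" for t using st_scale[of t "1 / t" 1] that by simp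
    \<comment> \<open>The two curves overlap off t = 0, so \<open>e1\<close> already gives agreement
      there; the identity theorem adds the value at infinity.\<close>
    have e2: "h (st 1 t) = h (\<gamma> (st 1 t))" for t
      by (rule lift_identity[OF X(1) open_UNIV connected_UNIV l, of "\<lambda>t. st 1 t" "- {0}"]) (use flip e1 in auto)
    show ?thesis
    proof (cases "x = axis 3 1")
      case True
      then show ?thesis using e2[of 0] st_zero_right[of 1] by simp
    next
      case False
      then show ?thesis using e1[of "north_coordinate x"] st_north[OF x] by simp
    qed
  qed
  \<comment> \<open>\<open>unique\<close> starts from a point other than the north pole whose value
    lies outside \<open>P\<close>; these are the points of \<open>X\<close> to be avoided to make it
    applicable.\<close>
  let ?Z = "{v. f v \<in> insert (g (axis 3 1)) P}"
  have fibH: "h x = h y \<longleftrightarrow> (\<exists>\<gamma>\<in>H. y = \<gamma> x)" if xy: "x \<in> ?S" "y \<in> ?S" for x y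
  proof
    assume "\<exists>\<gamma>\<in>H. y = \<gamma> x" then show "h x = h y" using xy by (auto simp: H_def)
  next
    assume eq: "h x = h y"
    show "\<exists>\<gamma>\<in>H. y = \<gamma> x"
    proof (rule rotation_group_fibres[OF H bh _ _ xy eq, where Z = ?Z])
      fix x y assume xy: "x \<in> ?S" "y \<in> ?S" "h x = h y" "h x \<notin> ?Z"
      then have "g x = g y" using fh by metis
      then obtain \<gamma> where \<gamma>: "\<gamma> \<in> G" "y = \<gamma> x" using fib xy by blast
      have "g x \<notin> P" "x \<noteq> axis 3 1" using xy(4) fh[OF xy(1)] by auto
      then have "\<gamma> \<in> H" unfolding H_def using unique[OF \<gamma>(1) xy(1)] xy(3) \<gamma> by simp
      then show "\<exists>\<gamma>\<in>H. y = \<gamma> x" using \<gamma>(2) by blast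
    next
      fix W assume W: "openin (carrier_top X) W" "W \<noteq> {}"
      have "openin (carrier_top riemann_sphere) (f ` W)" by (rule branched_covering_open_map[OF f W(1)])
      then have "infinite (f ` W)" using W(2) by (intro infinite_openin_sphere) simp_all
      then have "f ` W - insert (g (axis 3 1)) P \<noteq> {}" using P by (intro infinite_imp_nonempty Diff_infinite_finite) simp_all
      then show "W - ?Z \<noteq> {}" by blast
    qed
  qed
  obtain R where R: "branched_covering riemann_sphere riemann_sphere R"
    "\<And>x y. x \<in> ?S \<Longrightarrow> y \<in> ?S \<Longrightarrow> R x = R y \<longleftrightarrow> (\<exists>g\<in>H. y = g x)"
    by (rule rotation_group_quotient[OF H]) (rule that)
  note bhs = branched_covering_rs[OF bh]
  have "quotient_map (carrier_top riemann_sphere) (carrier_top X) h"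
    by (rule T1_Spaces.continuous_imp_quotient_map[OF bhs(8,3,10) branched_covering_surj[OF bh]])
  then obtain F where "biholomorphism X riemann_sphere F"
  proof (rule quotient_biholomorphism[OF R(1)])
    show "h x = h y \<longleftrightarrow> R x = R y" if "x \<in> points riemann_sphere" "y \<in> points riemann_sphere" for x y
      using fibH[of x y] R(2)[of x y] that by simp
  qed (use riemann_surface_chart[OF X(1)] holomorphic_map_coordinate[OF S X(1) h] in blast)+
  then show ?thesis unfolding biholomorphic_def by blast
qed

text \<open>The interface to the concrete groups: finiteness, three points in different orbits, and,
  for each weight in use, a rotation fixing the corresponding point whose powers are trivial only
  for multiples of the weight. Three pairs are listed in every case because the Moebius
  transformation is determined by three points.\<close>

lemma dominated_by_rotation_group_quotient:
  assumes f: "branched_covering X riemann_sphere f" and sub: "subject_to X riemann_sphere f P n" and P: "P \<subseteq> {p1, p2, p3}"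
    and p: "p1 \<in> sphere 0 1" "p2 \<in> sphere 0 1" "p3 \<in> sphere 0 1" "p1 \<noteq> p2" "p1 \<noteq> p3" "p2 \<noteq> p3"
    and s: "s1 \<in> sphere 0 1" "s2 \<in> sphere 0 1" "s3 \<in> sphere 0 1" 
      "\<And>\<gamma>. \<gamma> \<in> G \<Longrightarrow> s2 \<noteq> \<gamma> s1" "\<And>\<gamma>. \<gamma> \<in> G \<Longrightarrow> s3 \<noteq> \<gamma> s1" "\<And>\<gamma>. \<gamma> \<in> G \<Longrightarrow> s3 \<noteq> \<gamma> s2"
    and G: "rotation_group G" 
    and stab: "\<And>p s. (p, s) \<in> {(p1, s1), (p2, s2), (p3, s3)} \<Longrightarrow> p \<in> P \<Longrightarrow> n p \<ge> 1 \<and>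
      (\<exists>\<rho>\<in>G. \<rho> s = s \<and> (\<forall>j. (\<forall>x\<in>sphere 0 1. (\<rho> ^^ j) x = x) \<longrightarrow> n p dvd j))"
  shows "biholomorphic X riemann_sphere \<and>
     (\<exists>F. biholomorphism (quotient_surface riemann_sphere G) riemann_sphere F \<and>
          dominates riemann_sphere X riemann_sphere (F \<circ> orbit G) f)"
proof -
  let ?S = "sphere (0::real^3) 1"
  note * = rotation_groupD[OF G]
  note X = branched_covering_rs[OF f]
  note S = riemann_surface_sphere
  obtain R where R: "branched_covering riemann_sphere riemann_sphere R"
    "\<And>x y. x \<in> ?S \<Longrightarrow> y \<in> ?S \<Longrightarrow> R x = R y \<longleftrightarrow> (\<exists>g\<in>G. y = g x)"
    by (rule rotation_group_quotient[OF G]) (rule that)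
  have RS: "R x \<in> ?S" if "x \<in> ?S" for x using branched_covering_surj[OF R(1)] that by auto
  have Rs: "R s1 \<noteq> R s2" "R s1 \<noteq> R s3" "R s2 \<noteq> R s3" using R(2) s by blast+
  obtain M where M: "holomorphic_map riemann_sphere riemann_sphere M" "inj_on M ?S"
    "M (R s1) = p1" "M (R s2) = p2" "M (R s3) = p3"
    by (rule moebius_three_transitive[OF RS[OF s(1)] RS[OF s(2)] RS[OF s(3)] Rs p]) (rule that)
  define g where "g = M \<circ> R"
  have fib: "g x = g y \<longleftrightarrow> (\<exists>\<gamma>\<in>G. y = \<gamma> x)" if "x \<in> ?S" "y \<in> ?S" for x y
    using R(2)[OF that] inj_on_eq_iff[OF M(2) RS[OF that(1)] RS[OF that(2)]] by (simp add: g_def)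
  have holg: "holomorphic_map riemann_sphere riemann_sphere g" unfolding g_def
    by (rule holomorphic_map_compose[OF S S S branched_covering_rs(7)[OF R(1)] M(1)])
  have "g s1 \<noteq> g s2" using M(3,4) p(4) by (simp add: g_def)
  then have "\<exists>x\<in>?S. \<exists>y\<in>?S. g x \<noteq> g y" using s(1,2) by blast
  then have g: "branched_covering riemann_sphere riemann_sphere g"
    unfolding branched_covering_def using compact_connected_sphere holg by simp
  have root: "n (g s) \<ge> 1 \<and> 
      (\<exists>\<rho>. rotation \<rho> \<and> \<rho> s = s \<and> (\<forall>x\<in>?S. g (\<rho> x) = g x) \<and> (\<forall>j. (\<forall>x\<in>?S. (\<rho> ^^ j) x = x) \<longrightarrow> n (g s) dvd j))"
    if s': "s \<in> ?S" "g s \<in> P" for s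
  proof -
    obtain t where t: "(g s, t) \<in> {(p1, s1), (p2, s2), (p3, s3)}" using s'(2) P by blast
    then have tS: "t \<in> ?S" "g t = g s" using s M by (auto simp: g_def)
    then obtain \<gamma> where \<gamma>: "\<gamma> \<in> G" "s = \<gamma> t" using fib[OF tS(1) s'(1)] by blast
    obtain \<delta> where \<delta>: "\<delta> \<in> G" "\<gamma> \<circ> \<delta> = id" "\<delta> \<circ> \<gamma> = id" using rotation_group_inverse[OF G \<gamma>(1)] .
    have dg: "\<delta> (\<gamma> x) = x" for x using \<delta>(3) by (metis comp_apply id_apply)
    obtain \<rho> where \<rho>: "\<rho> \<in> G" "\<rho> t = t" "\<And>j. (\<forall>x\<in>?S. (\<rho> ^^ j) x = x) \<Longrightarrow> n (g s) dvd j" and n1: "n (g s) \<ge> 1"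
      using stab[OF t s'(2)] by blast
    \<comment> \<open>The stabilising rotation is given at the representative t only; at another
      point of its orbit the conjugate does the same job.\<close>
    let ?r = "\<gamma> \<circ> \<rho> \<circ> \<delta>"
    have rG: "?r \<in> G" using *(4) \<gamma>(1) \<rho>(1) \<delta>(1) by blast
    have pow: "(?r ^^ j) (\<gamma> x) = \<gamma> ((\<rho> ^^ j) x)" for j x by (induction j) (simp_all add: dg)
    have "n (g s) dvd j" if j: "\<forall>x\<in>?S. (?r ^^ j) x = x" for j
    proof (rule \<rho>(3), rule ballI)
      fix x :: "real^3" assume "x \<in> ?S"
      then have "\<gamma> x \<in> ?S" by (rule rotation_sphere[OF *(3)[OF \<gamma>(1)]])
      then have "\<gamma> ((\<rho> ^^ j) x) = \<gamma> x" using j pow by metis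
      then show "(\<rho> ^^ j) x = x" using dg by metis
    qed
    moreover have "g (?r x) = g x" if "x \<in> ?S" for x
      using fib[OF that rotation_sphere[OF *(3)[OF rG] that]] rG by metis
    moreover have "?r s = s" using \<gamma>(2) dg \<rho>(2) by simp
    ultimately show ?thesis using n1 *(3)[OF rG] by blast
  qed
  have finP: "finite P" using P finite_subset by blast
  obtain h where h: "holomorphic_map riemann_sphere X h" "\<And>x. x \<in> ?S \<Longrightarrow> f (h x) = g x"
  proof (rule lift_sphere[OF f holg])
    show "generic_curve X riemann_sphere f (\<lambda>t. g (st t 1))" "generic_curve X riemann_sphere f (\<lambda>t. g (st 1 t))"
      by (rule lift_generic_curve[OF sub finP g]; simp)+
    show "\<exists>e>0. liftable X f (\<lambda>t. g (st t 1)) c e" "\<exists>e>0. liftable X f (\<lambda>t. g (st 1 t)) c e" for c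
      by (rule lift_liftable[OF f sub g root]; simp)+
  qed (rule that)
  have 1: "biholomorphic X riemann_sphere"
    by (rule quotient_of_sphere_biholomorphic[OF f sub finP g G fib h])
  have qc: "carrier_top (quotient_surface riemann_sphere G) = quotient_topology (top_of_set ?S) (orbit G)"
    by (simp add: quotient_surface_def Let_def)
  have quot: "quotient_map (carrier_top riemann_sphere) (carrier_top (quotient_surface riemann_sphere G)) (orbit G)"
    unfolding qc using quotient_map_quotient_topology[of "top_of_set ?S" "orbit G"] by simp
  obtain F where F: "biholomorphism (quotient_surface riemann_sphere G) riemann_sphere F" 
      "\<And>x. x \<in> points riemann_sphere \<Longrightarrow> F (orbit G x) = g x"
  proof (rule quotient_biholomorphism[OF g quot])
    show "orbit G x = orbit G y \<longleftrightarrow> g x = g y" if "x \<in> points riemann_sphere" "y \<in> points riemann_sphere" for x y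
      using orbit_eq_iff[OF G] fib[of x y] that by simp
    fix V \<phi> assume "(V, \<phi>) \<in> atlas (quotient_surface riemann_sphere G)"
    then show "complex_chart (carrier_top (quotient_surface riemann_sphere G)) V \<phi>"
      "holomorphic_function riemann_sphere {x \<in> points riemann_sphere. orbit G x \<in> V} (\<phi> \<circ> orbit G)"
      unfolding quotient_surface_def Let_def by simp_all
  qed (rule that)
  have Fg: "(F \<circ> orbit G) x = g x" if "x \<in> ?S" for x using F(2)[of x] that by simp
  have "holomorphic_map riemann_sphere riemann_sphere (F \<circ> orbit G)"
    by (rule holomorphic_map_cong[OF S S holg]) (use Fg in simp)
  moreover have "\<exists>x\<in>?S. \<exists>y\<in>?S. (F \<circ> orbit G) x \<noteq> (F \<circ> orbit G) y"
    using \<open>\<exists>x\<in>?S. \<exists>y\<in>?S. g x \<noteq> g y\<close> Fg by metis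
  ultimately have "branched_covering riemann_sphere riemann_sphere (F \<circ> orbit G)"
    unfolding branched_covering_def using compact_connected_sphere by simp
  then have "dominates riemann_sphere X riemann_sphere (F \<circ> orbit G) f"
    unfolding dominates_def using f h Fg by auto
  then show ?thesis using 1 F(1) by blast
qed


section \<open>Cyclic and dihedral groups\<close>


unbundle no cross3_syntax

lemma vector3_components [simp]:
  "(vector [a, b, c] :: real^3) $ 1 = a" "(vector [a, b, c] :: real^3) $ 2 = b" "(vector [a, b, c] :: real^3) $ 3 = c"
  by simp_all

lemma axis_components3 [simp]: 
  "(axis 1 1 :: real^3) $ 1 = 1" "(axis 1 1 :: real^3) $ 2 = 0" "(axis 1 1 :: real^3) $ 3 = 0"
  "(axis 2 1 :: real^3) $ 1 = 0" "(axis 2 1 :: real^3) $ 2 = 1" "(axis 2 1 :: real^3) $ 3 = 0"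
  by (auto simp: axis_def)

lemma norm3: "norm (x::real^3) = sqrt ((x $ 1)\<^sup>2 + (x $ 2)\<^sup>2 + (x $ 3)\<^sup>2)"
  by (simp add: norm_eq_sqrt_inner inner3 power2_eq_square)

lemma in_sphere3_iff: "r \<ge> 0 \<Longrightarrow> (x::real^3) \<in> sphere 0 r \<longleftrightarrow> (x $ 1)\<^sup>2 + (x $ 2)\<^sup>2 + (x $ 3)\<^sup>2 = r\<^sup>2"
proof -
  assume r: "r \<ge> 0"
  have "(norm x)\<^sup>2 = (x $ 1)\<^sup>2 + (x $ 2)\<^sup>2 + (x $ 3)\<^sup>2"
    unfolding power2_norm_eq_inner inner3 by (simp add: power2_eq_square)
  then show ?thesis using power2_eq_iff_nonneg[of "norm x" r] r by simp
qed

section \<open>Orders of rotations\<close>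

lemma funpow_fixpoint: "f x = x \<Longrightarrow> (f ^^ a) x = x"
  by (induction a) simp_all

lemma funpow_fixed_mod:
  assumes "\<And>x. (\<rho> ^^ n) x = x"
  shows "(\<rho> ^^ j) x = (\<rho> ^^ (j mod n)) x"
proof -
  have "(\<rho> ^^ j) x = (\<rho> ^^ (j mod n + n * (j div n))) x" by simp
  also have "\<dots> = (\<rho> ^^ (j mod n)) (((\<rho> ^^ n) ^^ (j div n)) x)" by (simp only: funpow_add funpow_mult comp_apply)
  also have "\<dots> = (\<rho> ^^ (j mod n)) x" using funpow_fixpoint[where f = "\<rho> ^^ n" and x = x, OF assms] by simp
  finally show ?thesis .
qed

lemma rotation_order_dvd:
  fixes \<rho> :: "real^3 \<Rightarrow> real^3"
  assumes n: "n > 0" "\<And>x. (\<rho> ^^ n) x = x" and x: "x \<in> sphere 0 1" "\<And>q. 0 < q \<Longrightarrow> q < n \<Longrightarrow> (\<rho> ^^ q) x \<noteq> x"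
    and j: "\<forall>x\<in>sphere 0 1. (\<rho> ^^ j) x = x"
  shows "n dvd j"
proof (rule ccontr)
  assume "\<not> n dvd j"
  then have "0 < j mod n" "j mod n < n" using n(1) by (simp_all add: mod_greater_zero_iff_not_dvd)
  then show False using x(2) funpow_fixed_mod[OF n(2), where j = j and x = x] bspec[OF j x(1)] by metis
qed

text \<open>For prime n it is enough that a single point is moved once: were j prime to n, Bezout
  would express the rotation itself through its j-th and n-th powers, both of which fix x.\<close>

lemma rotation_prime_order_dvd:
  fixes \<rho> :: "real^3 \<Rightarrow> real^3"
  assumes n: "prime n" "\<And>x. (\<rho> ^^ n) x = x" and x: "x \<in> sphere 0 1" "\<rho> x \<noteq> x"
    and j: "\<forall>x\<in>sphere 0 1. (\<rho> ^^ j) x = x"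
  shows "n dvd j"
proof (rule ccontr)
  assume nd: "\<not> n dvd j"
  then have "coprime n j" using prime_imp_coprime[OF n(1)] by blast
  moreover have "j \<noteq> 0" using nd by (cases "j = 0") simp_all
  ultimately obtain a b where ab: "j * a = n * b + 1" using bezout_nat[of j n] by (auto simp: coprime_iff_gcd_eq_1 gcd.commute)
  have "(\<rho> ^^ (j * a)) x = x" using funpow_fixpoint[of "\<rho> ^^ j" x a] bspec[OF j x(1)] by (simp only: funpow_mult)
  moreover have "(\<rho> ^^ (j * a)) x = (\<rho> ^^ (1 + n * b)) x" by (simp only: ab add.commute)
  moreover have "(\<rho> ^^ (n * b)) x = x" using funpow_fixpoint[of "\<rho> ^^ n" x b] n(2) by (simp only: funpow_mult)
  ultimately show False using x(2) by simp
qed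

text \<open>The images of two independent vectors determine a rotation, which embeds
  \<open>G\<close> into a finite set of pairs.\<close>

lemma finite_rotations:
  assumes E: "finite E" and G: "\<And>g. g \<in> G \<Longrightarrow> rotation g \<and> g u \<in> E \<and> g w \<in> E" and uw: "cross3 u w \<noteq> 0"
  shows "finite G"
proof (rule finite_imageD)
  have "(\<lambda>g. (g u, g w)) ` G \<subseteq> E \<times> E" using G by auto
  then show "finite ((\<lambda>g. (g u, g w)) ` G)" using E finite_subset by blast
  show "inj_on (\<lambda>g. (g u, g w)) G" by (rule inj_onI) (use rotation_eqI[OF _ _ _ _ uw] G in auto)
qed

section \<open>Symmetry groups of convex hulls of points on a sphere\<close>

lemma rotational_symmetries_id: "id \<in> rotational_symmetries P"
  by (simp add: rotational_symmetries_def rotation_id)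

lemma rotational_symmetries_compose: 
  "g \<in> rotational_symmetries P \<Longrightarrow> h \<in> rotational_symmetries P \<Longrightarrow> g \<circ> h \<in> rotational_symmetries P"
proof -
  assume "g \<in> rotational_symmetries P" "h \<in> rotational_symmetries P"
  then have *: "rotation g" "rotation h" "g ` P = P" "h ` P = P" by (simp_all add: rotational_symmetries_def)
  have "(g \<circ> h) ` P = P" unfolding image_comp[symmetric] *(3,4) ..
  then show ?thesis using rotation_compose[OF *(1,2)] by (simp add: rotational_symmetries_def)
qed

text \<open>For x on the sphere outside \<open>V\<close>, all of \<open>V\<close> lies in the open
  half-space \<open>x \<bullet> y < R\<^sup>2\<close>, hence so does its hull, but x does not.
  Consequently a symmetry of the hull permutes the vertices.\<close>

lemma convex_hull_Int_sphere:
  fixes V :: "(real^3) set"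
  assumes V: "V \<subseteq> sphere 0 R" and x: "x \<in> convex hull V" "x \<in> sphere 0 R"
  shows "x \<in> V"
proof (rule ccontr)
  assume nx: "x \<notin> V"
  have "V \<subseteq> {y. x \<bullet> y < R\<^sup>2}"
  proof
    fix v assume v: "v \<in> V"
    then have "0 < (x - v) \<bullet> (x - v)" using nx by auto
    moreover have "x \<bullet> x = R\<^sup>2" "v \<bullet> v = R\<^sup>2" using x(2) v V by (auto simp: dot_square_norm)
    ultimately show "v \<in> {y. x \<bullet> y < R\<^sup>2}" by (simp add: inner_diff_left inner_diff_right inner_commute)
  qed
  then have "convex hull V \<subseteq> {y. x \<bullet> y < R\<^sup>2}" by (rule hull_minimal) (rule convex_halfspace_lt)
  then have "x \<bullet> x < R\<^sup>2" using x(1) by blast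
  then show False using x(2) by (simp add: dot_square_norm)
qed

lemma rotational_symmetry_vertices:
  assumes V: "V \<subseteq> sphere 0 R" "finite V" and g: "g \<in> rotational_symmetries (convex hull V)"
  shows "g ` V = V"
proof (rule endo_inj_surj[OF V(2)])
  have r: "rotation g" "g ` (convex hull V) = convex hull V" using g by (auto simp: rotational_symmetries_def)
  show "inj_on g V" by (rule inj_on_subset[OF rotation_inj[OF r(1)] subset_UNIV])
  show "g ` V \<subseteq> V"
  proof
    fix x assume "x \<in> g ` V"
    then obtain v where v: "v \<in> V" "x = g v" by blast
    have "v \<in> convex hull V" using v(1) by (rule hull_inc)
    then have "g v \<in> g ` (convex hull V)" by (rule imageI)
    then have "x \<in> convex hull V" using r(2) v(2) by simp
    moreover have "x \<in> sphere 0 R" using v V(1) by (auto simp: rotation_norm[OF r(1)])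
    ultimately show "x \<in> V" by (rule convex_hull_Int_sphere[OF V(1)])
  qed
qed

lemma rotational_symmetryI:
  assumes V: "finite V" and g: "rotation g" "g ` V \<subseteq> V"
  shows "g \<in> rotational_symmetries (convex hull V)"
proof -
  have "g ` V = V" by (rule endo_inj_surj[OF V g(2)]) (rule inj_on_subset[OF rotation_inj[OF g(1)] subset_UNIV])
  then have "g ` (convex hull V) = convex hull V" using convex_hull_linear_image[OF rotation_linear[OF g(1)], of V] by simp
  then show ?thesis using g(1) by (simp add: rotational_symmetries_def)
qed

lemma polyhedral_rotation_group:
  assumes V: "V \<subseteq> sphere 0 R" "finite V" and uw: "u \<in> V" "w \<in> V" "cross3 u w \<noteq> 0"
  shows "rotation_group (rotational_symmetries (convex hull V))"
proof -
  let ?G = "rotational_symmetries (convex hull V)"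
  have "finite ?G"
  proof (rule finite_rotations[OF V(2) _ uw(3)])
    fix g assume g: "g \<in> ?G"
    then show "rotation g \<and> g u \<in> V \<and> g w \<in> V" 
      using rotational_symmetry_vertices[OF V g] uw(1,2) by (auto simp: rotational_symmetries_def)
  qed
  then show ?thesis
    unfolding rotation_group_def using rotational_symmetries_id rotational_symmetries_compose
    by (auto simp: rotational_symmetries_def)
qed

section \<open>Rotations about the vertical axis and the cyclic groups\<close>

abbreviation rz :: "real \<Rightarrow> real^3 \<Rightarrow> real^3" where "rz \<equiv> axis_rotation (axis 3 1)"

lemma rz_components [simp]:
  "rz t x $ 1 = cos t * x $ 1 - sin t * x $ 2" "rz t x $ 2 = sin t * x $ 1 + cos t * x $ 2" "rz t x $ 3 = x $ 3"
  by (simp_all add: axis_rotation_def cross_components inner3 algebra_simps)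

lemma rotation_rz: "rotation (rz t)"
  unfolding rotation_iff
proof (intro conjI allI)
  have sc: "sin t * sin t + cos t * cos t = 1" using sin_cos_squared_add[of t] by (simp add: power2_eq_square)
  show "linear (rz t)" by (rule linearI) (simp_all add: vec3_eq_iff algebra_simps)
  show "rz t x \<bullet> rz t y = x \<bullet> y" for x y 
    unfolding inner3 rz_components using sc by algebra
  have sc2: "cos t * (cos t * z) + sin t * (sin t * z) = z" for z
  proof -
    have "cos t * (cos t * z) + sin t * (sin t * z) = (sin t * sin t + cos t * cos t) * z" by (simp only: distrib_right mult.assoc add.commute)
    also have "\<dots> = z" by (simp only: sc mult_1)
    finally show ?thesis .
  qed
  show "cross3 (rz t x) (rz t y) = rz t (cross3 x y)" for x y
    unfolding vec3_eq_iff cross_components rz_components by (simp add: algebra_simps sc2)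
qed

lemma rz_add: "rz s (rz t x) = rz (s + t) x"
  by (simp add: vec3_eq_iff cos_add sin_add algebra_simps)

lemma rz_full_turn: "rz (2 * pi * of_int i) = id"
proof
  fix x
  have "cos (2 * pi * of_int i) = 1" "sin (2 * pi * of_int i) = 0" by (rule cos_int_2pin sin_int_2pin)+
  then show "rz (2 * pi * of_int i) x = id x" by (simp add: vec3_eq_iff)
qed

lemma rz_pow: "(rz t ^^ j) x = rz (real j * t) x"
  using rz_full_turn[of 0] by (induction j) (simp_all add: rz_add algebra_simps)

text \<open>Indices are taken from the integers and reduced modulo m, so sums and negatives of
  indices stay admissible in the cyclic group and among the polygon vertices.\<close>

lemma rz_div_mod:
  assumes "m > 0"
  shows "rz (2 * pi * real_of_int i / real m) = rz (2 * pi * real (nat (i mod int m)) / real m)"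
proof
  fix x
  have "nat (i mod int m) = i mod int m" using assms by simp
  then have "real (nat (i mod int m)) = real_of_int (i mod int m)" by (metis of_int_of_nat_eq)
  moreover have "real_of_int i = real_of_int (i mod int m) + real m * real_of_int (i div int m)"
    by (metis mod_mult_div_eq of_int_add of_int_mult of_int_of_nat_eq)
  ultimately have "2 * pi * real_of_int i / real m = 2 * pi * real (nat (i mod int m)) / real m + 2 * pi * of_int (i div int m)"
    using assms by (simp add: field_simps)
  then show "rz (2 * pi * real_of_int i / real m) x = rz (2 * pi * real (nat (i mod int m)) / real m) x"
    using rz_full_turn[of "i div int m"] by (simp flip: rz_add)
qed

lemma rz_order_dvd:
  assumes m: "m > 0" and j: "\<forall>x\<in>sphere 0 1. (rz (2 * pi / real m) ^^ j) x = x"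
  shows "m dvd j"
proof -
  have "(rz (2 * pi / real m) ^^ j) (axis 1 1) $ 1 = 1" using j by simp
  then have "cos (real j * (2 * pi / real m)) = 1" by (simp add: rz_pow)
  then obtain i :: int where "real j * (2 * pi / real m) = of_int i * 2 * pi" unfolding cos_one_2pi_int by blast
  then have "real j = of_int i * real m" using m by (simp add: field_simps)
  then have "of_int (int j) = (of_int (i * int m) :: real)" by simp
  then have "int j = i * int m" unfolding of_int_eq_iff .
  then have "int m dvd int j" by simp
  then show ?thesis by (simp only: int_dvd_int_iff)
qed

definition cyclic_rotations :: "nat \<Rightarrow> (real^3 \<Rightarrow> real^3) set" where
  "cyclic_rotations m = {rz (2 * pi * real k / real m) |k. k < m}"

lemma cyclic_rotationsI: "m > 0 \<Longrightarrow> rz (2 * pi * real_of_int i / real m) \<in> cyclic_rotations m"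
  unfolding cyclic_rotations_def using rz_div_mod[of m i] by (auto intro!: exI[of _ "nat (i mod int m)"] simp: nat_less_iff)

lemma rotation_group_cyclic:
  assumes m: "m > 0"
  shows "rotation_group (cyclic_rotations m)"
  unfolding rotation_group_def
proof (intro conjI ballI)
  show "finite (cyclic_rotations m)" unfolding cyclic_rotations_def by simp
  show "id \<in> cyclic_rotations m" using cyclic_rotationsI[OF m, of 0] rz_full_turn[of 0] by simp
  show "rotation g" if "g \<in> cyclic_rotations m" for g using that rotation_rz by (auto simp: cyclic_rotations_def)
  fix g h assume "g \<in> cyclic_rotations m" "h \<in> cyclic_rotations m"
  then obtain k l where "g = rz (2 * pi * real k / real m)" "h = rz (2 * pi * real l / real m)"
    by (auto simp: cyclic_rotations_def)
  then have "g \<circ> h = rz (2 * pi * real_of_int (int (k + l)) / real m)"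
    by (simp add: fun_eq_iff rz_add add_divide_distrib algebra_simps)
  then show "g \<circ> h \<in> cyclic_rotations m" using cyclic_rotationsI[OF m, of "int (k + l)"] by simp
qed

section \<open>Regular polygons and the dihedral groups\<close>

definition vz :: "real \<Rightarrow> real^3" where "vz t = cos t *\<^sub>R axis 1 1 + sin t *\<^sub>R axis 2 1"

lemma vz_components [simp]: "vz t $ 1 = cos t" "vz t $ 2 = sin t" "vz t $ 3 = 0"
  by (simp_all add: vz_def)

lemma rz_vz: "rz s (vz t) = vz (s + t)"
  by (simp add: vec3_eq_iff cos_add sin_add algebra_simps)

lemma xflip_vz: "xflip (vz t) = vz (- t)"
  by (simp add: vec3_eq_iff)

lemma rotation_xflip: "rotation xflip"
  unfolding rotation_iff
proof (intro conjI allI)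
  show "linear xflip" by (rule linearI) (simp_all add: vec3_eq_iff)
qed (simp_all add: inner3 vec3_eq_iff cross_components algebra_simps)

lemma vz_in_sphere: "vz t \<in> sphere 0 1"
  unfolding sphere3_iff by simp

lemma vz_eq_iff: "vz s = vz t \<longleftrightarrow> (\<exists>i::int. s = t + 2 * pi * i)"
  using sin_cos_eq_iff[of s t] by (auto simp: vec3_eq_iff)

definition polygon_vertices :: "nat \<Rightarrow> (real^3) set" where
  "polygon_vertices m = {vz (2 * pi * real k / real m) |k. k < m}"

definition dihedral_rotations :: "nat \<Rightarrow> (real^3 \<Rightarrow> real^3) set" where
  "dihedral_rotations m = rotational_symmetries (convex hull (polygon_vertices m)) \<inter> rotational_symmetries (range vz)"

lemma polygon_verticesI: assumes "m > 0" shows "vz (2 * pi * real_of_int i / real m) \<in> polygon_vertices m"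
proof -
  have "vz t = rz t (vz 0)" for t by (simp add: rz_vz)
  then have "vz (2 * pi * real_of_int i / real m) = vz (2 * pi * real (nat (i mod int m)) / real m)"
    using rz_div_mod[OF assms, of i] by metis
  then show ?thesis unfolding polygon_vertices_def using assms by (auto intro!: exI[of _ "nat (i mod int m)"] simp: nat_less_iff)
qed

lemma finite_polygon_vertices: "finite (polygon_vertices m)"
  and polygon_vertices_sphere: "polygon_vertices m \<subseteq> sphere 0 1"
  using vz_in_sphere by (auto simp: polygon_vertices_def)

lemma dihedral_rotationsI:
  assumes m: "m > 0" and g: "rotation g" "\<And>i::int. \<exists>j::int. g (vz (2 * pi * real_of_int i / real m)) = vz (2 * pi * real_of_int j / real m)"
    and C: "\<And>t. g (vz t) \<in> range vz" "\<And>t. vz t \<in> g ` range vz"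
  shows "g \<in> dihedral_rotations m"
proof -
  have "g ` polygon_vertices m \<subseteq> polygon_vertices m"
  proof
    fix x assume "x \<in> g ` polygon_vertices m"
    then obtain k where "x = g (vz (2 * pi * real k / real m))" by (auto simp: polygon_vertices_def)
    then show "x \<in> polygon_vertices m" using g(2)[of "int k"] polygon_verticesI[OF m] by auto
  qed
  then have "g \<in> rotational_symmetries (convex hull (polygon_vertices m))"
    by (rule rotational_symmetryI[OF finite_polygon_vertices g(1)])
  moreover have "g ` range vz = range vz" using C by auto
  ultimately show ?thesis using g(1) by (simp add: dihedral_rotations_def rotational_symmetries_def)
qed

lemma dihedral_rotations_rz: assumes m: "m > 0" shows "rz (2 * pi / real m) \<in> dihedral_rotations m"
proof (rule dihedral_rotationsI[OF m rotation_rz])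
  show "\<exists>j::int. rz (2 * pi / real m) (vz (2 * pi * real_of_int i / real m)) = vz (2 * pi * real_of_int j / real m)" for i
    by (rule exI[of _ "i + 1"]) (simp add: rz_vz add_divide_distrib algebra_simps)
  show "vz t \<in> rz (2 * pi / real m) ` range vz" for t
    by (rule image_eqI[of _ _ "vz (t - 2 * pi / real m)"]) (simp_all add: rz_vz)
qed (simp add: rz_vz)

lemma dihedral_rotations_xflip: assumes m: "m > 0" shows "xflip \<in> dihedral_rotations m"
proof (rule dihedral_rotationsI[OF m rotation_xflip])
  show "\<exists>j::int. xflip (vz (2 * pi * real_of_int i / real m)) = vz (2 * pi * real_of_int j / real m)" for i
    by (rule exI[of _ "- i"]) (simp add: xflip_vz)
  show "vz t \<in> xflip ` range vz" for t by (rule image_eqI[of _ _ "vz (- t)"]) (simp_all add: xflip_vz)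
qed (simp add: xflip_vz)

lemma dihedral_rotationsD:
  fixes g :: "real^3 \<Rightarrow> real^3"
  assumes "g \<in> dihedral_rotations m"
  shows "rotation g" "g ` polygon_vertices m = polygon_vertices m" "g (vz t) $ 3 = 0" "g (axis 3 1) \<in> {axis 3 1, - axis 3 1}"
proof -
  show r: "rotation g" using assms by (simp add: dihedral_rotations_def rotational_symmetries_def)
  show "g ` polygon_vertices m = polygon_vertices m"
    using assms by (intro rotational_symmetry_vertices[OF polygon_vertices_sphere finite_polygon_vertices]) (simp add: dihedral_rotations_def)
  have C: "g (vz t) $ 3 = 0" for t
  proof -
    have "g (vz t) \<in> range vz" using assms by (auto simp: dihedral_rotations_def rotational_symmetries_def)
    then show ?thesis by auto
  qed
  then show "g (vz t) $ 3 = 0" .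
  \<comment> \<open>The pole is the cross product of two points of the big circle. As a symmetry
    keeps the circle in the horizontal plane, the image of the pole is a cross product of horizontal
    vectors, hence vertical.\<close>
  have e3: "axis 3 1 = cross3 (vz 0) (vz (pi / 2))" by (simp add: vec3_eq_iff cross_components)
  have "g (axis 3 1) = cross3 (g (vz 0)) (g (vz (pi / 2)))" unfolding e3 rotation_cross[OF r] ..
  then have z: "g (axis 3 1) $ 1 = 0" "g (axis 3 1) $ 2 = 0" by (simp_all add: cross_components C)
  have "g (axis 3 1) \<in> sphere 0 1" by (rule rotation_sphere[OF r]) simp
  then have "(g (axis 3 1) $ 3)\<^sup>2 = 1" unfolding sphere3_iff z by simp
  then have "g (axis 3 1) $ 3 = 1 \<or> g (axis 3 1) $ 3 = - 1" by (simp add: power2_eq_1_iff)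
  then show "g (axis 3 1) \<in> {axis 3 1, - axis 3 1}" using z by (auto simp: vec3_eq_iff)
qed

lemma rotation_group_dihedral:
  assumes m: "m > 0"
  shows "rotation_group (dihedral_rotations m)"
proof -
  have "finite (dihedral_rotations m)"
  proof (rule finite_rotations)
    \<comment> \<open>For m = 2 the vertices are antipodal and do not determine a rotation, so the
      poles are added to obtain two independent directions.\<close>
    show "finite (polygon_vertices m \<union> {axis 3 1, - axis 3 1})" using finite_polygon_vertices by simp
    show "cross3 (vz 0) (axis 3 1) \<noteq> 0" by (simp add: vec3_eq_iff cross_components)
    fix g assume g: "g \<in> dihedral_rotations m"
    have "vz 0 \<in> polygon_vertices m" using polygon_verticesI[OF m, of 0] by simp
    then show "rotation g \<and> g (vz 0) \<in> polygon_vertices m \<union> {axis 3 1, - axis 3 1} \<and> g (axis 3 1) \<in> polygon_vertices m \<union> {axis 3 1, - axis 3 1}"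
      using dihedral_rotationsD[OF g] by blast
  qed
  then show ?thesis
    unfolding rotation_group_def using dihedral_rotationsD(1) rotational_symmetries_id rotational_symmetries_compose
    by (auto simp: dihedral_rotations_def)
qed


section \<open>Polyhedral groups\<close>


text \<open>\<open>cyc\<close> is the third of a turn about (1, 1, 1), \<open>quarter\<close> and
  \<open>zflip\<close> are the quarter turn and the half-turn about the third axis, and
  \<open>swap\<close> is the half-turn about (1, 1, 0). They generate the stabilisers needed for the
  weights 3, 4 and 2.\<close>

definition cyc :: "real^3 \<Rightarrow> real^3" where "cyc x = vector [x $ 3, x $ 1, x $ 2]"
definition quarter :: "real^3 \<Rightarrow> real^3" where "quarter x = vector [- x $ 2, x $ 1, x $ 3]"
definition zflip :: "real^3 \<Rightarrow> real^3" where "zflip x = vector [- x $ 1, - x $ 2, x $ 3]"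
definition swap :: "real^3 \<Rightarrow> real^3" where "swap x = vector [x $ 2, x $ 1, - x $ 3]"

lemma cyc_components [simp]: "cyc x $ 1 = x $ 3" "cyc x $ 2 = x $ 1" "cyc x $ 3 = x $ 2"
  and quarter_components [simp]: "quarter x $ 1 = - x $ 2" "quarter x $ 2 = x $ 1" "quarter x $ 3 = x $ 3"
  and zflip_components [simp]: "zflip x $ 1 = - x $ 1" "zflip x $ 2 = - x $ 2" "zflip x $ 3 = x $ 3"
  and swap_components [simp]: "swap x $ 1 = x $ 2" "swap x $ 2 = x $ 1" "swap x $ 3 = - x $ 3"
  by (simp_all add: cyc_def quarter_def zflip_def swap_def)

lemma rotation_coordinates: "rotation cyc" "rotation quarter" "rotation zflip" "rotation swap"
  unfolding rotation_iff
  by (intro conjI allI linearI; simp add: inner3 vec3_eq_iff cross_components algebra_simps)+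

lemma funpow_coordinates:
  "(cyc ^^ 3) x = x" "(quarter ^^ 4) x = x" "(zflip ^^ 2) x = x" "(swap ^^ 2) x = x"
  by (simp_all add: numeral_eq_Suc vec3_eq_iff)

lemma cyc_order_dvd:
  assumes "\<forall>x\<in>sphere 0 1. (cyc ^^ j) x = x" shows "3 dvd j"
proof (rule rotation_prime_order_dvd[where \<rho> = cyc and x = "axis 1 1", OF _ _ _ _ assms])
  show "cyc (axis 1 1) \<noteq> axis 1 1" by (simp add: vec3_eq_iff)
qed (simp_all add: funpow_coordinates)

lemma quarter_order_dvd:
  assumes "\<forall>x\<in>sphere 0 1. (quarter ^^ j) x = x" shows "4 dvd j"
proof (rule rotation_order_dvd[where \<rho> = quarter and x = "axis 1 1", OF _ _ _ _ assms])
  fix q :: nat assume "0 < q" "q < 4"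
  then have "q = 1 \<or> q = 2 \<or> q = 3" by auto
  then show "(quarter ^^ q) (axis 1 1) \<noteq> axis 1 1" by (auto simp: numeral_eq_Suc vec3_eq_iff)
qed (simp_all add: funpow_coordinates)

lemma involution_order_dvd:
  fixes \<rho> :: "real^3 \<Rightarrow> real^3"
  assumes "\<And>x. \<rho> (\<rho> x) = x" "x \<in> sphere 0 1" "\<rho> x \<noteq> x" "\<forall>x\<in>sphere 0 1. (\<rho> ^^ j) x = x" 
  shows "2 dvd j"
  by (rule rotation_prime_order_dvd[where \<rho> = \<rho> and x = x, OF two_is_prime_nat _ assms(2,3,4)]) (simp add: assms(1) numeral_2_eq_2)

lemma zflip_order_dvd: "\<forall>x\<in>sphere 0 1. (zflip ^^ j) x = x \<Longrightarrow> 2 dvd j"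
  by (rule involution_order_dvd[of zflip "axis 1 1"]) (simp_all add: vec3_eq_iff)

lemma swap_order_dvd: "\<forall>x\<in>sphere 0 1. (swap ^^ j) x = x \<Longrightarrow> 2 dvd j"
  by (rule involution_order_dvd[of swap "axis 1 1"]) (simp_all add: vec3_eq_iff)

lemma xflip_order_dvd: "\<forall>x\<in>sphere 0 1. (xflip ^^ j) x = x \<Longrightarrow> 2 dvd j"
  by (rule involution_order_dvd[of xflip "axis 3 1"]) (simp_all add: vec3_eq_iff)

text \<open>Both lemmas separate the orbits of two directions under the symmetries of a polyhedron with
  vertex set \<open>V\<close>.\<close>

lemma vertex_direction_orbit:
  assumes g: "rotation g" "g ` V = V" and v: "v \<in> V" "v = R *\<^sub>R s" and s': "R *\<^sub>R s' \<notin> V"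
  shows "s' \<noteq> g s"
proof
  assume "s' = g s"
  then have "R *\<^sub>R s' = g v" using linear_cmul[OF rotation_linear[OF g(1)]] v(2) by simp
  then show False using v(1) g(2) s' by blast
qed

lemma orthogonal_vertex_orbit:
  assumes g: "rotation g" "g ` V = V" and v: "v \<in> V" "v \<bullet> s' = 0" and s: "\<And>w. w \<in> V \<Longrightarrow> w \<bullet> s \<noteq> 0"
  shows "s' \<noteq> g s"
proof
  assume e: "s' = g s"
  obtain w where w: "w \<in> V" "v = g w" using v(1) g(2) by blast
  then have "w \<bullet> s = 0" using v(2) e rotation_inner[OF g(1)] by simp
  then show False using s w(1) by blast
qed

definition diagonal :: "real^3" where "diagonal = (1 / sqrt 3) *\<^sub>R vector [1, 1, 1]"

lemma diagonal_components [simp]: "diagonal $ 1 = 1 / sqrt 3" "diagonal $ 2 = 1 / sqrt 3" "diagonal $ 3 = 1 / sqrt 3"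
  by (simp_all add: diagonal_def)

lemma diagonal_sphere: "diagonal \<in> sphere 0 1" "- diagonal \<in> sphere 0 1"
  unfolding sphere3_iff by (simp_all add: power_divide)

lemma cyc_diagonal: "cyc diagonal = diagonal" "cyc (- diagonal) = - diagonal"
  by (simp_all add: vec3_eq_iff)

section \<open>Vertex sets of the tetrahedron, cube and icosahedron, and a rotation of order
  five\<close>

definition tetrahedron_vertices :: "(real^3) set" where
  "tetrahedron_vertices = (\<lambda>x. (1 / sqrt 3) *\<^sub>R x) ` {vector [1, 1, 1], vector [1, - 1, - 1], vector [- 1, 1, - 1], vector [- 1, - 1, 1]}"

lemma tetrahedron_vertices_sphere: "tetrahedron_vertices \<subseteq> sphere 0 1"
proof
  fix x assume "x \<in> tetrahedron_vertices"
  then show "x \<in> sphere 0 1" unfolding sphere3_iff by (auto simp: tetrahedron_vertices_def power_divide)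
qed

lemma regular_tetrahedron_vertices: "regular_tetrahedron (convex hull tetrahedron_vertices)"
  unfolding regular_tetrahedron_def
proof (intro exI conjI)
  let ?A = "{vector [1, 1, 1], vector [1, - 1, - 1], vector [- 1, 1, - 1], vector [- 1, - 1, 1]} :: (real^3) set"
  have "card tetrahedron_vertices = card ?A"
    unfolding tetrahedron_vertices_def by (rule card_image) (simp add: inj_on_def)
  also have "card ?A = 4" by (simp add: vec3_eq_iff)
  finally show "card tetrahedron_vertices = 4" .
  \<comment> \<open>Two different vertices have opposite entries in exactly two coordinates, each
    contributing 4/3 to the squared distance.\<close>
  show "\<forall>x\<in>tetrahedron_vertices. \<forall>y\<in>tetrahedron_vertices. x \<noteq> y \<longrightarrow> dist x y = sqrt (8 / 3)"
    by (auto simp: tetrahedron_vertices_def dist_norm norm3 power_divide)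
qed (use tetrahedron_vertices_sphere in auto)

definition cube_vertices :: "(real^3) set" where
  "cube_vertices = {a *\<^sub>R axis 1 1 + b *\<^sub>R axis 2 1 + c *\<^sub>R axis 3 1 |a b c. a \<in> {1, - 1} \<and> b \<in> {1, - 1} \<and> c \<in> {1, - 1}}"

lemma cube_vertex_iff: "x \<in> cube_vertices \<longleftrightarrow> x $ 1 \<in> {1, - 1} \<and> x $ 2 \<in> {1, - 1} \<and> x $ 3 \<in> {1, - 1}"
proof
  assume r: "x $ 1 \<in> {1, - 1} \<and> x $ 2 \<in> {1, - 1} \<and> x $ 3 \<in> {1, - 1}"
  have "x = x $ 1 *\<^sub>R axis 1 1 + x $ 2 *\<^sub>R axis 2 1 + x $ 3 *\<^sub>R axis 3 1" by (simp add: vec3_eq_iff)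
  then show "x \<in> cube_vertices" unfolding cube_vertices_def using r by blast
next
  assume "x \<in> cube_vertices"
  then obtain a b c where "x = a *\<^sub>R axis 1 1 + b *\<^sub>R axis 2 1 + c *\<^sub>R axis 3 1" "a \<in> {1, - 1}" "b \<in> {1, - 1}" "c \<in> {1, - 1}"
    unfolding cube_vertices_def by blast
  then show "x $ 1 \<in> {1, - 1} \<and> x $ 2 \<in> {1, - 1} \<and> x $ 3 \<in> {1, - 1}" by simp
qed

lemma finite_cube_vertices: "finite cube_vertices"
proof -
  have "cube_vertices \<subseteq> (\<lambda>(a, b, c). a *\<^sub>R axis 1 1 + b *\<^sub>R axis 2 1 + c *\<^sub>R axis 3 1) ` ({1, - 1} \<times> {1, - 1} \<times> {1, - 1})"
    unfolding cube_vertices_def by force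
  then show ?thesis by (rule finite_subset) simp
qed

lemma orthonormal_frame_axes: "orthonormal_frame (axis 1 1) (axis 2 1) (axis 3 1)"
  by (simp add: orthonormal_frame_def inner3)

lemma cube_cube_vertices: "cube (convex hull cube_vertices)"
  unfolding cube_def cube_vertices_def using orthonormal_frame_axes by blast

lemma cube_vertices_sphere: "cube_vertices \<subseteq> sphere 0 (sqrt 3)"
proof
  fix x assume "x \<in> cube_vertices"
  then show "x \<in> sphere 0 (sqrt 3)" unfolding cube_vertex_iff by (subst in_sphere3_iff) auto
qed

definition gr :: real where "gr = (1 + sqrt 5) / 2"

lemma gr_square: "gr * gr = gr + 1"
proof -
  have "sqrt 5 * sqrt 5 = (5::real)" by simp
  then show ?thesis by (simp add: gr_def field_simps)
qed

lemma gr_gt_1: "gr > 1" by (simp add: gr_def)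

definition icosahedron_vertices :: "(real^3) set" where
  "icosahedron_vertices = (\<Union>a \<in> {1, -1}. \<Union>b \<in> {1, -1}.
      {a *\<^sub>R axis 2 1 + (b * gr) *\<^sub>R axis 3 1, a *\<^sub>R axis 3 1 + (b * gr) *\<^sub>R axis 1 1, a *\<^sub>R axis 1 1 + (b * gr) *\<^sub>R axis 2 1})"

lemma icosahedron_vertex_iff:
  "x \<in> icosahedron_vertices \<longleftrightarrow> 
     x $ 1 = 0 \<and> x $ 2 \<in> {1, - 1} \<and> x $ 3 \<in> {gr, - gr} \<or>
     x $ 1 \<in> {gr, - gr} \<and> x $ 2 = 0 \<and> x $ 3 \<in> {1, - 1} \<or>
     x $ 1 \<in> {1, - 1} \<and> x $ 2 \<in> {gr, - gr} \<and> x $ 3 = 0"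
  unfolding icosahedron_vertices_def by (simp add: vec3_eq_iff) auto

lemma finite_icosahedron_vertices: "finite icosahedron_vertices"
  unfolding icosahedron_vertices_def by simp

lemma regular_icosahedron_vertices: "regular_icosahedron (convex hull icosahedron_vertices)"
  unfolding regular_icosahedron_def icosahedron_vertices_def
  using orthonormal_frame_axes gr_def by blast

text \<open>The squared radius is 1 + gr * gr, which the equation of the golden ratio turns into gr
  + 2.\<close>

lemma icosahedron_vertices_sphere: "icosahedron_vertices \<subseteq> sphere 0 (sqrt (gr + 2))"
proof
  fix x assume "x \<in> icosahedron_vertices"
  then show "x \<in> sphere 0 (sqrt (gr + 2))" unfolding icosahedron_vertex_iff 
    using gr_square gr_gt_1 by (subst in_sphere3_iff) (auto simp: power2_eq_square)
qed

text \<open>The axes of \<open>edge_halfturn\<close> and \<open>xflip\<close> pass through midpoints of edges, are orthogonal to the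
  vertex \<open>(0, 1, gr)\<close> and enclose an angle of 36 degrees; so the product of the two half-turns is the
  rotation by 72 degrees about that vertex.\<close>

definition edge_halfturn :: "real^3 \<Rightarrow> real^3" where
  "edge_halfturn = halfturn (vector [gr / 2, 1 / 2, (1 - gr) / 2])"

definition fifth :: "real^3 \<Rightarrow> real^3" where "fifth = edge_halfturn \<circ> xflip"

lemma edge_halfturn_components:
  fixes x :: "real^3"
  defines "k \<equiv> gr * x $ 1 + x $ 2 + (1 - gr) * x $ 3"
  shows "edge_halfturn x $ 1 = k * gr / 2 - x $ 1" "edge_halfturn x $ 2 = k / 2 - x $ 2" "edge_halfturn x $ 3 = k * (1 - gr) / 2 - x $ 3"
  unfolding edge_halfturn_def halfturn_def k_def by (simp_all add: inner3 field_simps)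

lemma rotation_edge_halfturn: "rotation edge_halfturn"
proof -
  have "(gr / 2)\<^sup>2 + (1 / 2)\<^sup>2 + ((1 - gr) / 2)\<^sup>2 = 1" using gr_square by (simp add: power2_eq_square field_simps)
  then have "norm (vector [gr / 2, 1 / 2, (1 - gr) / 2] :: real^3) = 1" by (simp add: norm3)
  then show ?thesis unfolding edge_halfturn_def by (rule rotation_halfturn)
qed

lemma rotation_fifth: "rotation fifth"
  unfolding fifth_def by (rule rotation_compose[OF rotation_edge_halfturn rotation_xflip])

lemma fifth_components:
  fixes x :: "real^3"
  defines "k \<equiv> gr * x $ 1 - x $ 2 - (1 - gr) * x $ 3"
  shows "fifth x $ 1 = k * gr / 2 - x $ 1" "fifth x $ 2 = k / 2 + x $ 2" "fifth x $ 3 = k * (1 - gr) / 2 + x $ 3"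
  unfolding fifth_def k_def by (simp_all add: edge_halfturn_components)

text \<open>The twelve vertices are the two ends of the axis of \<open>fifth\<close> and two
  pentagons around it, each pentagon listed in cyclic order.\<close>

lemma fifth_values:
  "fifth (vector [0, 1, gr]) = vector [0, 1, gr]" "fifth (vector [0, - 1, - gr]) = vector [0, - 1, - gr]"
  "fifth (vector [0, - 1, gr]) = vector [gr, 0, 1]" "fifth (vector [gr, 0, 1]) = vector [1, gr, 0]"
  "fifth (vector [1, gr, 0]) = vector [- 1, gr, 0]" "fifth (vector [- 1, gr, 0]) = vector [- gr, 0, 1]"
  "fifth (vector [- gr, 0, 1]) = vector [0, - 1, gr]"
  "fifth (vector [0, 1, - gr]) = vector [- gr, 0, - 1]" "fifth (vector [- gr, 0, - 1]) = vector [- 1, - gr, 0]"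
  "fifth (vector [- 1, - gr, 0]) = vector [1, - gr, 0]" "fifth (vector [1, - gr, 0]) = vector [gr, 0, - 1]"
  "fifth (vector [gr, 0, - 1]) = vector [0, 1, - gr]"
  using gr_square by (simp_all add: vec3_eq_iff fifth_components field_simps)

lemma fifth_vertices: "fifth ` icosahedron_vertices \<subseteq> icosahedron_vertices"
proof
  fix y assume "y \<in> fifth ` icosahedron_vertices"
  then obtain x where x: "x \<in> icosahedron_vertices" "y = fifth x" by blast
  have e: "x = vector [x $ 1, x $ 2, x $ 3]" by (simp add: vec3_eq_iff)
  from x(1) have "x \<in> {vector [0, 1, gr], vector [0, - 1, - gr], vector [0, - 1, gr], vector [gr, 0, 1], vector [1, gr, 0], vector [- 1, gr, 0],
    vector [- gr, 0, 1], vector [0, 1, - gr], vector [- gr, 0, - 1], vector [- 1, - gr, 0], vector [1, - gr, 0], vector [gr, 0, - 1]}"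
    unfolding icosahedron_vertex_iff by (auto simp: vec3_eq_iff)
  then show "y \<in> icosahedron_vertices" unfolding x(2) by (elim insertE emptyE; simp add: fifth_values icosahedron_vertex_iff)
qed

text \<open>The fifth power fixes the vertex on the axis and a vertex of one pentagon; these
  directions are independent, so it is the identity.\<close>

lemma fifth_pow: "(fifth ^^ 5) x = x"
proof -
  have "rotation (fifth ^^ n)" for n
    by (induction n) (simp_all only: funpow.simps rotation_id rotation_compose[OF rotation_fifth])
  then have "fifth ^^ 5 = id"
  proof (rule rotation_eqI[OF _ rotation_id])
    show "(fifth ^^ 5) (vector [0, 1, gr]) = id (vector [0, 1, gr])" 
      "(fifth ^^ 5) (vector [0, - 1, gr]) = id (vector [0, - 1, gr])" by (simp_all add: numeral_eq_Suc fifth_values)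
    show "cross3 (vector [0, 1, gr]) (vector [0, - 1, gr]) \<noteq> 0" using gr_gt_1 by (simp add: vec3_eq_iff cross_components)
  qed
  then show ?thesis by simp
qed

lemma fifth_order_dvd:
  assumes "\<forall>x\<in>sphere 0 1. (fifth ^^ j) x = x" shows "5 dvd j"
proof (rule rotation_prime_order_dvd[where \<rho> = fifth and x = "axis 1 1", OF _ fifth_pow _ _ assms])
  show "fifth (axis 1 1) \<noteq> axis 1 1" using gr_gt_1 by (simp add: vec3_eq_iff fifth_components)
qed simp_all


text \<open>The special directions are a vertex, the face centre opposite to it and an edge
  midpoint, fixed by \<open>cyc\<close>, \<open>cyc\<close> and \<open>zflip\<close>. Vertices and
  face centres are antipodal, so the face centre can be separated from the edge midpoint by negating
  both.\<close>

lemma tetrahedral_rotation_group: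
  defines "V \<equiv> tetrahedron_vertices"
  defines "G \<equiv> rotational_symmetries (convex hull V)"
  shows "rotation_group G" "cyc \<in> G" "zflip \<in> G"
    "\<And>g. g \<in> G \<Longrightarrow> - diagonal \<noteq> g diagonal" "\<And>g. g \<in> G \<Longrightarrow> axis 3 1 \<noteq> g diagonal" "\<And>g. g \<in> G \<Longrightarrow> axis 3 1 \<noteq> g (- diagonal)"
proof -
  have fin: "finite V" by (simp add: V_def tetrahedron_vertices_def)
  have d: "diagonal \<in> V" by (simp add: V_def tetrahedron_vertices_def diagonal_def)
  have w: "(1 / sqrt 3) *\<^sub>R vector [1, - 1, - 1] \<in> V" by (simp add: V_def tetrahedron_vertices_def)
  show "rotation_group G" unfolding G_def
    by (rule polyhedral_rotation_group[OF tetrahedron_vertices_sphere[folded V_def] fin d w]) (simp add: vec3_eq_iff cross_components)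
  have inG: "g \<in> G" if "rotation g" "\<And>x. x \<in> V \<Longrightarrow> g x \<in> V" for g
    unfolding G_def by (rule rotational_symmetryI[OF fin that(1)]) (use that(2) in blast)
  show "cyc \<in> G"
  proof (rule inG[OF rotation_coordinates(1)])
    fix x assume "x \<in> V"
    then show "cyc x \<in> V" unfolding V_def by (auto simp: tetrahedron_vertices_def vec3_eq_iff)
  qed
  show "zflip \<in> G"
  proof (rule inG[OF rotation_coordinates(3)])
    fix x assume "x \<in> V"
    then show "zflip x \<in> V" unfolding V_def by (auto simp: tetrahedron_vertices_def vec3_eq_iff)
  qed
  fix g assume g: "g \<in> G"
  have r: "rotation g" and gV: "g ` V = V"
    using g rotational_symmetry_vertices[OF tetrahedron_vertices_sphere[folded V_def] fin] by (auto simp: G_def rotational_symmetries_def)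
  have nV: "1 *\<^sub>R (- diagonal) \<notin> V" "1 *\<^sub>R axis 3 1 \<notin> V" "1 *\<^sub>R (- axis 3 1) \<notin> V"
    by (auto simp: V_def tetrahedron_vertices_def vec3_eq_iff)
  have v: "diagonal = 1 *\<^sub>R diagonal" by simp
  show "- diagonal \<noteq> g diagonal" by (rule vertex_direction_orbit[OF r gV d v nV(1)])
  show "axis 3 1 \<noteq> g diagonal" by (rule vertex_direction_orbit[OF r gV d v nV(2)])
  have "- axis 3 1 \<noteq> g diagonal" by (rule vertex_direction_orbit[OF r gV d v nV(3)])
  then show "axis 3 1 \<noteq> g (- diagonal)" unfolding linear_neg[OF rotation_linear[OF r]] by (metis minus_minus)
qed

text \<open>For the cube this is the direction of an edge midpoint: (1, 1, 0) is halfway between the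
  vertices (1, 1, 1) and (1, 1, -1).\<close>

definition face_diagonal :: "real^3" where "face_diagonal = (1 / sqrt 2) *\<^sub>R vector [1, 1, 0]"

lemma face_diagonal_components [simp]: 
  "face_diagonal $ 1 = 1 / sqrt 2" "face_diagonal $ 2 = 1 / sqrt 2" "face_diagonal $ 3 = 0"
  by (simp_all add: face_diagonal_def)

text \<open>The special directions are a vertex, a face centre and an edge midpoint, fixed by
  \<open>cyc\<close>, \<open>quarter\<close> and \<open>swap\<close>. The last two are told apart by
  orthogonality: (1, -1, 1) is a vertex orthogonal to the edge midpoint, while no vertex is
  orthogonal to a face centre.\<close>

lemma octahedral_rotation_group:
  defines "G \<equiv> rotational_symmetries (convex hull cube_vertices)"
  shows "rotation_group G" "cyc \<in> G" "quarter \<in> G" "swap \<in> G"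
    "\<And>g. g \<in> G \<Longrightarrow> axis 3 1 \<noteq> g diagonal" "\<And>g. g \<in> G \<Longrightarrow> face_diagonal \<noteq> g diagonal" "\<And>g. g \<in> G \<Longrightarrow> face_diagonal \<noteq> g (axis 3 1)"
proof -
  note V = cube_vertices_sphere finite_cube_vertices
  have d: "sqrt 3 *\<^sub>R diagonal \<in> cube_vertices" by (simp add: cube_vertex_iff)
  have w: "vector [1, - 1, 1] \<in> cube_vertices" by (simp add: cube_vertex_iff)
  show "rotation_group G" unfolding G_def
    by (rule polyhedral_rotation_group[OF V d w]) (simp add: vec3_eq_iff cross_components)
  have inG: "g \<in> G" if "rotation g" "\<And>x. x \<in> cube_vertices \<Longrightarrow> g x \<in> cube_vertices" for g
    unfolding G_def by (rule rotational_symmetryI[OF V(2) that(1)]) (use that(2) in blast)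
  show "cyc \<in> G" by (rule inG[OF rotation_coordinates(1)]) (auto simp: cube_vertex_iff)
  show "quarter \<in> G" by (rule inG[OF rotation_coordinates(2)]) (auto simp: cube_vertex_iff)
  show "swap \<in> G" by (rule inG[OF rotation_coordinates(4)]) (auto simp: cube_vertex_iff)
  fix g assume g: "g \<in> G"
  have r: "rotation g" and gV: "g ` cube_vertices = cube_vertices"
    using g rotational_symmetry_vertices[OF V] by (auto simp: G_def rotational_symmetries_def)
  show "axis 3 1 \<noteq> g diagonal" by (rule vertex_direction_orbit[OF r gV d refl]) (simp add: cube_vertex_iff)
  show "face_diagonal \<noteq> g diagonal" by (rule vertex_direction_orbit[OF r gV d refl]) (simp add: cube_vertex_iff)
  show "face_diagonal \<noteq> g (axis 3 1)"
    by (rule orthogonal_vertex_orbit[OF r gV w]) (auto simp: inner3 cube_vertex_iff)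
qed

definition vertex_direction :: "real^3" where "vertex_direction = (1 / sqrt (gr + 2)) *\<^sub>R vector [0, 1, gr]"

lemma vertex_direction_components [simp]: 
  "vertex_direction $ 1 = 0" "vertex_direction $ 2 = 1 / sqrt (gr + 2)" "vertex_direction $ 3 = gr / sqrt (gr + 2)"
  by (simp_all add: vertex_direction_def)

lemma vertex_direction_sphere: "vertex_direction \<in> sphere 0 1"
proof -
  have "1 + gr * gr = gr + 2" using gr_square by simp
  then show ?thesis unfolding sphere3_iff using gr_gt_1
    by (simp add: power_divide power2_eq_square[of gr] flip: add_divide_distrib)
qed

text \<open>The special directions are a vertex, the centre of the face (0, 1, gr), (gr, 0, 1), (1,
  gr, 0), and the midpoint of the edge joining (0, 1, gr) to (0, -1, gr). The vertex (1, gr, 0) is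
  orthogonal to the edge midpoint, but no vertex is orthogonal to the face centre, since its
  coordinates never sum to 0.\<close>

lemma icosahedral_rotation_group:
  defines "G \<equiv> rotational_symmetries (convex hull icosahedron_vertices)"
  shows "rotation_group G" "cyc \<in> G" "zflip \<in> G" "fifth \<in> G"
    "\<And>g. g \<in> G \<Longrightarrow> diagonal \<noteq> g vertex_direction" "\<And>g. g \<in> G \<Longrightarrow> axis 3 1 \<noteq> g vertex_direction" "\<And>g. g \<in> G \<Longrightarrow> axis 3 1 \<noteq> g diagonal"
proof -
  note V = icosahedron_vertices_sphere finite_icosahedron_vertices
  have s: "sqrt (gr + 2) > 0" using gr_gt_1 by simp
  have d: "sqrt (gr + 2) *\<^sub>R vertex_direction \<in> icosahedron_vertices" using s by (simp add: icosahedron_vertex_iff)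
  have w: "vector [1, gr, 0] \<in> icosahedron_vertices" by (simp add: icosahedron_vertex_iff)
  show "rotation_group G" unfolding G_def
    by (rule polyhedral_rotation_group[OF V d w]) (use s gr_gt_1 in \<open>simp add: vec3_eq_iff cross_components\<close>)
  have inG: "g \<in> G" if "rotation g" "\<And>x. x \<in> icosahedron_vertices \<Longrightarrow> g x \<in> icosahedron_vertices" for g
    unfolding G_def by (rule rotational_symmetryI[OF V(2) that(1)]) (use that(2) in blast)
  show "cyc \<in> G" by (rule inG[OF rotation_coordinates(1)]) (auto simp: icosahedron_vertex_iff)
  show "zflip \<in> G" by (rule inG[OF rotation_coordinates(3)]) (auto simp: icosahedron_vertex_iff)
  show "fifth \<in> G" by (rule inG[OF rotation_fifth]) (use fifth_vertices in blast)
  fix g assume g: "g \<in> G"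
  have r: "rotation g" and gV: "g ` icosahedron_vertices = icosahedron_vertices"
    using g rotational_symmetry_vertices[OF V] by (auto simp: G_def rotational_symmetries_def)
  show "diagonal \<noteq> g vertex_direction" 
    by (rule vertex_direction_orbit[OF r gV d refl]) (use s gr_gt_1 in \<open>simp add: icosahedron_vertex_iff\<close>)
  show "axis 3 1 \<noteq> g vertex_direction" 
    by (rule vertex_direction_orbit[OF r gV d refl]) (use s gr_gt_1 in \<open>simp add: icosahedron_vertex_iff\<close>)
  have nz: "w \<bullet> diagonal \<noteq> 0" if "w \<in> icosahedron_vertices" for w
  proof -
    have "w \<bullet> diagonal = (w $ 1 + w $ 2 + w $ 3) / sqrt 3" by (simp add: inner3 add_divide_distrib)
    then show ?thesis using that gr_gt_1 unfolding icosahedron_vertex_iff by auto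
  qed
  have z: "vector [1, gr, 0] \<bullet> (axis 3 1 :: real^3) = 0" unfolding inner3 by simp
  show "axis 3 1 \<noteq> g diagonal" by (rule orthogonal_vertex_orbit[OF r gV w z nz])
qed

section \<open>The branching types and their groups\<close>

lemma branching_type_three:
  assumes P: "finite P" and t: "branching_type P n = {#a, b, c#}"
  obtains p1 p2 p3 where "P = {p1, p2, p3}" "p1 \<noteq> p2" "p1 \<noteq> p3" "p2 \<noteq> p3" "n p1 = a" "n p2 = b" "n p3 = c"
proof -
  obtain p1 M1 where 1: "mset_set P = add_mset p1 M1" "n p1 = a" "image_mset n M1 = {#b, c#}"
    using msed_map_invR[of n "mset_set P" a "{#b, c#}"] t unfolding branching_type_def by metis
  obtain p2 M2 where 2: "M1 = add_mset p2 M2" "n p2 = b" "image_mset n M2 = {#c#}"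
    using msed_map_invR[of n M1 b "{#c#}"] 1(3) by metis
  obtain p3 M3 where 3: "M2 = add_mset p3 M3" "n p3 = c" "image_mset n M3 = {#}"
    using msed_map_invR[of n M2 c "{#}"] 2(3) by metis
  have e: "mset_set P = {#p1, p2, p3#}" using 1(1) 2(1) 3(1,3) by simp
  have "P = set_mset (mset_set P)" using P by simp
  then have PP: "P = {p1, p2, p3}" unfolding e by simp
  \<comment> \<open>\<open>mset_set\<close> counts every point once, so the three points are
    distinct even when weights coincide.\<close>
  have "card P = 3" using arg_cong[OF e, of size] by simp
  then have "p1 \<noteq> p2" "p1 \<noteq> p3" "p2 \<noteq> p3" unfolding PP by (auto simp: card_insert_if split: if_splits)
  then show ?thesis using that PP 1 2 3 by blast
qed

lemma branching_type_two:
  assumes P: "finite P" and t: "branching_type P n = {#a, b#}"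
  obtains p1 p2 where "P = {p1, p2}" "p1 \<noteq> p2" "n p1 = a" "n p2 = b"
proof -
  obtain p1 M1 where 1: "mset_set P = add_mset p1 M1" "n p1 = a" "image_mset n M1 = {#b#}"
    using msed_map_invR[of n "mset_set P" a "{#b#}"] t unfolding branching_type_def by metis
  obtain p2 M2 where 2: "M1 = add_mset p2 M2" "n p2 = b" "image_mset n M2 = {#}"
    using msed_map_invR[of n M1 b "{#}"] 1(3) by metis
  have e: "mset_set P = {#p1, p2#}" using 1(1) 2(1,3) by simp
  have "P = set_mset (mset_set P)" using P by simp
  then have PP: "P = {p1, p2}" unfolding e by simp
  have "card P = 2" using arg_cong[OF e, of size] by simp
  then have "p1 \<noteq> p2" unfolding PP by (auto simp: card_insert_if split: if_splits)
  then show ?thesis using that PP 1 2 by blast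
qed

lemma listed_cyclic: "m \<ge> 1 \<Longrightarrow> listed_rotation_group (cyclic_rotations m)"
  unfolding listed_rotation_group_def cyclic_rotation_group_def cyclic_rotations_def by (intro disjI1 exI[of _ m] conjI exI[of _ "axis 3 1"]) simp_all

lemma listed_dihedral: assumes "m \<ge> 2" shows "listed_rotation_group (dihedral_rotations m)"
proof -
  have "orthonormal_pair (axis 1 1) (axis 2 1)" by (simp add: orthonormal_pair_def inner3)
  then have "regular_polygon_on_big_circle m (convex hull (polygon_vertices m)) (range vz)"
    unfolding regular_polygon_on_big_circle_def polygon_vertices_def vz_def
    by (intro exI[of _ "axis 1 1"] exI[of _ "axis 2 1"] conjI) auto
  then show ?thesis unfolding listed_rotation_group_def dihedral_rotation_group_def dihedral_rotations_def using assms by blast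
qed

lemma cyclic_case:
  assumes f: "branched_covering X riemann_sphere f" and sub: "subject_to X riemann_sphere f {p1, p2} n"
    and p: "p1 \<in> sphere 0 1" "p2 \<in> sphere 0 1" "p1 \<noteq> p2" and k: "k \<ge> 2" "n p1 = k" "n p2 = k"
  shows "biholomorphic X riemann_sphere \<and>
     (\<exists>F. biholomorphism (quotient_surface riemann_sphere (cyclic_rotations k)) riemann_sphere F \<and>
          dominates riemann_sphere X riemann_sphere (F \<circ> orbit (cyclic_rotations k)) f)"
proof -
  \<comment> \<open>A third point outside the datum is paired with the horizontal point
    \<open>axis 1 1\<close>, so that the Moebius transformation is fixed by three points here too;
    the stabiliser condition concerns \<open>p1\<close> and \<open>p2\<close> alone.\<close>
  have "infinite (sphere (0::real^3) 1)" by (rule infinite_openin_sphere) auto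
  then have "infinite (sphere (0::real^3) 1 - {p1, p2})" by simp
  then obtain p3 where p3: "p3 \<in> sphere 0 1" "p1 \<noteq> p3" "p2 \<noteq> p3" by (metis DiffE ex_in_conv finite.emptyI insertCI)
  have k0: "k > 0" using k(1) by simp
  have fixed_axis: "g (axis 3 1) = axis 3 1" "g (- axis 3 1) = - axis 3 1" if "g \<in> cyclic_rotations k" for g
    using that by (auto simp: cyclic_rotations_def vec3_eq_iff)
  have rG: "rz (2 * pi / real k) \<in> cyclic_rotations k" using cyclic_rotationsI[OF k0, of 1] by simp
  have ne: "axis 1 1 \<noteq> (axis 3 1 :: real^3)" "axis 1 1 \<noteq> (- axis 3 1 :: real^3)" "- axis 3 1 \<noteq> (axis 3 1 :: real^3)"
    by (simp_all add: vec3_eq_iff)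
  show ?thesis
  proof (rule dominated_by_rotation_group_quotient[OF f sub _ p(1,2) p3(1) p(3) p3(2,3), where ?s1.0 = "axis 3 1" and ?s2.0 = "- axis 3 1" and ?s3.0 = "axis 1 1"])
    show "rotation_group (cyclic_rotations k)" by (rule rotation_group_cyclic[OF k0])
    fix p s :: "real^3" assume "(p, s) \<in> {(p1, axis 3 1), (p2, - axis 3 1), (p3, axis 1 1)}" "p \<in> {p1, p2}"
    then have ps: "n p = k" "s = axis 3 1 \<or> s = - axis 3 1" using k p3 by auto
    then have "rz (2 * pi / real k) s = s" using fixed_axis[OF rG] by blast
    then show "n p \<ge> 1 \<and> (\<exists>\<rho>\<in>cyclic_rotations k. \<rho> s = s \<and> (\<forall>j. (\<forall>x\<in>sphere 0 1. (\<rho> ^^ j) x = x) \<longrightarrow> n p dvd j))"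
      using rG rz_order_dvd[OF k0] k0 unfolding ps(1) by (intro conjI bexI[of _ "rz (2 * pi / real k)"]) auto
  next
    show "- axis 3 1 \<noteq> g (axis 3 1)" "axis 1 1 \<noteq> g (axis 3 1)" "axis 1 1 \<noteq> g (- axis 3 1)" 
      if "g \<in> cyclic_rotations k" for g
      unfolding fixed_axis[OF that] by (rule ne)+
  qed auto
qed

lemma triangle_case:
  assumes f: "branched_covering X riemann_sphere f" and sub: "subject_to X riemann_sphere f {p1, p2, p3} n"
    and p: "p1 \<in> sphere 0 1" "p2 \<in> sphere 0 1" "p3 \<in> sphere 0 1" "p1 \<noteq> p2" "p1 \<noteq> p3" "p2 \<noteq> p3" 
    and np: "n p1 \<ge> 1" "n p2 \<ge> 1" "n p3 \<ge> 1"
    and G: "listed_rotation_group G" "rotation_group G" and s: "s1 \<in> sphere 0 1" "s2 \<in> sphere 0 1" "s3 \<in> sphere 0 1" 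
      "\<And>\<gamma>. \<gamma> \<in> G \<Longrightarrow> s2 \<noteq> \<gamma> s1" "\<And>\<gamma>. \<gamma> \<in> G \<Longrightarrow> s3 \<noteq> \<gamma> s1" "\<And>\<gamma>. \<gamma> \<in> G \<Longrightarrow> s3 \<noteq> \<gamma> s2"
    and stab: "\<rho>1 \<in> G" "\<rho>1 s1 = s1" "\<And>j. \<forall>x\<in>sphere 0 1. (\<rho>1 ^^ j) x = x \<Longrightarrow> n p1 dvd j"
      "\<rho>2 \<in> G" "\<rho>2 s2 = s2" "\<And>j. \<forall>x\<in>sphere 0 1. (\<rho>2 ^^ j) x = x \<Longrightarrow> n p2 dvd j"
      "\<rho>3 \<in> G" "\<rho>3 s3 = s3" "\<And>j. \<forall>x\<in>sphere 0 1. (\<rho>3 ^^ j) x = x \<Longrightarrow> n p3 dvd j"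
  shows "biholomorphic X riemann_sphere \<and>
         (\<exists>G F. listed_rotation_group G \<and>
                biholomorphism (quotient_surface riemann_sphere G) riemann_sphere F \<and>
                dominates riemann_sphere X riemann_sphere (F \<circ> orbit G) f)"
proof -
  have "biholomorphic X riemann_sphere \<and>
     (\<exists>F. biholomorphism (quotient_surface riemann_sphere G) riemann_sphere F \<and>
          dominates riemann_sphere X riemann_sphere (F \<circ> orbit G) f)"
  proof (rule dominated_by_rotation_group_quotient[where G = G and ?s1.0 = s1 and ?s2.0 = s2 and ?s3.0 = s3, OF f sub subset_refl p s(1,2,3)])
    show "rotation_group G" by (rule G(2))
    show "s2 \<noteq> \<gamma> s1" "s3 \<noteq> \<gamma> s1" "s3 \<noteq> \<gamma> s2" if "\<gamma> \<in> G" for \<gamma>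
      by (rule s(4-6)[OF that])+
    fix p s :: "real^3" assume "(p, s) \<in> {(p1, s1), (p2, s2), (p3, s3)}"
    then consider "p = p1" "s = s1" | "p = p2" "s = s2" | "p = p3" "s = s3" by blast
    then show "n p \<ge> 1 \<and> (\<exists>\<rho>\<in>G. \<rho> s = s \<and> (\<forall>j. (\<forall>x\<in>sphere 0 1. (\<rho> ^^ j) x = x) \<longrightarrow> n p dvd j))"
      by cases (use np stab in blast)+
  qed
  then show ?thesis using G(1) by blast
qed

text \<open>The special directions are a vertex of the k-gon, the midpoint of an edge and a pole,
  with stabilising rotations of orders 2, 2 and k.\<close>

lemma dihedral_case:
  assumes f: "branched_covering X riemann_sphere f" and sub: "subject_to X riemann_sphere f {p1, p2, p3} n"
    and p: "p1 \<in> sphere 0 1" "p2 \<in> sphere 0 1" "p3 \<in> sphere 0 1" "p1 \<noteq> p2" "p1 \<noteq> p3" "p2 \<noteq> p3" 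
    and n: "n p1 = 2" "n p2 = 2" "n p3 = k" and k: "k \<ge> 2"
  shows "biholomorphic X riemann_sphere \<and>
         (\<exists>G F. listed_rotation_group G \<and>
                biholomorphism (quotient_surface riemann_sphere G) riemann_sphere F \<and>
                dominates riemann_sphere X riemann_sphere (F \<circ> orbit G) f)"
proof -
  have k0: "k > 0" using k by simp
  let ?G = "dihedral_rotations k"
  let ?a = "2 * pi / real k"
  have v0: "vz 0 \<in> polygon_vertices k" using polygon_verticesI[OF k0, of 0] by simp
  \<comment> \<open>A parity argument: if half a step along the polygon led to a vertex, 1 would be
    even. As symmetries permute the vertices, this separates edge midpoints from vertices.\<close>
  have vm: "vz (pi / real k) \<notin> polygon_vertices k"
  proof
    assume "vz (pi / real k) \<in> polygon_vertices k"
    then obtain j where "vz (pi / real k) = vz (2 * pi * real j / real k)" unfolding polygon_vertices_def by blast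
    then obtain i :: int where "pi / real k = 2 * pi * real j / real k + 2 * pi * i" unfolding vz_eq_iff by blast
    then have "pi * 1 = pi * (2 * (real j + of_int i * real k))" using k0 by (simp add: field_simps)
    then have "1 = 2 * (real j + of_int i * real k)" by (metis mult_left_cancel pi_neq_zero)
    then have "of_int 1 = (of_int (2 * (int j + i * int k)) :: real)" by simp
    then have "1 = 2 * (int j + i * int k)" unfolding of_int_eq_iff .
    then have "even (1::int)" by (metis dvd_triv_left)
    then show False by simp
  qed
  \<comment> \<open>On the circle \<open>xflip\<close> is t -> -t, so this composite is t -> 2 * pi
    / k - t, whose fixed angle pi / k is the midpoint of an edge.\<close>
  have m: "(rz ?a \<circ> xflip) (vz (pi / real k)) = vz (pi / real k)"
    by (simp add: xflip_vz rz_vz)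
  have mG: "rz ?a \<circ> xflip \<in> ?G" 
    by (rule rotation_groupD(4)[OF rotation_group_dihedral[OF k0] dihedral_rotations_rz[OF k0] dihedral_rotations_xflip[OF k0]])
  have invol: "(rz ?a \<circ> xflip) ((rz ?a \<circ> xflip) x) = x" for x
  proof -
    have "xflip (rz ?a y) = rz (- ?a) (xflip y)" for y by (simp add: vec3_eq_iff)
    then show ?thesis using rz_full_turn[of 0] by (simp add: rz_add)
  qed
  show ?thesis
  proof (rule triangle_case[OF f sub p, where G = ?G and ?s1.0 = "vz 0" and ?s2.0 = "vz (pi / real k)" and ?s3.0 = "axis 3 1" and
      ?\<rho>1.0 = xflip and ?\<rho>2.0 = "rz ?a \<circ> xflip" and ?\<rho>3.0 = "rz ?a"])
    show "listed_rotation_group ?G" by (rule listed_dihedral[OF k])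
    show "rotation_group ?G" by (rule rotation_group_dihedral[OF k0])
    show "vz (pi / real k) \<noteq> g (vz 0)" if "g \<in> ?G" for g
    proof
      assume "vz (pi / real k) = g (vz 0)"
      then show False using vm v0 dihedral_rotationsD(2)[OF that] by (metis imageI)
    qed
    show "axis 3 1 \<noteq> g (vz 0)" "axis 3 1 \<noteq> g (vz (pi / real k))" if "g \<in> ?G" for g
      using dihedral_rotationsD(3)[OF that] axis3_components(3) by (metis zero_neq_one)+
    show "xflip \<in> ?G" by (rule dihedral_rotations_xflip[OF k0])
    show "rz ?a \<circ> xflip \<in> ?G" by (rule mG)
    show "rz ?a \<in> ?G" by (rule dihedral_rotations_rz[OF k0])
    show "(rz ?a \<circ> xflip) (vz (pi / real k)) = vz (pi / real k)" by (rule m)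
    show "n p1 dvd j" if "\<forall>x\<in>sphere 0 1. (xflip ^^ j) x = x" for j using xflip_order_dvd[OF that] n by simp
    show "n p2 dvd j" if "\<forall>x\<in>sphere 0 1. ((rz ?a \<circ> xflip) ^^ j) x = x" for j
    proof -
      have "(rz ?a \<circ> xflip) (axis 3 1) \<noteq> axis 3 1" by (simp add: vec3_eq_iff)
      then show ?thesis using involution_order_dvd[OF invol _ _ that, of "axis 3 1"] n by simp
    qed
    show "n p3 dvd j" if "\<forall>x\<in>sphere 0 1. (rz ?a ^^ j) x = x" for j using rz_order_dvd[OF k0 that] n by simp
  qed (use n k vz_in_sphere in \<open>auto simp: xflip_vz vec3_eq_iff simp del: mem_sphere_0\<close>)
qed

theorem theorem8:
  fixes X :: "'a surface" and f :: "'a \<Rightarrow> real^3"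
    and P :: "(real^3) set" and n :: "real^3 \<Rightarrow> nat"
  assumes "branched_covering X riemann_sphere f"
    and "branching_datum riemann_sphere P n"
    and "(\<exists>k \<ge> 2. branching_type P n = {#k, k#} \<or> branching_type P n = {#2, 2, k#}) \<or>
         branching_type P n \<in> {{#2, 3, 3#}, {#2, 3, 4#}, {#2, 3, 5#}}"
    and "subject_to X riemann_sphere f P n"
  shows "biholomorphic X riemann_sphere \<and>
         (\<exists>G F. listed_rotation_group G \<and>
                biholomorphism (quotient_surface riemann_sphere G) riemann_sphere F \<and>
                dominates riemann_sphere X riemann_sphere (F \<circ> orbit G) f)"
proof -
  note f = assms(1) and sub = assms(4)
  have P: "finite P" "P \<subseteq> sphere 0 1" using assms(2) by (simp_all add: branching_datum_def)
  consider (cyclic) k where "k \<ge> 2" "branching_type P n = {#k, k#}"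
    | (dihedral) k where "k \<ge> 2" "branching_type P n = {#2, 2, k#}"
    | (triangle) k where "branching_type P n = {#2, 3, k#}" "k = 3 \<or> k = 4 \<or> k = 5"
    using assms(3) by blast
  then show ?thesis
  proof cases
    case cyclic
    obtain p1 p2 where p: "P = {p1, p2}" "p1 \<noteq> p2" "n p1 = k" "n p2 = k"
      by (rule branching_type_two[OF P(1) cyclic(2)]) (rule that)
    have s: "p1 \<in> sphere 0 1" "p2 \<in> sphere 0 1" using P(2) unfolding p(1) by blast+
    show ?thesis using cyclic_case[OF f sub[unfolded p(1)] s p(2) cyclic(1) p(3,4)] listed_cyclic[of k] cyclic(1) by auto
  next
    case dihedral
    obtain p1 p2 p3 where p: "P = {p1, p2, p3}" "p1 \<noteq> p2" "p1 \<noteq> p3" "p2 \<noteq> p3" "n p1 = 2" "n p2 = 2" "n p3 = k"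
      by (rule branching_type_three[OF P(1) dihedral(2)]) (rule that)
    have s: "p1 \<in> sphere 0 1" "p2 \<in> sphere 0 1" "p3 \<in> sphere 0 1" using P(2) unfolding p(1) by blast+
    show ?thesis by (rule dihedral_case[OF f sub[unfolded p(1)] s p(2-7) dihedral(1)])
  next
    case triangle
    obtain p1 p2 p3 where p: "P = {p1, p2, p3}" "p1 \<noteq> p2" "p1 \<noteq> p3" "p2 \<noteq> p3" and n: "n p1 = 2" "n p2 = 3" "n p3 = k"
      by (rule branching_type_three[OF P(1) triangle(1)]) (rule that)
    have s: "p1 \<in> sphere 0 1" "p2 \<in> sphere 0 1" "p3 \<in> sphere 0 1" using P(2) unfolding p(1) by blast+
    have e3: "axis 3 1 \<in> sphere (0::real^3) 1" "zflip (axis 3 1) = axis 3 1" "quarter (axis 3 1) = axis 3 1" by (simp_all add: vec3_eq_iff)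
    have n1: "n p1 \<ge> 1" "n p2 \<ge> 1" "n p3 \<ge> 1" using n triangle(2) by auto
    \<comment> \<open>The points are reordered to match the special directions, where a vertex
      direction has to come first and an edge midpoint last: the weights become 3, k, 2 for the
      tetrahedron and cube and 5, 3, 2 for the icosahedron.\<close>
    have sub': "subject_to X riemann_sphere f {p2, p3, p1} n" "subject_to X riemann_sphere f {p3, p2, p1} n" 
      using sub unfolding p(1) by (simp_all add: insert_commute)
    have d2: "n p1 dvd j" if "\<forall>x\<in>sphere 0 1. (zflip ^^ j) x = x" for j using zflip_order_dvd[OF that] n by simp
    have d2': "n p1 dvd j" if "\<forall>x\<in>sphere 0 1. (swap ^^ j) x = x" for j using swap_order_dvd[OF that] n by simp
    have d3: "n p2 dvd j" if "\<forall>x\<in>sphere 0 1. (cyc ^^ j) x = x" for j using cyc_order_dvd[OF that] n by simp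
    consider "k = 3" | "k = 4" | "k = 5" using triangle(2) by blast
    then show ?thesis
    proof cases
      case 1
      have l: "listed_rotation_group (rotational_symmetries (convex hull tetrahedron_vertices))"
        unfolding listed_rotation_group_def using regular_tetrahedron_vertices by blast
      note T = tetrahedral_rotation_group
      have d3': "n p3 dvd j" if "\<forall>x\<in>sphere 0 1. (cyc ^^ j) x = x" for j using cyc_order_dvd[OF that] n 1 by simp
      show ?thesis
        by (rule triangle_case[where G = "rotational_symmetries (convex hull tetrahedron_vertices)" and ?s1.0 = "diagonal" and ?s2.0 = "- diagonal" and ?s3.0 = "axis 3 1" and
            ?\<rho>1.0 = cyc and ?\<rho>2.0 = cyc and ?\<rho>3.0 = zflip, OF f sub'(1) s(2,3,1) p(4) p(2)[symmetric] p(3)[symmetric] n1(2,3,1) l T(1) diagonal_sphere e3(1)])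
           (rule T cyc_diagonal d3 d3' e3 d2 | assumption)+
    next
      case 2
      have l: "listed_rotation_group (rotational_symmetries (convex hull cube_vertices))"
        unfolding listed_rotation_group_def using cube_cube_vertices by blast
      note T = octahedral_rotation_group
      have d4: "n p3 dvd j" if "\<forall>x\<in>sphere 0 1. (quarter ^^ j) x = x" for j using quarter_order_dvd[OF that] n 2 by simp
      have fd: "face_diagonal \<in> sphere 0 1" "swap face_diagonal = face_diagonal" 
        unfolding sphere3_iff by (simp_all add: vec3_eq_iff power_divide)
      show ?thesis
        by (rule triangle_case[where G = "rotational_symmetries (convex hull cube_vertices)" and ?s1.0 = "diagonal" and ?s2.0 = "axis 3 1" and ?s3.0 = "face_diagonal" and
            ?\<rho>1.0 = cyc and ?\<rho>2.0 = quarter and ?\<rho>3.0 = swap, OF f sub'(1) s(2,3,1) p(4) p(2)[symmetric] p(3)[symmetric] n1(2,3,1) l T(1) diagonal_sphere(1) e3(1) fd(1)])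
           (rule T cyc_diagonal d3 d4 e3 fd d2' | assumption)+
    next
      case 3
      have l: "listed_rotation_group (rotational_symmetries (convex hull icosahedron_vertices))"
        unfolding listed_rotation_group_def using regular_icosahedron_vertices by blast
      note T = icosahedral_rotation_group
      have d5: "n p3 dvd j" if "\<forall>x\<in>sphere 0 1. (fifth ^^ j) x = x" for j using fifth_order_dvd[OF that] n 3 by simp
      have fv: "fifth vertex_direction = vertex_direction"
        unfolding vertex_direction_def linear_cmul[OF rotation_linear[OF rotation_fifth]] fifth_values ..
      show ?thesis
        by (rule triangle_case[where G = "rotational_symmetries (convex hull icosahedron_vertices)" and ?s1.0 = "vertex_direction" and ?s2.0 = "diagonal" and ?s3.0 = "axis 3 1" and
            ?\<rho>1.0 = fifth and ?\<rho>2.0 = cyc and ?\<rho>3.0 = zflip, OF f sub'(2) s(3,2,1) p(4)[symmetric] p(3)[symmetric] p(2)[symmetric] n1(3,2,1) l T(1) vertex_direction_sphere diagonal_sphere(1) e3(1)])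
           (rule T fv d5 cyc_diagonal d3 e3 d2 | assumption)+
    qed
  qed
qed

end
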